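(* Let $\Lambda$ be a $k$-graph. For each $r\ge0$, the map $\Phi_*:H_r(\Lambda)\to H_r^{\mathrm{top}}(X_\Lambda)$ from the homology of $\Lambda$ to the singular homology of its topological realisation $X_\Lambda$ is an isomorphism. Moreover this isomorphism is natural in $\Lambda$ (with respect to $k$-graph morphisms).
   Context: Conventions: $0\in\mathbb{N}$ and $\mathbb{N}^0=\{0\}$. A $k$-graph ($k\ge0$) is a nonempty countable small category $\Lambda$ with a functor $d:\Lambda\to\mathbb{N}^k$ (the degree) satisfying the factorisation property: whenever $d(\lambda)=m+n$ there are unique $\mu,\nu\in\Lambda$ with $d(\mu)=m$, $d(\nu)=n$, $\lambda=\mu\nu$. Objects are identified with identity morphisms; $\Lambda^n=d^{-1}(n)$. For $0\le m\le n\le d(\lambda)$, $\lambda(m,n)$ is the unique $\beta\in\Lambda^{n-m}$ with $\lambda=\alpha\beta\gamma$ for some $\alpha\in\Lambda^m$, $\gamma\in\Lambda^{d(\lambda)-n}$. $e_1,\dots,e_k$ are the standard generators of $\mathbb{N}^k$, $\mathbf{1}_k=\sum_i e_i$, $\le$ is coordinatewise, $|n|=\sum_i n_i$. A $k$-graph morphism is a degree-preserving functor. Homology: $Q_r(\Lambda)=\{\lambda\in\Lambda: d(\lambda)\le\mathbf{1}_k,\ |d(\lambda)|=r\}$. For $\lambda\in Q_r(\Lambda)$ with $d(\lambda)=e_{i_1}+\dots+e_{i_r}$, $i_1<\dots<i_r$, and $1\le j\le r$, put $F_j^0(\lambda)=\lambda(0,d(\lambda)-e_{i_j})$ and $F_j^1(\lambda)=\lambda(e_{i_j},d(\lambda))$.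 $C_r(\Lambda)=\mathbb{Z}Q_r(\Lambda)$ is the free abelian group on $Q_r(\Lambda)$; $\partial_r(\lambda)=\sum_{\ell=0}^1\sum_{i=1}^r(-1)^{i+\ell}F_i^\ell(\lambda)$ for $r\ge1$, $\partial_0=0$; $H_r(\Lambda)=\ker\partial_r/\operatorname{Im}\partial_{r+1}$. Topological realisation: for $n\in\mathbb{N}^k$ let $[0,n]=\{t\in\mathbb{R}^k:0\le t\le n\}$; $\lfloor t\rfloor$, $\lceil t\rceil$ are taken coordinatewise. On $\bigsqcup_{\lambda\in\Lambda}\{\lambda\}\times[0,d(\lambda)]$ define $(\mu,s)\sim(\nu,t)$ iff $s-\lfloor s\rfloor=t-\lfloor t\rfloor$ and $\mu(\lfloor s\rfloor,\lceil s\rceil)=\nu(\lfloor t\rfloor,\lceil t\rceil)$. $X_\Lambda$ is the quotient space and $[\lambda,t]$ the class of $(\lambda,t)$. A $k$-graph morphism $\theta:\Lambda\to\Gamma$ induces the continuous map $\widetilde\theta:X_\Lambda\to X_\Gamma$, $[\lambda,t]\mapsto[\theta(\lambda),t]$. Singular homology $H_*^{\mathrm{top}}(X)$ is taken in Massey's cubical form: $C_r^{\mathrm{top}}(X)$ is the free abelian group on continuous maps $T:\mathbf{I}^r=[0,1]^r\to X$ modulo the degenerate ones (those independent of some coordinate), with boundary $\partial_r T=\sum_{i=1}^r(-1)^i(T|_{t_i=0}-T|_{t_i=1})$; this agrees with the usual (simplicial) singular homology. For $\lambda\in Q_r(\Lambda)$ with $d(\lambda)=e_{i_1}+\dots+e_{i_r}$,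 $i_1<\dots<i_r$, let $\iota_\lambda:\mathbf{I}^r\to X_\Lambda$, $\iota_\lambda(t_1,\dots,t_r)=[\lambda,\sum_{m=1}^r t_me_{i_m}]$. Then $\Phi(\lambda)=\iota_\lambda$ defines a chain map $\Phi:C_*(\Lambda)\to C_*^{\mathrm{top}}(X_\Lambda)$, and $\Phi_*$ is the induced map on homology. *)

theory Defs
  imports "HOL-Homology.Homology"
begin

section \<open>k-graphs\<close>

text \<open>
  A small category is given by its set of morphisms, an object being identified with its identity
  morphism: \<open>src x\<close> and \<open>rng x\<close> are the identities at the domain and the codomain of \<open>x\<close>. The
  composite \<open>cmp x y\<close>, written \<open>xy\<close> on paper, is meaningful when \<open>src x = rng y\<close>. An element of
  $\mathbb{N}^k$ is a function \<open>nat \<Rightarrow> nat\<close> vanishing at all \<open>i \<ge> k\<close>, so the coordinates are numbered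
  from 0 to \<open>k - 1\<close>; this includes \<open>k = 0\<close>.
\<close>

record 'a kgraph =
  Mor :: "'a set"
  src :: "'a \<Rightarrow> 'a"
  rng :: "'a \<Rightarrow> 'a"
  cmp :: "'a \<Rightarrow> 'a \<Rightarrow> 'a"
  deg :: "'a \<Rightarrow> nat \<Rightarrow> nat"

locale k_graph =
  fixes k :: nat and \<Lambda> :: "'a kgraph"
  assumes Mor_nonempty: "Mor \<Lambda> \<noteq> {}"
    and Mor_countable: "countable (Mor \<Lambda>)"
    and src_closed: "x \<in> Mor \<Lambda> \<Longrightarrow> src \<Lambda> x \<in> Mor \<Lambda>"
    and rng_closed: "x \<in> Mor \<Lambda> \<Longrightarrow> rng \<Lambda> x \<in> Mor \<Lambda>"
    and src_src: "x \<in> Mor \<Lambda> \<Longrightarrow> src \<Lambda> (src \<Lambda> x) = src \<Lambda> x"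
    and rng_src: "x \<in> Mor \<Lambda> \<Longrightarrow> rng \<Lambda> (src \<Lambda> x) = src \<Lambda> x"
    and src_rng: "x \<in> Mor \<Lambda> \<Longrightarrow> src \<Lambda> (rng \<Lambda> x) = rng \<Lambda> x"
    and rng_rng: "x \<in> Mor \<Lambda> \<Longrightarrow> rng \<Lambda> (rng \<Lambda> x) = rng \<Lambda> x"
    and cmp_closed: "\<lbrakk>x \<in> Mor \<Lambda>; y \<in> Mor \<Lambda>; src \<Lambda> x = rng \<Lambda> y\<rbrakk> \<Longrightarrow> cmp \<Lambda> x y \<in> Mor \<Lambda>"
    and src_cmp: "\<lbrakk>x \<in> Mor \<Lambda>; y \<in> Mor \<Lambda>; src \<Lambda> x = rng \<Lambda> y\<rbrakk> \<Longrightarrow> src \<Lambda> (cmp \<Lambda> x y) = src \<Lambda> y"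
    and rng_cmp: "\<lbrakk>x \<in> Mor \<Lambda>; y \<in> Mor \<Lambda>; src \<Lambda> x = rng \<Lambda> y\<rbrakk> \<Longrightarrow> rng \<Lambda> (cmp \<Lambda> x y) = rng \<Lambda> x"
    and cmp_rng_left: "x \<in> Mor \<Lambda> \<Longrightarrow> cmp \<Lambda> (rng \<Lambda> x) x = x"
    and cmp_src_right: "x \<in> Mor \<Lambda> \<Longrightarrow> cmp \<Lambda> x (src \<Lambda> x) = x"
    and cmp_assoc: "\<lbrakk>x \<in> Mor \<Lambda>; y \<in> Mor \<Lambda>; z \<in> Mor \<Lambda>; src \<Lambda> x = rng \<Lambda> y; src \<Lambda> y = rng \<Lambda> z\<rbrakk>
          \<Longrightarrow> cmp \<Lambda> (cmp \<Lambda> x y) z = cmp \<Lambda> x (cmp \<Lambda> y z)"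
    and deg_beyond: "\<lbrakk>x \<in> Mor \<Lambda>; k \<le> i\<rbrakk> \<Longrightarrow> deg \<Lambda> x i = 0"
    and deg_src: "x \<in> Mor \<Lambda> \<Longrightarrow> deg \<Lambda> (src \<Lambda> x) = (\<lambda>i. 0)"
    and deg_rng: "x \<in> Mor \<Lambda> \<Longrightarrow> deg \<Lambda> (rng \<Lambda> x) = (\<lambda>i. 0)"
    and deg_cmp: "\<lbrakk>x \<in> Mor \<Lambda>; y \<in> Mor \<Lambda>; src \<Lambda> x = rng \<Lambda> y\<rbrakk>
          \<Longrightarrow> deg \<Lambda> (cmp \<Lambda> x y) = (\<lambda>i. deg \<Lambda> x i + deg \<Lambda> y i)"
    and factorisation: "\<lbrakk>x \<in> Mor \<Lambda>; deg \<Lambda> x = (\<lambda>i. m i + n i)\<rbrakk>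
          \<Longrightarrow> \<exists>!p. fst p \<in> Mor \<Lambda> \<and> snd p \<in> Mor \<Lambda> \<and> src \<Lambda> (fst p) = rng \<Lambda> (snd p)
                \<and> deg \<Lambda> (fst p) = m \<and> deg \<Lambda> (snd p) = n \<and> x = cmp \<Lambda> (fst p) (snd p)"

definition kgraph_morphism :: "'a kgraph \<Rightarrow> 'b kgraph \<Rightarrow> ('a \<Rightarrow> 'b) \<Rightarrow> bool" where
  "kgraph_morphism \<Lambda> \<Gamma> \<theta> \<longleftrightarrow>
     (\<forall>x \<in> Mor \<Lambda>. \<theta> x \<in> Mor \<Gamma> \<and> \<theta> (src \<Lambda> x) = src \<Gamma> (\<theta> x) \<and> \<theta> (rng \<Lambda> x) = rng \<Gamma> (\<theta> x)
                \<and> deg \<Gamma> (\<theta> x) = deg \<Lambda> x) \<and>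
     (\<forall>x \<in> Mor \<Lambda>. \<forall>y \<in> Mor \<Lambda>. src \<Lambda> x = rng \<Lambda> y \<longrightarrow> \<theta> (cmp \<Lambda> x y) = cmp \<Gamma> (\<theta> x) (\<theta> y))"

text \<open>\<open>seg \<Lambda> x m n\<close> is the factor $x(m,n)$; only used for $m \le n \le d(x)$.\<close>

definition seg :: "'a kgraph \<Rightarrow> 'a \<Rightarrow> (nat \<Rightarrow> nat) \<Rightarrow> (nat \<Rightarrow> nat) \<Rightarrow> 'a" where
  "seg \<Lambda> x m n = (THE b. b \<in> Mor \<Lambda> \<and> deg \<Lambda> b = (\<lambda>i. n i - m i) \<and>
     (\<exists>a \<in> Mor \<Lambda>. \<exists>c \<in> Mor \<Lambda>. deg \<Lambda> a = m \<and> deg \<Lambda> c = (\<lambda>i. deg \<Lambda> x i - n i) \<and>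
        src \<Lambda> a = rng \<Lambda> b \<and> src \<Lambda> b = rng \<Lambda> c \<and> x = cmp \<Lambda> a (cmp \<Lambda> b c)))"


section \<open>Homology of a chain complex, and maps induced on quotients\<close>

text \<open>\<open>c\<close> is a coset in some source group and \<open>G\<close> is the target; \<open>the_elem\<close> picks the \<open>N\<close>-coset that
  contains \<open>f ` c\<close>, which is unique whenever \<open>f\<close> descends to the quotients.\<close>

definition quotient_map_on_cosets ::
    "('b, 'n) monoid_scheme \<Rightarrow> 'b set \<Rightarrow> ('a \<Rightarrow> 'b) \<Rightarrow> 'a set \<Rightarrow> 'b set" where
  "quotient_map_on_cosets G N f = (\<lambda>c. the_elem ((\<lambda>z. N #>\<^bsub>G\<^esub> f z) ` c))"

text \<open>
  A chain complex is a sequence of groups \<open>C r\<close> with \<open>D r\<close> mapping \<open>C r\<close> to \<open>C (r - 1)\<close>. In degree 0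
  truncated subtraction makes \<open>D 0\<close> a map from \<open>C 0\<close> to itself; it is the zero map for both
  complexes below, so that every 0-chain is a cycle.
\<close>

definition boundary_set ::
    "(nat \<Rightarrow> ('a, 'm) monoid_scheme) \<Rightarrow> (nat \<Rightarrow> 'a \<Rightarrow> 'a) \<Rightarrow> nat \<Rightarrow> 'a set" where
  "boundary_set C D r = D (Suc r) ` carrier (C (Suc r))"

definition chain_homology ::
    "(nat \<Rightarrow> ('a, 'm) monoid_scheme) \<Rightarrow> (nat \<Rightarrow> 'a \<Rightarrow> 'a) \<Rightarrow> nat \<Rightarrow> 'a set monoid" where
  "chain_homology C D r =
     (C r)\<lparr>carrier := kernel (C r) (C (r - 1)) (D r)\<rparr> Mod boundary_set C D r"

definition chain_homology_map ::
    "(nat \<Rightarrow> ('b, 'm) monoid_scheme) \<Rightarrow> (nat \<Rightarrow> 'b \<Rightarrow> 'b) \<Rightarrow> (nat \<Rightarrow> 'a \<Rightarrow> 'b) \<Rightarrow> nat \<Rightarrow> 'a set \<Rightarrow> 'b set"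
  where \<comment> \<open>the complex in the arguments is the target of the chain map\<close>
  "chain_homology_map C D f r = quotient_map_on_cosets (C r) (boundary_set C D r) (f r)"


section \<open>Homology of a k-graph\<close>

definition kcubes :: "nat \<Rightarrow> 'a kgraph \<Rightarrow> nat \<Rightarrow> 'a set" where
  "kcubes k \<Lambda> r = {x \<in> Mor \<Lambda>. (\<forall>i<k. deg \<Lambda> x i \<le> 1) \<and> (\<Sum>i<k. deg \<Lambda> x i) = r}"

text \<open>
  \<open>dir \<Lambda> x 0 < \<dots> < dir \<Lambda> x (r - 1)\<close> are the indices $i_1 < \dots < i_r$ of an \<open>r\<close>-cube \<open>x\<close>.
\<close>

definition dir :: "'a kgraph \<Rightarrow> 'a \<Rightarrow> nat \<Rightarrow> nat" where
  "dir \<Lambda> x j = sorted_list_of_set {i. deg \<Lambda> x i \<noteq> 0} ! j"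

definition unit_vec :: "nat \<Rightarrow> nat \<Rightarrow> nat" where
  "unit_vec i = (\<lambda>j. if j = i then 1 else 0)"

definition kface :: "'a kgraph \<Rightarrow> nat \<Rightarrow> nat \<Rightarrow> 'a \<Rightarrow> 'a" where
  "kface \<Lambda> l j x =
     (if l = 0 then seg \<Lambda> x (\<lambda>i. 0) (\<lambda>i. deg \<Lambda> x i - unit_vec (dir \<Lambda> x j) i)
      else seg \<Lambda> x (unit_vec (dir \<Lambda> x j)) (deg \<Lambda> x))"

definition kchain_group :: "nat \<Rightarrow> 'a kgraph \<Rightarrow> nat \<Rightarrow> ('a \<Rightarrow>\<^sub>0 int) monoid" where
  "kchain_group k \<Lambda> r = free_Abelian_group (kcubes k \<Lambda> r)"

text \<open>
  Directions of cubes are numbered from 0 here and in the singular complex, whence the shifted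
  exponents in the signs.
\<close>

definition kboundary :: "'a kgraph \<Rightarrow> nat \<Rightarrow> ('a \<Rightarrow>\<^sub>0 int) \<Rightarrow> ('a \<Rightarrow>\<^sub>0 int)" where
  "kboundary \<Lambda> r = frag_extend (\<lambda>x. \<Sum>l\<in>{0,1}. \<Sum>j<r.
     frag_cmul ((-1) ^ (Suc j + l)) (frag_of (kface \<Lambda> l j x)))"

definition kgraph_homology :: "nat \<Rightarrow> 'a kgraph \<Rightarrow> nat \<Rightarrow> ('a \<Rightarrow>\<^sub>0 int) set monoid" where
  "kgraph_homology k \<Lambda> = chain_homology (kchain_group k \<Lambda>) (kboundary \<Lambda>)"

definition kgraph_homology_map ::
    "nat \<Rightarrow> 'b kgraph \<Rightarrow> ('a \<Rightarrow> 'b) \<Rightarrow> nat \<Rightarrow> ('a \<Rightarrow>\<^sub>0 int) set \<Rightarrow> ('b \<Rightarrow>\<^sub>0 int) set" where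
  \<comment> \<open>\<open>\<Gamma>\<close> is the target of \<open>\<theta>\<close>\<close>
  "kgraph_homology_map k \<Gamma> \<theta> =
     chain_homology_map (kchain_group k \<Gamma>) (kboundary \<Gamma>) (\<lambda>r. frag_extend (frag_of \<circ> \<theta>))"


section \<open>Topological realisation\<close>

definition quotient_topology :: "'a topology \<Rightarrow> ('a \<times> 'a) set \<Rightarrow> 'a set topology" where
  "quotient_topology X R =
     topology (\<lambda>U. U \<subseteq> topspace X // R \<and> openin X {x \<in> topspace X. R `` {x} \<in> U})"

lemma istopology_quotient:
  "istopology (\<lambda>U. U \<subseteq> topspace X // R \<and> openin X {x \<in> topspace X. R `` {x} \<in> U})"
proof -
  have 1: "{x \<in> topspace X. R `` {x} \<in> S \<inter> T} =
      {x \<in> topspace X. R `` {x} \<in> S} \<inter> {x \<in> topspace X. R `` {x} \<in> T}" for S T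
    by auto
  have 2: "{x \<in> topspace X. R `` {x} \<in> \<Union>\<K>} = (\<Union>K\<in>\<K>. {x \<in> topspace X. R `` {x} \<in> K})" for \<K>
    by auto
  show ?thesis
    unfolding istopology_def 1 2 by blast
qed

lemma openin_quotient_topology:
  "openin (quotient_topology X R) U \<longleftrightarrow>
     U \<subseteq> topspace X // R \<and> openin X {x \<in> topspace X. R `` {x} \<in> U}"
  by (simp add: quotient_topology_def istopology_quotient)

definition deg_box :: "(nat \<Rightarrow> nat) \<Rightarrow> (nat \<Rightarrow> real) set" where
  "deg_box n = {t. \<forall>i. 0 \<le> t i \<and> t i \<le> real (n i)}"

definition realisation_pre :: "nat \<Rightarrow> 'a kgraph \<Rightarrow> ('a \<times> (nat \<Rightarrow> real)) topology" where
  "realisation_pre k \<Lambda> =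
     sum_topology (\<lambda>x. subtopology (Euclidean_space k) (deg_box (deg \<Lambda> x))) (Mor \<Lambda>)"

definition realisation_rel ::
    "nat \<Rightarrow> 'a kgraph \<Rightarrow> (('a \<times> (nat \<Rightarrow> real)) \<times> ('a \<times> (nat \<Rightarrow> real))) set" where
  "realisation_rel k \<Lambda> =
     {((x, s), (y, t)). (x, s) \<in> topspace (realisation_pre k \<Lambda>) \<and> (y, t) \<in> topspace (realisation_pre k \<Lambda>) \<and>
        (\<forall>i. s i - \<lfloor>s i\<rfloor> = t i - \<lfloor>t i\<rfloor>) \<and>
        seg \<Lambda> x (\<lambda>i. nat \<lfloor>s i\<rfloor>) (\<lambda>i. nat \<lceil>s i\<rceil>) = seg \<Lambda> y (\<lambda>i. nat \<lfloor>t i\<rfloor>) (\<lambda>i. nat \<lceil>t i\<rceil>)}"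

definition realisation :: "nat \<Rightarrow> 'a kgraph \<Rightarrow> ('a \<times> (nat \<Rightarrow> real)) set topology" where
  "realisation k \<Lambda> = quotient_topology (realisation_pre k \<Lambda>) (realisation_rel k \<Lambda>)"

definition realisation_class :: "nat \<Rightarrow> 'a kgraph \<Rightarrow> 'a \<Rightarrow> (nat \<Rightarrow> real) \<Rightarrow> ('a \<times> (nat \<Rightarrow> real)) set" where
  "realisation_class k \<Lambda> x t = realisation_rel k \<Lambda> `` {(x, t)}"

definition realisation_map ::
    "nat \<Rightarrow> 'b kgraph \<Rightarrow> ('a \<Rightarrow> 'b) \<Rightarrow> ('a \<times> (nat \<Rightarrow> real)) set \<Rightarrow> ('b \<times> (nat \<Rightarrow> real)) set" where
  \<comment> \<open>\<open>\<Gamma>\<close> is the target of \<open>\<theta>\<close>\<close>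
  "realisation_map k \<Gamma> \<theta> c = the_elem ((\<lambda>(x, t). realisation_class k \<Gamma> (\<theta> x) t) ` c)"


section \<open>Cubical singular homology\<close>

definition unit_cube :: "nat \<Rightarrow> (nat \<Rightarrow> real) set" where
  "unit_cube r = {t. (\<forall>i<r. 0 \<le> t i \<and> t i \<le> 1) \<and> (\<forall>i\<ge>r. t i = 0)}"

text \<open>As for the simplices of the library, cubes are made extensional to be determined by their
  values on the unit cube.\<close>

definition singular_cube :: "nat \<Rightarrow> 'x topology \<Rightarrow> ((nat \<Rightarrow> real) \<Rightarrow> 'x) \<Rightarrow> bool" where
  "singular_cube r X T \<longleftrightarrow>
     continuous_map (subtopology (Euclidean_space r) (unit_cube r)) X T \<and> T \<in> extensional (unit_cube r)"

definition degenerate_cube :: "nat \<Rightarrow> ((nat \<Rightarrow> real) \<Rightarrow> 'x) \<Rightarrow> bool" where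
  "degenerate_cube r T \<longleftrightarrow>
     (\<exists>i<r. \<forall>s \<in> unit_cube r. \<forall>t \<in> unit_cube r. (\<forall>j. j \<noteq> i \<longrightarrow> s j = t j) \<longrightarrow> T s = T t)"

definition insert_coord :: "nat \<Rightarrow> real \<Rightarrow> (nat \<Rightarrow> real) \<Rightarrow> nat \<Rightarrow> real" where
  "insert_coord i a t = (\<lambda>j. if j < i then t j else if j = i then a else t (j - 1))"

definition cube_face :: "nat \<Rightarrow> nat \<Rightarrow> real \<Rightarrow> ((nat \<Rightarrow> real) \<Rightarrow> 'x) \<Rightarrow> (nat \<Rightarrow> real) \<Rightarrow> 'x" where
  "cube_face r i a T = restrict (T \<circ> insert_coord i a) (unit_cube (r - 1))"

definition all_cubes_group :: "'x topology \<Rightarrow> nat \<Rightarrow> (((nat \<Rightarrow> real) \<Rightarrow> 'x) \<Rightarrow>\<^sub>0 int) monoid" where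
  "all_cubes_group X r = free_Abelian_group {T. singular_cube r X T}"

definition degenerate_chains :: "'x topology \<Rightarrow> nat \<Rightarrow> (((nat \<Rightarrow> real) \<Rightarrow> 'x) \<Rightarrow>\<^sub>0 int) set" where
  "degenerate_chains X r = carrier (free_Abelian_group {T. singular_cube r X T \<and> degenerate_cube r T})"

definition cubical_chain_group ::
    "'x topology \<Rightarrow> nat \<Rightarrow> (((nat \<Rightarrow> real) \<Rightarrow> 'x) \<Rightarrow>\<^sub>0 int) set monoid" where
  "cubical_chain_group X r = all_cubes_group X r Mod degenerate_chains X r"

definition cubical_boundary ::
    "'x topology \<Rightarrow> nat \<Rightarrow> (((nat \<Rightarrow> real) \<Rightarrow> 'x) \<Rightarrow>\<^sub>0 int) set \<Rightarrow> (((nat \<Rightarrow> real) \<Rightarrow> 'x) \<Rightarrow>\<^sub>0 int) set" where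
  "cubical_boundary X r =
     quotient_map_on_cosets (all_cubes_group X (r - 1)) (degenerate_chains X (r - 1))
       (frag_extend (\<lambda>T. \<Sum>i<r.
          frag_cmul ((-1) ^ Suc i) (frag_of (cube_face r i 0 T) - frag_of (cube_face r i 1 T))))"

definition cubical_homology ::
    "'x topology \<Rightarrow> nat \<Rightarrow> (((nat \<Rightarrow> real) \<Rightarrow> 'x) \<Rightarrow>\<^sub>0 int) set set monoid" where
  "cubical_homology X = chain_homology (cubical_chain_group X) (cubical_boundary X)"

definition cubical_chain_map ::
    "'y topology \<Rightarrow> ('x \<Rightarrow> 'y) \<Rightarrow> nat \<Rightarrow>
       (((nat \<Rightarrow> real) \<Rightarrow> 'x) \<Rightarrow>\<^sub>0 int) set \<Rightarrow> (((nat \<Rightarrow> real) \<Rightarrow> 'y) \<Rightarrow>\<^sub>0 int) set" where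
  "cubical_chain_map Y f r =
     quotient_map_on_cosets (all_cubes_group Y r) (degenerate_chains Y r)
       (frag_extend (\<lambda>T. frag_of (restrict (f \<circ> T) (unit_cube r))))"

definition cubical_homology_map ::
    "'y topology \<Rightarrow> ('x \<Rightarrow> 'y) \<Rightarrow> nat \<Rightarrow>
       (((nat \<Rightarrow> real) \<Rightarrow> 'x) \<Rightarrow>\<^sub>0 int) set set \<Rightarrow> (((nat \<Rightarrow> real) \<Rightarrow> 'y) \<Rightarrow>\<^sub>0 int) set set" where
  \<comment> \<open>\<open>Y\<close> is the target of \<open>f\<close>\<close>
  "cubical_homology_map Y f =
     chain_homology_map (cubical_chain_group Y) (cubical_boundary Y) (cubical_chain_map Y f)"


section \<open>The comparison map\<close>

definition iota ::
    "nat \<Rightarrow> 'a kgraph \<Rightarrow> nat \<Rightarrow> 'a \<Rightarrow> (nat \<Rightarrow> real) \<Rightarrow> ('a \<times> (nat \<Rightarrow> real)) set" where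
  "iota k \<Lambda> r x = restrict
     (\<lambda>t. realisation_class k \<Lambda> x (\<lambda>i. \<Sum>m<r. t m * real (unit_vec (dir \<Lambda> x m) i))) (unit_cube r)"

definition Phi ::
    "nat \<Rightarrow> 'a kgraph \<Rightarrow> nat \<Rightarrow> ('a \<Rightarrow>\<^sub>0 int) \<Rightarrow>
       (((nat \<Rightarrow> real) \<Rightarrow> ('a \<times> (nat \<Rightarrow> real)) set) \<Rightarrow>\<^sub>0 int) set" where
  "Phi k \<Lambda> r c = degenerate_chains (realisation k \<Lambda>) r
     #>\<^bsub>all_cubes_group (realisation k \<Lambda>) r\<^esub> frag_extend (\<lambda>x. frag_of (iota k \<Lambda> r x)) c"

definition Phi_star ::
    "nat \<Rightarrow> 'a kgraph \<Rightarrow> nat \<Rightarrow> ('a \<Rightarrow>\<^sub>0 int) set \<Rightarrow>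
       (((nat \<Rightarrow> real) \<Rightarrow> ('a \<times> (nat \<Rightarrow> real)) set) \<Rightarrow>\<^sub>0 int) set set" where
  "Phi_star k \<Lambda> = chain_homology_map (cubical_chain_group (realisation k \<Lambda>))
     (cubical_boundary (realisation k \<Lambda>)) (Phi k \<Lambda>)"

end

theory Submission
  imports Defs "HOL-Analysis.Abstract_Topological_Spaces"
begin

text \<open>  The realisation of a k-graph is glued from unit boxes, one box with sides in the directions
  \<open>{i. deg \<Lambda> x i \<noteq> 0}\<close> for every cube \<open>x\<close>. Every point lies in exactly one open box, the faces of a
  box are identified with the boxes of the faces of the cube, and a set is closed as soon as its trace
  on every closed box is closed (theorem \<open>realisation_complex\<close>). The locale \<open>cubical_complex\<close> keeps just
  these properties. That every cell has a set of directions in \<open>{..<k}\<close>, and that a face has one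
  direction less, is what makes the following induction on \<open>k\<close> possible.

  The comparison of cellular and singular chains is shown to be a quasi-isomorphism in the form
  \<open>cell_exact\<close>: the mapping cone is acyclic, that is, if \<open>c\<close> is a singular chain, \<open>a\<close> is a cellular cycle,
  and the boundary of \<open>c\<close> is the image of \<open>a\<close> up to degenerate cubes, then the pair is a boundary. The
  case \<open>a = 0\<close> yields surjectivity in homology and a \<open>c\<close> that bounds the image of \<open>a\<close> yields injectivity.
  With this formulation one statement is proved by a single diagram chase, where a five lemma would
  compare two long exact sequences.

  For the induction step take the last direction \<open>k\<close>. The cells without this direction form a closed
  subcomplex \<open>Z\<close>, and the points at height one half in the other cells form a complex \<open>Y\<close>; both have
  directions in \<open>{..<k}\<close> only, so the induction hypothesis applies to them. The whole space arises
  from \<open>Z\<close> by attaching the cylinder over \<open>Y\<close> along its two ends. Hence the homology of \<open>X\<close> relative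
  to \<open>Z\<close> is that of \<open>Y\<close> with degrees raised by one, and the isomorphism maps a chain \<open>s\<close> in \<open>Y\<close> to
  the chain \<open>s \<times> [0,1]\<close> carried to \<open>X\<close> by the attaching map (lemmas \<open>attach_surj\<close> and \<open>attach_inj\<close>).
  On cells this operation merely adds the direction \<open>k\<close> (lemma \<open>prismc_cellc\<close>), so it is compatible with
  the comparison maps, and \<open>cell_exact_Suc\<close> assembles the statements for \<open>Z\<close> and \<open>Y\<close>.

  The relative homology of an attached cylinder is computed by excision, which for cubes means that
  chains can be subdivided until every cube lies either in the open cylinder or near \<open>Z\<close>. The
  subdivision of the r-cube is the r-fold product of the subdivision of the interval into two halves;
  its chain homotopy to the identity is an explicit product as well (\<open>sdm\<close>, \<open>hdm\<close>, \<open>sbd_hd\<close>). The homology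
  of a cylinder relative to its ends follows from contracting it to one of them.

  Finally the chain-level statement is transported to the quotient groups by a criterion for maps
  of chain complexes, \<open>homology_map_iso\<close>. Naturality holds already for chains: a morphism of k-graphs
  commutes with the normal form of points, hence with the characteristic maps of the cells.\<close>

section \<open>Chains with support in a set\<close>

text \<open>Sums over directions are to be split only at chosen places.\<close>

declare sum.lessThan_Suc [simp del]

definition chains :: "'a set \<Rightarrow> ('a \<Rightarrow>\<^sub>0 int) set" where
  "chains A = {c. Poly_Mapping.keys c \<subseteq> A}"

lemma chains_zero [simp]: "0 \<in> chains A"
  and chains_of [simp]: "frag_of x \<in> chains A \<longleftrightarrow> x \<in> A"
  and chains_minus [simp]: "- c \<in> chains A \<longleftrightarrow> c \<in> chains A"
  by (auto simp: chains_def)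

lemma chains_add: "\<lbrakk>c \<in> chains A; d \<in> chains A\<rbrakk> \<Longrightarrow> c + d \<in> chains A"
  unfolding chains_def using Poly_Mapping.keys_add[of c d] by blast

lemma chains_diff: "\<lbrakk>c \<in> chains A; d \<in> chains A\<rbrakk> \<Longrightarrow> c - d \<in> chains A"
  unfolding chains_def using keys_diff[of c d] by blast

lemma chains_cmul: "c \<in> chains A \<Longrightarrow> frag_cmul n c \<in> chains A"
  unfolding chains_def using keys_cmul[of n c] by blast

lemma chains_sum: "(\<And>i. i \<in> I \<Longrightarrow> f i \<in> chains A) \<Longrightarrow> sum f I \<in> chains A"
  by (induction I rule: infinite_finite_induct) (auto intro: chains_add)

lemma chains_mono: "\<lbrakk>c \<in> chains A; A \<subseteq> B\<rbrakk> \<Longrightarrow> c \<in> chains B"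
  by (auto simp: chains_def)

lemma chains_diff_iff: "c - d \<in> chains A \<Longrightarrow> c \<in> chains A \<longleftrightarrow> d \<in> chains A"
  using chains_add[of "c - d" A d] chains_diff[of c A "c - d"] by auto

lemma chains_induct [consumes 1, case_names zero one diff]:
  assumes "c \<in> chains A" "P 0" "\<And>x. x \<in> A \<Longrightarrow> P (frag_of x)" "\<And>a b. \<lbrakk>P a; P b\<rbrakk> \<Longrightarrow> P (a - b)"
  shows "P c"
  using assms frag_induction[of c A P] by (auto simp: chains_def)

lemma chains_UNIV [simp]: "c \<in> chains UNIV"
  by (simp add: chains_def)

lemma chains_extend:
  "\<lbrakk>c \<in> chains A; \<And>x. x \<in> A \<Longrightarrow> f x \<in> chains B\<rbrakk> \<Longrightarrow> frag_extend f c \<in> chains B"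
  by (induction rule: chains_induct) (auto simp: frag_extend_diff chains_diff)

lemma frag_extend_eq_on: "\<lbrakk>c \<in> chains A; \<And>x. x \<in> A \<Longrightarrow> f x = g x\<rbrakk> \<Longrightarrow> frag_extend f c = frag_extend g c"
  by (rule frag_extend_eq) (auto simp: chains_def)

lemma frag_extend_extend:
  "frag_extend f (frag_extend g c) = frag_extend (\<lambda>x. frag_extend f (g x)) c"
  using chains_UNIV[of c] by (induction rule: chains_induct) (auto simp: frag_extend_diff)

lemma frag_extend_sum': "frag_extend f (\<Sum>i\<in>I. g i) = (\<Sum>i\<in>I. frag_extend f (g i))"
  by (induction I rule: infinite_finite_induct) (auto simp: frag_extend_add)

lemma frag_extend_fun_diff: "frag_extend (\<lambda>x. f x - g x) c = frag_extend f c - frag_extend g c"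
  using chains_UNIV[of c] by (induction rule: chains_induct) (auto simp: frag_extend_diff)

lemma chains_split:
  assumes "c \<in> chains (A \<union> B)" obtains d e where "d \<in> chains A" "e \<in> chains B" "c = d + e"
  using frag_split[of c A B] assms unfolding chains_def by (metis mem_Collect_eq)

lemma chains_Int: "\<lbrakk>c \<in> chains A; c \<in> chains B\<rbrakk> \<Longrightarrow> c \<in> chains (A \<inter> B)"
  by (auto simp: chains_def)

lemma chains_empty: "c \<in> chains {} \<longleftrightarrow> c = 0"
  by (auto simp: chains_def)

lemma frag_cmul_diff: "frag_cmul c (a - b) = frag_cmul c a - frag_cmul c b"
  by (rule poly_mapping_eqI) (simp add: lookup_minus right_diff_distrib)

section \<open>Cubes, faces and prisms\<close>

lemma unit_cube_nonempty: "(\<lambda>_. 0) \<in> unit_cube r"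
  by (auto simp: unit_cube_def)

lemma insert_coord_unit_cube:
  "\<lbrakk>t \<in> unit_cube r; i \<le> r; 0 \<le> a; a \<le> 1\<rbrakk> \<Longrightarrow> insert_coord i a t \<in> unit_cube (Suc r)"
  unfolding unit_cube_def insert_coord_def by (auto simp: less_Suc_eq)

lemma insert_coord_last: "t \<in> unit_cube r \<Longrightarrow> insert_coord r a t = t(r := a)"
  unfolding unit_cube_def insert_coord_def by (auto simp: fun_eq_iff)

lemma insert_coord_insert_coord:
  "i \<le> j \<Longrightarrow> insert_coord i a (insert_coord j b t) = insert_coord (Suc j) b (insert_coord i a t)"
  unfolding insert_coord_def by (auto simp: fun_eq_iff)

lemma insert_coord_upd:
  "i \<le> q \<Longrightarrow> insert_coord i a (t(q := v)) = (insert_coord i a t)(Suc q := v)"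
  unfolding insert_coord_def by (auto simp: fun_eq_iff)

lemma upd_unit_cube:
  "\<lbrakk>t \<in> unit_cube (Suc r)\<rbrakk> \<Longrightarrow> t(r := 0) \<in> unit_cube r"
  "\<lbrakk>t \<in> unit_cube r; 0 \<le> a; a \<le> 1\<rbrakk> \<Longrightarrow> t(r := a) \<in> unit_cube (Suc r)"
  "\<lbrakk>t \<in> unit_cube r; i < r; 0 \<le> a; a \<le> 1\<rbrakk> \<Longrightarrow> t(i := a) \<in> unit_cube r"
  unfolding unit_cube_def by (auto simp: less_Suc_eq)

lemma unit_cube_coord: "t \<in> unit_cube r \<Longrightarrow> 0 \<le> t i \<and> t i \<le> 1"
  unfolding unit_cube_def by (cases "i < r") auto

lemma unit_cube_beyond: "\<lbrakk>t \<in> unit_cube r; r \<le> i\<rbrakk> \<Longrightarrow> t i = 0"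
  unfolding unit_cube_def by auto

type_synonym 'x cube_chain = "((nat \<Rightarrow> real) \<Rightarrow> 'x) \<Rightarrow>\<^sub>0 int"

text \<open>The singular boundary before passage to the quotient by degenerate chains; computations take
  place in the free abelian groups, and congruences modulo degenerate chains are written as
  membership of a difference.\<close>

definition sbd :: "nat \<Rightarrow> 'x cube_chain \<Rightarrow> 'x cube_chain" where
  "sbd r = frag_extend (\<lambda>T. \<Sum>i<r.
     frag_cmul ((-1) ^ Suc i) (frag_of (cube_face r i 0 T) - frag_of (cube_face r i 1 T)))"

definition push :: "nat \<Rightarrow> ('x \<Rightarrow> 'y) \<Rightarrow> ((nat \<Rightarrow> real) \<Rightarrow> 'x) \<Rightarrow> (nat \<Rightarrow> real) \<Rightarrow> 'y" where
  "push r f T = restrict (f \<circ> T) (unit_cube r)"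

definition pushc :: "nat \<Rightarrow> ('x \<Rightarrow> 'y) \<Rightarrow> 'x cube_chain \<Rightarrow> 'y cube_chain" where
  "pushc r f = frag_extend (\<lambda>T. frag_of (push r f T))"

text \<open>The product of a cube with the unit interval, followed by a homotopy \<open>H\<close>. The interval is put in
  the last coordinate, so that taking one of the first faces commutes with forming the prism.\<close>

definition prism :: "nat \<Rightarrow> ('x \<Rightarrow> real \<Rightarrow> 'y) \<Rightarrow> ((nat \<Rightarrow> real) \<Rightarrow> 'x) \<Rightarrow> (nat \<Rightarrow> real) \<Rightarrow> 'y" where
  "prism r H T = restrict (\<lambda>t. H (T (t(r := 0))) (t r)) (unit_cube (Suc r))"

definition prismc :: "nat \<Rightarrow> ('x \<Rightarrow> real \<Rightarrow> 'y) \<Rightarrow> 'x cube_chain \<Rightarrow> 'y cube_chain" where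
  "prismc r H = frag_extend (\<lambda>T. frag_of (prism r H T))"

lemma sbd_0 [simp]: "sbd r 0 = 0"
  and sbd_diff: "sbd r (c - d) = sbd r c - sbd r d"
  and sbd_add: "sbd r (c + d) = sbd r c + sbd r d"
  and sbd_minus: "sbd r (- c) = - sbd r c"
  and sbd_cmul: "sbd r (frag_cmul n c) = frag_cmul n (sbd r c)"
  and sbd_sum: "sbd r (\<Sum>i\<in>I. f i) = (\<Sum>i\<in>I. sbd r (f i))"
  by (simp_all add: sbd_def frag_extend_diff frag_extend_add frag_extend_minus frag_extend_cmul frag_extend_sum')

lemma pushc_0 [simp]: "pushc r f 0 = 0"
  and pushc_of [simp]: "pushc r f (frag_of T) = frag_of (push r f T)"
  and pushc_diff: "pushc r f (c - d) = pushc r f c - pushc r f d"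
  and pushc_add: "pushc r f (c + d) = pushc r f c + pushc r f d"
  and pushc_cmul: "pushc r f (frag_cmul n c) = frag_cmul n (pushc r f c)"
  and pushc_sum: "pushc r f (\<Sum>i\<in>I. g i) = (\<Sum>i\<in>I. pushc r f (g i))"
  by (simp_all add: pushc_def frag_extend_diff frag_extend_add frag_extend_minus frag_extend_cmul frag_extend_sum')

lemma prismc_0 [simp]: "prismc r H 0 = 0"
  and prismc_of [simp]: "prismc r H (frag_of T) = frag_of (prism r H T)"
  and prismc_diff: "prismc r H (c - d) = prismc r H c - prismc r H d"
  and prismc_add: "prismc r H (c + d) = prismc r H c + prismc r H d"
  and prismc_minus: "prismc r H (- c) = - prismc r H c"
  and prismc_cmul: "prismc r H (frag_cmul n c) = frag_cmul n (prismc r H c)"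
  and prismc_sum: "prismc r H (\<Sum>i\<in>I. f i) = (\<Sum>i\<in>I. prismc r H (f i))"
  by (simp_all add: prismc_def frag_extend_diff frag_extend_add frag_extend_minus frag_extend_cmul frag_extend_sum')

lemma sbd_of: "sbd r (frag_of T) = (\<Sum>i<r.
     frag_cmul ((-1) ^ Suc i) (frag_of (cube_face r i 0 T) - frag_of (cube_face r i 1 T)))"
  by (simp add: sbd_def)

lemma sbd_dim_0 [simp]: "sbd 0 c = 0"
  by (simp add: sbd_def frag_extend_eq_0)

lemma cube_face_app: "t \<in> unit_cube r \<Longrightarrow> cube_face (Suc r) i a T t = T (insert_coord i a t)"
  by (simp add: cube_face_def)

lemma cube_face_push:
  "\<lbrakk>i < Suc r; 0 \<le> a; a \<le> 1\<rbrakk> \<Longrightarrow> cube_face (Suc r) i a (push (Suc r) f T) = push r f (cube_face (Suc r) i a T)"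
  unfolding cube_face_def push_def
  by (rule ext) (auto simp: restrict_def insert_coord_unit_cube)

lemma sbd_pushc: "sbd r (pushc r f c) = pushc (r - 1) f (sbd r c)"
  using chains_UNIV[of c]
proof (induction rule: chains_induct)
  case (one T)
  show ?case
    by (cases r) (auto simp: sbd_of pushc_sum pushc_cmul pushc_diff cube_face_push intro!: sum.cong)
qed (simp_all add: sbd_diff pushc_diff)

lemma cube_face_prism_inner:
  "\<lbrakk>i < Suc r; 0 \<le> a; a \<le> 1\<rbrakk> \<Longrightarrow>
     cube_face (Suc (Suc r)) i a (prism (Suc r) H T) = prism r H (cube_face (Suc r) i a T)"
proof (rule ext)
  fix t assume i: "i < Suc r" and a: "0 \<le> a" "a \<le> 1"
  have *: "(insert_coord i a t)(Suc r := 0) = insert_coord i a (t(r := 0))" "insert_coord i a t (Suc r) = t r"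
    using i by (auto simp: insert_coord_def fun_eq_iff)
  show "cube_face (Suc (Suc r)) i a (prism (Suc r) H T) t = prism r H (cube_face (Suc r) i a T) t"
    using i a by (auto simp: cube_face_def prism_def restrict_def insert_coord_unit_cube upd_unit_cube *)
qed

lemma cube_face_prism_last:
  "\<lbrakk>0 \<le> a; a \<le> 1\<rbrakk> \<Longrightarrow> cube_face (Suc r) r a (prism r H T) = push r (\<lambda>x. H x a) T"
proof (rule ext)
  fix t assume a: "0 \<le> a" "a \<le> 1"
  have "t(r := 0) = t" if "t \<in> unit_cube r"
    using that by (auto simp: fun_eq_iff unit_cube_def)
  then show "cube_face (Suc r) r a (prism r H T) t = push r (\<lambda>x. H x a) T t"
    using a by (auto simp: cube_face_def prism_def push_def restrict_def upd_unit_cube insert_coord_last)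
qed

text \<open>The faces of a product with an interval are the products of the faces, and the two ends. This is
  the chain homotopy belonging to a homotopy, and with a cycle in place of \<open>c\<close> it relates the two ends.\<close>

lemma sbd_prismc:
  "sbd (Suc r) (prismc r H c) = prismc (r - 1) H (sbd r c)
     + frag_cmul ((-1) ^ Suc r) (pushc r (\<lambda>x. H x 0) c - pushc r (\<lambda>x. H x 1) c)"
  using chains_UNIV[of c]
proof (induction rule: chains_induct)
  case (one T)
  have "(\<Sum>i<r. frag_cmul ((-1) ^ Suc i) (frag_of (cube_face (Suc r) i 0 (prism r H T))
            - frag_of (cube_face (Suc r) i 1 (prism r H T)))) = prismc (r - 1) H (sbd r (frag_of T))"
    by (cases r) (auto simp: sbd_of prismc_sum prismc_cmul prismc_diff cube_face_prism_inner intro!: sum.cong)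
  then show ?case
    by (simp add: sbd_of[of "Suc r"] sum.lessThan_Suc cube_face_prism_last del: power_Suc)
next
  case (diff a b)
  show ?case
    unfolding sbd_diff prismc_diff pushc_diff diff frag_cmul_diff by (simp add: algebra_simps)
qed simp

lemma cube_face_cube_face:
  assumes "i \<le> j" "j \<le> r" "0 \<le> a" "a \<le> 1" "0 \<le> b" "b \<le> 1"
  shows "cube_face (Suc r) j b (cube_face (Suc (Suc r)) i a T)
       = cube_face (Suc r) i a (cube_face (Suc (Suc r)) (Suc j) b T)"
  using assms
  by (auto simp: cube_face_def fun_eq_iff restrict_def insert_coord_unit_cube insert_coord_insert_coord)

text \<open>Every face of codimension two arises from its two directions in either order, with opposite signs.\<close>

lemma sbd_sbd: "sbd r (sbd (Suc r) c) = 0"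
  using chains_UNIV[of c]
proof (induction rule: chains_induct)
  case (one T)
  show ?case
  proof (cases r)
    case (Suc q)
    define F where "F j i = frag_cmul ((-1) ^ (i + j))
       (frag_of (cube_face (Suc q) j 0 (cube_face (Suc (Suc q)) i 0 T))
      - frag_of (cube_face (Suc q) j 1 (cube_face (Suc (Suc q)) i 0 T))
      - frag_of (cube_face (Suc q) j 0 (cube_face (Suc (Suc q)) i 1 T))
      + frag_of (cube_face (Suc q) j 1 (cube_face (Suc (Suc q)) i 1 T)))" for i j
    have swap: "F j i + F i (Suc j) = 0" if "i \<le> j" "j \<le> q" for i j
    proof -
      have *: "frag_cmul (s * - 1) (x - z - y + w) = - frag_cmul s (x - y - z + w)"
        for x y z w :: "((nat \<Rightarrow> real) \<Rightarrow> 'a) \<Rightarrow>\<^sub>0 int" and s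
        by (rule poly_mapping_eqI) (simp add: lookup_minus lookup_add algebra_simps)
      have s: "(-1) ^ (Suc j + i) = ((-1) ^ (i + j) * - 1 :: int)"
        by (simp add: add.commute)
      have "F i (Suc j) = - F j i"
        unfolding F_def s * using that
        by (simp only: cube_face_cube_face[of i j q 0 0] cube_face_cube_face[of i j q 0 1]
            cube_face_cube_face[of i j q 1 0] cube_face_cube_face[of i j q 1 1] order_refl zero_le_one)
      then show ?thesis by simp
    qed
    have term_eq: "frag_cmul ((-1) ^ Suc i) (sbd (Suc q) (frag_of (cube_face (Suc (Suc q)) i 0 T))
        - sbd (Suc q) (frag_of (cube_face (Suc (Suc q)) i 1 T))) = (\<Sum>j<Suc q. F j i)" for i
    proof -
      have [simp]: "(-1) ^ Suc i * (-1) ^ Suc j = ((-1) ^ (i + j) :: int)" for j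
        by (simp add: power_add)
      have *: "x - y - (z - w) = x - y - z + w" for x y z w :: "'c \<Rightarrow>\<^sub>0 int"
        by simp
      show ?thesis
        unfolding sbd_of sum_subtractf[symmetric] frag_cmul_sum F_def frag_cmul_diff[symmetric]
          frag_cmul_cmul * by (simp only: \<open>\<And>j. (-1) ^ Suc i * (-1) ^ Suc j = ((-1) ^ (i + j) :: int)\<close>)
    qed
    let ?A = "{(i, j). i \<le> j \<and> j < Suc q}" and ?B = "{(i, j). j < i \<and> i < Suc (Suc q)}"
    have AB: "{..<Suc (Suc q)} \<times> {..<Suc q} = ?A \<union> ?B" "?A \<inter> ?B = {}"
      by auto
    have "finite (?A \<union> ?B)"
      unfolding AB(1)[symmetric] by (intro finite_cartesian_product finite_lessThan)
    then have fin: "finite ?A" "finite ?B"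
      unfolding finite_Un by (rule conjunct1, rule conjunct2)
    have "sbd r (sbd (Suc r) (frag_of T)) = (\<Sum>i<Suc (Suc q). \<Sum>j<Suc q. F j i)"
      by (simp only: Suc sbd_of[of "Suc (Suc q)"] sbd_sum sbd_cmul sbd_diff term_eq)
    also have "\<dots> = (\<Sum>(i, j)\<in>?A \<union> ?B. F j i)"
      by (simp only: sum.cartesian_product AB)
    also have "\<dots> = (\<Sum>(i, j)\<in>?A. F j i) + (\<Sum>(i, j)\<in>?B. F j i)"
      by (rule sum.union_disjoint[OF fin AB(2)])
    also have "\<dots> = (\<Sum>(i, j)\<in>?A. F j i) + (\<Sum>(i, j)\<in>?A. F i (Suc j))"
      by (rule arg_cong[where f="\<lambda>z. _ + z"],
          rule sum.reindex_bij_witness[of _ "\<lambda>(i, j). (Suc j, i)" "\<lambda>(i, j). (j, i - 1)"])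
        (clarsimp; linarith?)+
    also have "\<dots> = (\<Sum>x\<in>?A. (case x of (i, j) \<Rightarrow> F j i) + (case x of (i, j) \<Rightarrow> F i (Suc j)))"
      by (rule sum.distrib[symmetric])
    also have "\<dots> = 0"
    proof (rule sum.neutral, rule ballI)
      fix x assume "x \<in> ?A"
      then obtain i j where "x = (i, j)" "i \<le> j" "j < Suc q" by blast
      then show "(case x of (i, j) \<Rightarrow> F j i) + (case x of (i, j) \<Rightarrow> F i (Suc j)) = 0"
        using swap[of i j] unfolding \<open>x = (i, j)\<close> prod.case by (metis less_Suc_eq_le)
    qed
    finally show ?thesis .
  qed simp
qed (simp_all add: sbd_diff)

section \<open>Singular cubes, degenerate cubes and relative chains\<close>

lemma top_of_unit_cube: "subtopology (Euclidean_space r) (unit_cube r) = top_of_set (unit_cube r)"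
proof -
  have "{x. \<forall>i\<ge>r. x i = 0} \<inter> unit_cube r = unit_cube r"
    by (auto simp: unit_cube_def)
  then show ?thesis
    by (simp add: Euclidean_space_def subtopology_subtopology euclidean_product_topology)
qed

lemma singular_cube_iff:
  "singular_cube r X T \<longleftrightarrow> continuous_map (top_of_set (unit_cube r)) X T \<and> T \<in> extensional (unit_cube r)"
  by (simp add: singular_cube_def top_of_unit_cube)

lemma singular_cube_in_topspace: "\<lbrakk>singular_cube r X T; t \<in> unit_cube r\<rbrakk> \<Longrightarrow> T t \<in> topspace X"
  unfolding singular_cube_iff using continuous_map_image_subset_topspace by fastforce

lemma continuous_on_coord [continuous_intros]: "continuous_on S (\<lambda>x. x (i::nat) :: real)"
  using continuous_on_product_then_coordinatewise[OF continuous_on_id] .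

lemma continuous_on_upd [continuous_intros]:
  fixes f :: "'a::topological_space \<Rightarrow> nat \<Rightarrow> real"
  assumes "continuous_on S f" "continuous_on S g"
  shows "continuous_on S (\<lambda>x. (f x)(i := g x))"
proof (rule continuous_on_coordinatewise_then_product)
  fix j show "continuous_on S (\<lambda>x. ((f x)(i := g x)) j)"
    using assms by (cases "j = i") (auto intro: continuous_on_product_then_coordinatewise)
qed

lemma continuous_on_insert_coord: "continuous_on S (insert_coord i a)"
proof (rule continuous_on_coordinatewise_then_product)
  fix j show "continuous_on S (\<lambda>x. insert_coord i a x j)"
    unfolding insert_coord_def by (cases "j < i"; cases "j = i") (auto intro: continuous_on_coord)
qed

lemma singular_cube_restrict_compose:
  assumes T: "singular_cube r X T" and g: "continuous_on (unit_cube n) g" "g ` unit_cube n \<subseteq> unit_cube r"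
  shows "singular_cube n X (restrict (T \<circ> g) (unit_cube n))"
proof -
  have "continuous_map (top_of_set (unit_cube n)) (top_of_set (unit_cube r)) g"
    using g by auto
  then have "continuous_map (top_of_set (unit_cube n)) X (T \<circ> g)"
    using T continuous_map_compose unfolding singular_cube_iff by blast
  then show ?thesis
    unfolding singular_cube_iff by (auto intro: continuous_map_eq)
qed

lemma singular_cube_face:
  "\<lbrakk>singular_cube (Suc r) X T; i < Suc r; 0 \<le> a; a \<le> 1\<rbrakk> \<Longrightarrow> singular_cube r X (cube_face (Suc r) i a T)"
  unfolding cube_face_def diff_Suc_1
  by (erule singular_cube_restrict_compose) (auto simp: continuous_on_insert_coord insert_coord_unit_cube)

lemma singular_cube_push_on:
  assumes "singular_cube r X T" "continuous_map (subtopology X V) Y f" "T ` unit_cube r \<subseteq> V"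
  shows "singular_cube r Y (push r f T)"
proof -
  have "continuous_map (top_of_set (unit_cube r)) (subtopology X V) T"
    using assms unfolding singular_cube_iff by (auto intro!: continuous_map_into_subtopology)
  then have "continuous_map (top_of_set (unit_cube r)) Y (f \<circ> T)"
    using assms(2) continuous_map_compose by blast
  then show ?thesis
    unfolding singular_cube_iff push_def by (auto intro: continuous_map_eq)
qed

lemma singular_cube_push:
  "\<lbrakk>singular_cube r X T; continuous_map X Y f\<rbrakk> \<Longrightarrow> singular_cube r Y (push r f T)"
  by (rule singular_cube_push_on[where V=UNIV]) auto

lemma singular_cube_prism:
  assumes T: "singular_cube r X T"
    and H: "continuous_map (prod_topology X (top_of_set {0..1})) Y (\<lambda>(x, u). H x u)"
  shows "singular_cube (Suc r) Y (prism r H T)"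
proof -
  have "continuous_map (top_of_set (unit_cube (Suc r))) (top_of_set (unit_cube r)) (\<lambda>t. t(r := 0))"
    using continuous_on_upd[OF continuous_on_id continuous_on_const, of "unit_cube (Suc r)" r 0]
    by (auto simp: upd_unit_cube)
  then have "continuous_map (top_of_set (unit_cube (Suc r))) X (T \<circ> (\<lambda>t. t(r := 0)))"
    using T continuous_map_compose unfolding singular_cube_iff by blast
  moreover have "continuous_map (top_of_set (unit_cube (Suc r))) (top_of_set {0..1}) (\<lambda>t. t r)"
    by (auto simp: unit_cube_coord intro!: continuous_intros)
  ultimately have "continuous_map (top_of_set (unit_cube (Suc r))) (prod_topology X (top_of_set {0..1}))
      (\<lambda>t. (T (t(r := 0)), t r))"
    by (simp add: continuous_map_paired o_def)
  then have "continuous_map (top_of_set (unit_cube (Suc r))) Y ((\<lambda>(x, u). H x u) \<circ> (\<lambda>t. (T (t(r := 0)), t r)))"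
    using H continuous_map_compose by blast
  then show ?thesis
    unfolding singular_cube_iff prism_def by (auto intro: continuous_map_eq)
qed

lemma singular_cube_subtopology:
  "singular_cube r (subtopology X A) T \<longleftrightarrow> singular_cube r X T \<and> T ` unit_cube r \<subseteq> A"
  unfolding singular_cube_iff by (auto simp: continuous_map_in_subtopology)

lemma degenerate_cubeI:
  "\<lbrakk>i < r; \<And>s t. \<lbrakk>s \<in> unit_cube r; t \<in> unit_cube r; \<And>j. j \<noteq> i \<Longrightarrow> s j = t j\<rbrakk> \<Longrightarrow> T s = T t\<rbrakk>
     \<Longrightarrow> degenerate_cube r T"
  unfolding degenerate_cube_def by blast

lemma degenerate_cube_0 [simp]: "\<not> degenerate_cube 0 T"
  by (simp add: degenerate_cube_def)

lemma degenerate_push: "degenerate_cube r T \<Longrightarrow> degenerate_cube r (push r f T)"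
  unfolding degenerate_cube_def push_def restrict_def comp_def by (metis (no_types, lifting))

lemma degenerate_prism:
  assumes "degenerate_cube r T" shows "degenerate_cube (Suc r) (prism r H T)"
proof -
  obtain i where i: "i < r"
    and T: "\<And>s t. \<lbrakk>s \<in> unit_cube r; t \<in> unit_cube r; \<And>j. j \<noteq> i \<Longrightarrow> s j = t j\<rbrakk> \<Longrightarrow> T s = T t"
    using assms unfolding degenerate_cube_def by blast
  show ?thesis
  proof (rule degenerate_cubeI[of i])
    fix s t assume st: "s \<in> unit_cube (Suc r)" "t \<in> unit_cube (Suc r)" "\<And>j. j \<noteq> i \<Longrightarrow> s j = t j"
    have "T (s(r := 0)) = T (t(r := 0))"
      by (rule T) (use st in \<open>auto simp: upd_unit_cube\<close>)
    moreover have "s r = t r" using st(3)[of r] i by auto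
    ultimately show "prism r H T s = prism r H T t"
      using st by (simp add: prism_def)
  qed (use i in simp)
qed

lemma degenerate_prism_constant:
  assumes "\<And>x u v. \<lbrakk>x \<in> T ` unit_cube r; u \<in> {0..1}; v \<in> {0..1}\<rbrakk> \<Longrightarrow> H x u = H x v"
  shows "degenerate_cube (Suc r) (prism r H T)"
proof (rule degenerate_cubeI[of r])
  fix s t assume st: "s \<in> unit_cube (Suc r)" "t \<in> unit_cube (Suc r)" "\<And>j. j \<noteq> r \<Longrightarrow> s j = t j"
  have eq: "s(r := 0) = t(r := 0)" using st(3) by (auto simp: fun_eq_iff)
  have "H (T (t(r := 0))) (s r) = H (T (t(r := 0))) (t r)"
    by (rule assms) (use st in \<open>auto simp: upd_unit_cube unit_cube_coord\<close>)
  then show "prism r H T s = prism r H T t"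
    using st(1,2) by (simp add: prism_def eq)
qed simp

lemma push_image: "push r f T ` unit_cube r = f ` T ` unit_cube r"
  by (auto simp: push_def image_image intro!: image_cong)

lemma prism_image: "prism r H T ` unit_cube (Suc r) \<subseteq> {H x u |x u. x \<in> T ` unit_cube r \<and> u \<in> {0..1}}"
proof
  fix y assume "y \<in> prism r H T ` unit_cube (Suc r)"
  then obtain t where t: "t \<in> unit_cube (Suc r)" "y = H (T (t(r := 0))) (t r)"
    by (auto simp: prism_def)
  moreover have "t r \<in> {0..1}" using unit_cube_coord[OF t(1)] by auto
  ultimately show "y \<in> {H x u |x u. x \<in> T ` unit_cube r \<and> u \<in> {0..1}}"
    using upd_unit_cube(1)[OF t(1)] by blast
qed

lemma cube_face_image:
  "\<lbrakk>i < Suc r; 0 \<le> a; a \<le> 1\<rbrakk> \<Longrightarrow> cube_face (Suc r) i a T ` unit_cube r \<subseteq> T ` unit_cube (Suc r)"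
  using insert_coord_unit_cube[of _ r i a] by (auto simp: cube_face_app intro!: imageI)

definition scubes :: "nat \<Rightarrow> 'x topology \<Rightarrow> ((nat \<Rightarrow> real) \<Rightarrow> 'x) set" where
  "scubes r X = {T. singular_cube r X T}"

text \<open>These cubes span the chains that vanish in the complex of the pair \<open>(X, A)\<close>: the degenerate ones
  and those inside \<open>A\<close>. With \<open>A = {}\<close> only degenerate cubes remain.\<close>

definition relc :: "nat \<Rightarrow> 'x topology \<Rightarrow> 'x set \<Rightarrow> ((nat \<Rightarrow> real) \<Rightarrow> 'x) set" where
  "relc r X A = {T. singular_cube r X T \<and> (degenerate_cube r T \<or> T ` unit_cube r \<subseteq> A)}"

lemma relc_empty: "relc r X {} = {T. singular_cube r X T \<and> degenerate_cube r T}"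
  using unit_cube_nonempty[of r] by (auto simp: relc_def)

lemma relc_mono: "A \<subseteq> B \<Longrightarrow> relc r X A \<subseteq> relc r X B"
  by (auto simp: relc_def)

lemma relc_subset: "relc r X A \<subseteq> scubes r X"
  by (auto simp: relc_def scubes_def)

lemma sbd_scubes:
  assumes "c \<in> chains (scubes r X)" shows "sbd r c \<in> chains (scubes (r - 1) X)"
proof (cases r)
  case (Suc q)
  show ?thesis
    unfolding sbd_def Suc
    by (rule chains_extend[OF assms[unfolded Suc]], rule chains_sum, rule chains_cmul, rule chains_diff)
      (auto simp: scubes_def singular_cube_face)
qed simp

text \<open>For a cube that is constant in direction \<open>i\<close> the two faces in this direction cancel and all
  others are constant in one direction.\<close>

lemma sbd_degenerate:
  assumes "singular_cube (Suc r) X T" "degenerate_cube (Suc r) T"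
  shows "sbd (Suc r) (frag_of T) \<in> chains (relc r X A)"
proof -
  obtain i where i: "i < Suc r"
    and T: "\<And>s t. \<lbrakk>s \<in> unit_cube (Suc r); t \<in> unit_cube (Suc r); \<And>j. j \<noteq> i \<Longrightarrow> s j = t j\<rbrakk> \<Longrightarrow> T s = T t"
    using assms unfolding degenerate_cube_def by blast
  have "cube_face (Suc r) i 0 T = cube_face (Suc r) i 1 T"
  proof (rule ext)
    fix t
    have "T (insert_coord i 0 t) = T (insert_coord i 1 t)" if "t \<in> unit_cube r"
    proof (rule T)
      show "insert_coord i 0 t j = insert_coord i 1 t j" if "j \<noteq> i" for j
        using that by (simp add: insert_coord_def)
    qed (use that i in \<open>auto intro!: insert_coord_unit_cube\<close>)
    then show "cube_face (Suc r) i 0 T t = cube_face (Suc r) i 1 T t"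
      by (auto simp: cube_face_def restrict_def)
  qed
  moreover have "cube_face (Suc r) j a T \<in> relc r X A" if j: "j < Suc r" "j \<noteq> i" and a: "0 \<le> a" "a \<le> 1" for j a
  proof -
    define i' where "i' = (if i < j then i else i - 1)"
    have "degenerate_cube r (cube_face (Suc r) j a T)"
    proof (rule degenerate_cubeI[of i'])
      show "i' < r" using i j by (auto simp: i'_def)
      fix s t assume st: "s \<in> unit_cube r" "t \<in> unit_cube r" "\<And>j. j \<noteq> i' \<Longrightarrow> s j = t j"
      have "T (insert_coord j a s) = T (insert_coord j a t)"
      proof (rule T)
        fix l assume "l \<noteq> i"
        then have "l < j \<and> l \<noteq> i' \<or> l = j \<or> l > j \<and> l - 1 \<noteq> i'"
          using j(2) unfolding i'_def by (cases "i < j"; simp; presburger)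
        then show "insert_coord j a s l = insert_coord j a t l"
          using st(3) by (auto simp: insert_coord_def)
      qed (use st j a in \<open>auto intro!: insert_coord_unit_cube\<close>)
      then show "cube_face (Suc r) j a T s = cube_face (Suc r) j a T t"
        using st by (simp add: cube_face_app)
    qed
    then show ?thesis
      using assms(1) j a by (simp add: relc_def singular_cube_face)
  qed
  ultimately have "frag_of (cube_face (Suc r) j 0 T) - frag_of (cube_face (Suc r) j 1 T) \<in> chains (relc r X A)"
    if "j < Suc r" for j
    using that by (cases "j = i") (auto intro: chains_diff)
  then show ?thesis
    unfolding sbd_of by (intro chains_sum chains_cmul) auto
qed

lemma sbd_relc:
  assumes "c \<in> chains (relc r X A)" shows "sbd r c \<in> chains (relc (r - 1) X A)"
proof (cases r)
  case (Suc q)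
  show ?thesis
    using assms
  proof (induction rule: chains_induct)
    case (one T)
    show ?case
    proof (cases "degenerate_cube r T")
      case False
      then have "T ` unit_cube (Suc q) \<subseteq> A" "singular_cube (Suc q) X T"
        using one Suc by (auto simp: relc_def)
      then have "cube_face (Suc q) i a T \<in> relc q X A" if "i < Suc q" "0 \<le> a" "a \<le> 1" for i a
        using order_trans[OF cube_face_image[OF that, of T] \<open>T ` unit_cube (Suc q) \<subseteq> A\<close>] that
          \<open>singular_cube (Suc q) X T\<close> by (auto simp only: relc_def singular_cube_face mem_Collect_eq)
      then show ?thesis
        unfolding Suc sbd_of by (intro chains_sum chains_cmul chains_diff) auto
    qed (use one sbd_degenerate Suc in \<open>auto simp: relc_def\<close>)
  qed (auto simp: sbd_diff chains_diff)
qed simp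

lemma pushc_scubes:
  "\<lbrakk>c \<in> chains (scubes r X); continuous_map X Y f\<rbrakk> \<Longrightarrow> pushc r f c \<in> chains (scubes r Y)"
  unfolding pushc_def by (erule chains_extend) (auto simp: scubes_def singular_cube_push)

lemma pushc_relc:
  "\<lbrakk>c \<in> chains (relc r X A); continuous_map X Y f; f ` A \<subseteq> B\<rbrakk> \<Longrightarrow> pushc r f c \<in> chains (relc r Y B)"
  unfolding pushc_def
  by (erule chains_extend) (auto simp: relc_def singular_cube_push degenerate_push push_image)

lemma prismc_scubes:
  "\<lbrakk>c \<in> chains (scubes r X); continuous_map (prod_topology X (top_of_set {0..1})) Y (\<lambda>(x, u). H x u)\<rbrakk>
     \<Longrightarrow> prismc r H c \<in> chains (scubes (Suc r) Y)"
  unfolding prismc_def by (erule chains_extend) (auto simp: scubes_def singular_cube_prism)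

lemma prismc_relc:
  assumes "c \<in> chains (relc r X A)" "continuous_map (prod_topology X (top_of_set {0..1})) Y (\<lambda>(x, u). H x u)"
    and "\<And>x u. \<lbrakk>x \<in> A; u \<in> {0..1}\<rbrakk> \<Longrightarrow> H x u \<in> B"
  shows "prismc r H c \<in> chains (relc (Suc r) Y B)"
  unfolding prismc_def
proof (rule chains_extend[OF assms(1)])
  fix T assume T: "T \<in> relc r X A"
  then have "prism r H T ` unit_cube (Suc r) \<subseteq> B" if "\<not> degenerate_cube r T"
  proof -
    have "T ` unit_cube r \<subseteq> A" using T that by (simp add: relc_def)
    then have "{H x u |x u. x \<in> T ` unit_cube r \<and> u \<in> {0..1}} \<subseteq> B"
      using assms(3) by auto
    then show ?thesis using prism_image[of r H T] by (rule order_trans[rotated])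
  qed
  then show "frag_of (prism r H T) \<in> chains (relc (Suc r) Y B)"
    using T assms(2) degenerate_prism[of r T H] singular_cube_prism[of r X T Y H]
    unfolding relc_def chains_of mem_Collect_eq by blast
qed

section \<open>Subdivision\<close>

text \<open>Subdivision is a natural operation: it composes a singular cube with a fixed chain of maps of cubes
  into the standard cube, a model chain. Identities between natural operations reduce to identities
  between model chains, and the latter are built as products of chains on the interval.\<close>

lemma pushc_pushc: "pushc n g (pushc n f c) = pushc n (g \<circ> f) c"
proof -
  have "push n g (push n f T) = push n (g \<circ> f) T" for T
    by (auto simp: push_def restrict_def fun_eq_iff)
  then show ?thesis by (simp add: pushc_def frag_extend_extend)
qed

lemma pushc_cong:
  assumes "c \<in> chains A" "\<And>m t. \<lbrakk>m \<in> A; t \<in> unit_cube n\<rbrakk> \<Longrightarrow> f (m t) = g (m t)"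
  shows "pushc n f c = pushc n g c"
proof -
  have "push n f m = push n g m" if "m \<in> A" for m
    using assms(2)[OF that] by (auto simp: push_def restrict_def fun_eq_iff)
  then show ?thesis unfolding pushc_def by (intro frag_extend_eq_on[OF assms(1)]) simp
qed

lemma prismc_pushc:
  assumes "\<And>x u. H' (f x) u = f (H x u)"
  shows "prismc n H' (pushc n f c) = pushc (Suc n) f (prismc n H c)"
proof -
  have "prism n H' (push n f T) = push (Suc n) f (prism n H T)" for T
    by (auto simp: push_def prism_def restrict_def fun_eq_iff upd_unit_cube assms)
  then show ?thesis by (simp add: pushc_def prismc_def frag_extend_extend)
qed

text \<open>The alternating sum of the inclusions of the faces of the \<open>m\<close>-cube, each composed with the model
  chain \<open>c\<close> of the cube of one dimension less. The operation of a family of model chains commutes with the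
  boundary when the boundary of each member is the sum of the cofaces of the preceding one.\<close>

definition cofaces :: "nat \<Rightarrow> nat \<Rightarrow> (nat \<Rightarrow> real) cube_chain \<Rightarrow> (nat \<Rightarrow> real) cube_chain" where
  "cofaces n m c = (\<Sum>i<m. frag_cmul ((-1) ^ Suc i) (pushc n (insert_coord i 0) c - pushc n (insert_coord i 1) c))"

lemma cofaces_0 [simp]: "cofaces n 0 c = 0" "cofaces n m 0 = 0"
  by (simp_all add: cofaces_def)

lemma cofaces_Suc: "cofaces n (Suc m) c = cofaces n m c
    + frag_cmul ((-1) ^ Suc m) (pushc n (insert_coord m 0) c - pushc n (insert_coord m 1) c)"
  by (simp add: cofaces_def sum.lessThan_Suc)

lemma cofaces_diff: "cofaces n m (c - d) = cofaces n m c - cofaces n m d"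
  unfolding cofaces_def pushc_diff sum_subtractf[symmetric]
  by (intro sum.cong refl poly_mapping_eqI) (simp add: lookup_minus lookup_add algebra_simps del: power_Suc)

lemma cofaces_minus: "cofaces n m (- c) = - cofaces n m c"
  using cofaces_diff[of n m 0 c] by simp

lemma cofaces_add: "cofaces n m (c + d) = cofaces n m c + cofaces n m d"
  using cofaces_diff[of n m c "- d"] by (simp add: cofaces_minus)

lemma cofaces_cmul: "cofaces n m (frag_cmul a c) = frag_cmul a (cofaces n m c)"
  by (simp add: cofaces_def pushc_cmul frag_cmul_diff[symmetric] frag_cmul_sum mult.commute
      del: minus_frag_cmul power_Suc)

lemma prismc_cofaces:
  assumes "\<And>i a x u. i < m \<Longrightarrow> H' (insert_coord i a x) u = insert_coord i a (H x u)"
  shows "prismc n H' (cofaces n m c) = cofaces (Suc n) m (prismc n H c)"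
  unfolding cofaces_def prismc_sum prismc_cmul prismc_diff
  by (rule sum.cong[OF refl]) (use assms in \<open>simp add: prismc_pushc[of H' _ H]\<close>)

definition idc :: "nat \<Rightarrow> (nat \<Rightarrow> real) \<Rightarrow> nat \<Rightarrow> real" where
  "idc r = restrict (\<lambda>t. t) (unit_cube r)"

text \<open>The product of a model chain with the subdivided interval \<open>[0,1/2] + [1/2,1]\<close>, the latter in
  coordinate \<open>r\<close> of the target.\<close>

definition halves :: "nat \<Rightarrow> nat \<Rightarrow> (nat \<Rightarrow> real) cube_chain \<Rightarrow> (nat \<Rightarrow> real) cube_chain" where
  "halves n r c = prismc n (\<lambda>x u. x(r := u / 2)) c + prismc n (\<lambda>x u. x(r := (1 + u) / 2)) c"

lemma halves_add: "halves n r (c + d) = halves n r c + halves n r d"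
  and halves_diff: "halves n r (c - d) = halves n r c - halves n r d"
  and halves_minus: "halves n r (- c) = - halves n r c"
  and halves_0 [simp]: "halves n r 0 = 0"
  by (simp_all add: halves_def prismc_add prismc_diff prismc_minus)

text \<open>The subdivision of the \<open>r\<close>-cube into the \<open>2 ^ r\<close> cubes of half the side length.\<close>

primrec sdm :: "nat \<Rightarrow> ((nat \<Rightarrow> real) \<Rightarrow> nat \<Rightarrow> real) \<Rightarrow>\<^sub>0 int" where
  "sdm 0 = frag_of (idc 0)"
| "sdm (Suc r) = halves r r (sdm r)"

text \<open>The homotopy on the interval between its subdivision and the identity, times the identity of the
  other coordinates: of the map \<open>(x, u) \<mapsto> x (1 + u) / 2\<close> of the square into the interval the side \<open>u = 0\<close> is
  the lower half, the side \<open>u = 1\<close> is the identity, the side \<open>x = 1\<close> is the upper half, and the side \<open>x = 0\<close>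
  is constant, so degenerate.\<close>

definition shear :: "nat \<Rightarrow> ((nat \<Rightarrow> real) \<Rightarrow> nat \<Rightarrow> real) \<Rightarrow>\<^sub>0 int" where
  "shear r = prismc (Suc r) (\<lambda>x u. x(r := x r * (1 + u) / 2)) (frag_of (idc (Suc r)))"

text \<open>The homotopy between product maps, changing one factor after the other. The sign is that of
  the Leibniz rule for the boundary of a product with an \<open>r\<close>-cube.\<close>

primrec hdm :: "nat \<Rightarrow> ((nat \<Rightarrow> real) \<Rightarrow> nat \<Rightarrow> real) \<Rightarrow>\<^sub>0 int" where
  "hdm 0 = 0"
| "hdm (Suc r) = halves (Suc r) r (hdm r) + frag_cmul ((-1) ^ r) (shear r)"

lemma halves_cofaces: "halves n (Suc q) (cofaces n (Suc q) c) = cofaces (Suc n) (Suc q) (halves n q c)"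
  unfolding halves_def cofaces_add
  by (subst (1 2) prismc_cofaces) (auto simp: insert_coord_upd)

text \<open>For every coordinate \<open>i\<close> of the target some source coordinate influences only \<open>i\<close>. This
  ensures that composition with \<open>m\<close> preserves degenerate cubes.\<close>

definition spread :: "nat \<Rightarrow> nat \<Rightarrow> ((nat \<Rightarrow> real) \<Rightarrow> nat \<Rightarrow> real) \<Rightarrow> bool" where
  "spread n r m \<longleftrightarrow> (\<forall>i<r. \<exists>i'<n. \<forall>s\<in>unit_cube n. \<forall>t\<in>unit_cube n.
     (\<forall>j. j \<noteq> i' \<longrightarrow> s j = t j) \<longrightarrow> (\<forall>j. j \<noteq> i \<longrightarrow> m s j = m t j))"

definition model_cubes :: "nat \<Rightarrow> nat \<Rightarrow> ((nat \<Rightarrow> real) \<Rightarrow> nat \<Rightarrow> real) set" where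
  "model_cubes n r = {m. singular_cube n (top_of_set (unit_cube r)) m \<and> spread n r m}"

lemma model_cubes_unit_cube: "\<lbrakk>m \<in> model_cubes n r; t \<in> unit_cube n\<rbrakk> \<Longrightarrow> m t \<in> unit_cube r"
  unfolding model_cubes_def using singular_cube_in_topspace by fastforce

lemma sbd_halves:
  assumes "c \<in> chains (model_cubes n r)"
  shows "sbd (Suc n) (halves n r c) = halves (n - 1) r (sbd n c)
    + frag_cmul ((-1) ^ Suc n) (pushc n (insert_coord r 0) c - pushc n (insert_coord r 1) c)"
proof -
  have *: "pushc n (\<lambda>x. x(r := a)) c = pushc n (insert_coord r a) c" for a
    by (rule pushc_cong[OF assms]) (simp add: insert_coord_last model_cubes_unit_cube)
  have cancel: "(P + frag_cmul s (A - B)) + (Q + frag_cmul s (B - C)) = (P + Q) + frag_cmul s (A - C)"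
    for P Q A B C :: "((nat \<Rightarrow> real) \<Rightarrow> nat \<Rightarrow> real) \<Rightarrow>\<^sub>0 int" and s
    by (simp add: frag_cmul_diff)
  show ?thesis
    unfolding halves_def sbd_add sbd_prismc by (simp add: cancel *[symmetric] del: power_Suc)
qed

lemma idc_singular: "singular_cube r (top_of_set (unit_cube r)) (idc r)"
  unfolding singular_cube_iff idc_def by (auto intro: continuous_map_eq[of _ _ "\<lambda>t. t"])

lemma idc_model: "idc r \<in> model_cubes r r"
  unfolding model_cubes_def spread_def using idc_singular by (auto simp: idc_def)

lemma prod_top_of_set: "prod_topology (top_of_set A) (top_of_set B) = top_of_set (A \<times> B)"
proof -
  have "prod_topology euclidean euclidean = (euclidean :: ('a \<times> 'b) topology)"
    unfolding topology_eq openin_prod_topology_alt open_openin[symmetric] open_prod_def by fastforce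
  then show ?thesis by (metis subtopology_Times)
qed

lemma prism_model:
  assumes m: "m \<in> model_cubes n r" and a: "continuous_on {0..1} a" "a ` {0..1} \<subseteq> {0..1}"
  shows "prism n (\<lambda>x u. x(r := a u)) m \<in> model_cubes (Suc n) (Suc r)"
proof -
  have cont: "continuous_map (prod_topology (top_of_set (unit_cube r)) (top_of_set {0..1})) (top_of_set (unit_cube (Suc r)))
      (\<lambda>(x, u). x(r := a u))"
  proof -
    have "continuous_on (unit_cube r \<times> {0..1}) (\<lambda>p. (fst p)(r := a (snd p)))"
      by (intro continuous_on_upd continuous_intros continuous_on_compose2[OF a(1)]) auto
    moreover have "(fst p)(r := a (snd p)) \<in> unit_cube (Suc r)" if "p \<in> unit_cube r \<times> {0..1}" for p
      using that a(2) by (intro upd_unit_cube) auto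
    ultimately show ?thesis
      by (auto simp: prod_top_of_set case_prod_unfold)
  qed
  have "spread (Suc n) (Suc r) (prism n (\<lambda>x u. x(r := a u)) m)"
    unfolding spread_def
  proof (intro allI impI)
    fix i assume i: "i < Suc r"
    show "\<exists>i'<Suc n. \<forall>s\<in>unit_cube (Suc n). \<forall>t\<in>unit_cube (Suc n). (\<forall>j. j \<noteq> i' \<longrightarrow> s j = t j) \<longrightarrow>
       (\<forall>j. j \<noteq> i \<longrightarrow> prism n (\<lambda>x u. x(r := a u)) m s j = prism n (\<lambda>x u. x(r := a u)) m t j)"
    proof (cases "i = r")
      case True
      show ?thesis
      proof (intro exI[of _ n] conjI ballI impI allI)
        fix s t j assume st: "s \<in> unit_cube (Suc n)" "t \<in> unit_cube (Suc n)" "\<forall>j. j \<noteq> n \<longrightarrow> s j = t j" "j \<noteq> i"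
        have "s(n := 0) = t(n := 0)" using st(3) by (auto simp: fun_eq_iff)
        then show "prism n (\<lambda>x u. x(r := a u)) m s j = prism n (\<lambda>x u. x(r := a u)) m t j"
          using st(1,2,4) True by (simp add: prism_def)
      qed simp
    next
      case False
      then have "i < r" using i by simp
      moreover have "spread n r m"
        using m by (simp add: model_cubes_def)
      ultimately obtain i' where i': "i' < n" and S: "\<forall>s\<in>unit_cube n. \<forall>t\<in>unit_cube n.
          (\<forall>j. j \<noteq> i' \<longrightarrow> s j = t j) \<longrightarrow> (\<forall>j. j \<noteq> i \<longrightarrow> m s j = m t j)"
        unfolding spread_def by meson
      show ?thesis
      proof (intro exI[of _ i'] conjI ballI impI allI)
        fix s t j assume st: "s \<in> unit_cube (Suc n)" "t \<in> unit_cube (Suc n)" "\<forall>j. j \<noteq> i' \<longrightarrow> s j = t j" "j \<noteq> i"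
        have "m (s(n := 0)) j = m (t(n := 0)) j"
          using S[THEN bspec, THEN bspec, OF upd_unit_cube(1)[OF st(1)] upd_unit_cube(1)[OF st(2)]] st(3,4) by simp
        then show "prism n (\<lambda>x u. x(r := a u)) m s j = prism n (\<lambda>x u. x(r := a u)) m t j"
          using st i' by (simp add: prism_def)
      qed (use i' in simp)
    qed
  qed
  then show ?thesis
    using m singular_cube_prism[OF _ cont] by (auto simp: model_cubes_def)
qed

lemma halves_model:
  assumes "c \<in> chains (model_cubes n r)" shows "halves n r c \<in> chains (model_cubes (Suc n) (Suc r))"
proof -
  have lo: "prism n (\<lambda>x u. x(r := u / 2)) m \<in> model_cubes (Suc n) (Suc r)" if "m \<in> model_cubes n r" for m
    by (rule prism_model[OF that]) (auto intro!: continuous_intros)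
  have hi: "prism n (\<lambda>x u. x(r := (1 + u) / 2)) m \<in> model_cubes (Suc n) (Suc r)" if "m \<in> model_cubes n r" for m
    by (rule prism_model[OF that]) (auto intro!: continuous_intros)
  show ?thesis
    unfolding halves_def prismc_def
    by (intro chains_add chains_extend[OF assms]) (auto intro: lo hi)
qed

lemma shear_cont: "continuous_map (prod_topology (top_of_set (unit_cube (Suc r))) (top_of_set {0..1})) (top_of_set (unit_cube (Suc r)))
      (\<lambda>(x, u). x(r := x r * (1 + u) / 2))"
proof -
  have "continuous_on (unit_cube (Suc r) \<times> {0..1}) (\<lambda>p. (fst p)(r := (fst p) r * (1 + snd p) / 2))"
    by (intro continuous_on_upd continuous_intros continuous_on_product_then_coordinatewise[OF continuous_on_fst]) auto
  moreover have "(fst p)(r := (fst p) r * (1 + snd p) / 2) \<in> unit_cube (Suc r)" if "p \<in> unit_cube (Suc r) \<times> {0..1}" for p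
  proof (rule upd_unit_cube(3))
    have "0 \<le> fst p r" "fst p r \<le> 1" "0 \<le> snd p" "snd p \<le> 1"
      using that unit_cube_coord[of "fst p" "Suc r" r] by auto
    then show "0 \<le> fst p r * (1 + snd p) / 2" "fst p r * (1 + snd p) / 2 \<le> 1"
      using mult_mono[of "fst p r" 1 "1 + snd p" 2] by auto
  qed (use that in auto)
  ultimately show ?thesis
    by (auto simp: prod_top_of_set case_prod_unfold)
qed

lemma shear_model: "shear r \<in> chains (model_cubes (Suc (Suc r)) (Suc r))"
proof -
  let ?P = "prism (Suc r) (\<lambda>x u. x(r := x r * (1 + u) / 2)) (idc (Suc r))"
  have P: "?P t = t(Suc r := 0, r := t r * (1 + t (Suc r)) / 2)" if "t \<in> unit_cube (Suc (Suc r))" for t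
    using that by (simp add: prism_def idc_def upd_unit_cube)
  have "\<exists>i'<Suc (Suc r). \<forall>s\<in>unit_cube (Suc (Suc r)). \<forall>t\<in>unit_cube (Suc (Suc r)).
     (\<forall>j. j \<noteq> i' \<longrightarrow> s j = t j) \<longrightarrow> (\<forall>j. j \<noteq> i \<longrightarrow> ?P s j = ?P t j)" if "i < Suc r" for i
    by (rule exI[of _ i]) (use that in \<open>auto simp: P\<close>)
  moreover have "singular_cube (Suc (Suc r)) (top_of_set (unit_cube (Suc r))) ?P"
    by (rule singular_cube_prism[OF idc_singular shear_cont])
  ultimately show ?thesis
    unfolding shear_def by (simp add: model_cubes_def spread_def)
qed

lemma sd_model: "sdm r \<in> chains (model_cubes r r)"
  by (induction r) (auto simp: idc_model halves_model)

lemma hd_model: "hdm r \<in> chains (model_cubes (Suc r) r)"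
  by (induction r) (auto simp: halves_model shear_model intro!: chains_add chains_cmul)

lemma sbd_sd: "sbd (Suc r) (sdm (Suc r)) = cofaces r (Suc r) (sdm r)"
proof (induction r)
  case 0
  show ?case unfolding sdm.simps(2)[of 0] sbd_halves[OF sd_model] cofaces_Suc by simp
next
  case (Suc q)
  have "sbd (Suc (Suc q)) (sdm (Suc (Suc q))) = halves q (Suc q) (cofaces q (Suc q) (sdm q))
    + frag_cmul ((-1) ^ Suc (Suc q)) (pushc (Suc q) (insert_coord (Suc q) 0) (sdm (Suc q)) - pushc (Suc q) (insert_coord (Suc q) 1) (sdm (Suc q)))"
    unfolding sdm.simps(2)[of "Suc q"] sbd_halves[OF sd_model] Suc.IH[symmetric] by simp
  also have "halves q (Suc q) (cofaces q (Suc q) (sdm q)) = cofaces (Suc q) (Suc q) (sdm (Suc q))"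
    by (simp add: halves_cofaces)
  finally show ?case by (simp only: cofaces_Suc[of "Suc q" "Suc q"])
qed

lemma sbd_idc: "sbd (Suc r) (frag_of (idc (Suc r))) = cofaces r (Suc r) (frag_of (idc r))"
proof -
  have "cube_face (Suc r) i a (idc (Suc r)) = push r (insert_coord i a) (idc r)"
    if "i < Suc r" "0 \<le> a" "a \<le> 1" for i a
    using that by (auto simp: fun_eq_iff cube_face_def push_def restrict_def idc_def insert_coord_unit_cube)
  then show ?thesis
    unfolding sbd_of cofaces_def by (intro sum.cong) auto
qed

text \<open>The degenerate remainder \<open>d\<close> is the constant side of the square, times the other coordinates.\<close>

lemma sbd_shear: "\<exists>d \<in> chains (relc (Suc r) (top_of_set (unit_cube (Suc r))) {}).
    sbd (Suc (Suc r)) (shear r) = cofaces (Suc r) r (shear (r - 1))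
      + frag_cmul ((-1) ^ r) (halves r r (frag_of (idc r)) - frag_of (idc (Suc r))) + d"
proof -
  let ?H = "\<lambda>(x :: nat \<Rightarrow> real) u. x(r := x r * (1 + u) / 2)"
  let ?lo = "prism r (\<lambda>x u. x(r := u / 2)) (idc r)" and ?hi = "prism r (\<lambda>x u. x(r := (1 + u) / 2)) (idc r)"
  define Z where "Z = prism r ?H (push r (insert_coord r 0) (idc r))"
  have sing: "singular_cube r (top_of_set (unit_cube (Suc r))) (push r (insert_coord r 0) (idc r))"
    by (rule singular_cube_push[OF idc_singular]) (auto simp: continuous_on_insert_coord insert_coord_unit_cube)
  have Z: "Z \<in> relc (Suc r) (top_of_set (unit_cube (Suc r))) {}"
    unfolding relc_empty Z_def mem_Collect_eq
    by (intro conjI singular_cube_prism[OF sing shear_cont] degenerate_prism_constant)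
      (auto simp: push_def idc_def insert_coord_def)
  have hi: "prism r ?H (push r (insert_coord r 1) (idc r)) = ?hi"
    by (auto simp: fun_eq_iff prism_def push_def restrict_def idc_def upd_unit_cube insert_coord_last)
  have lo: "push (Suc r) (\<lambda>x. ?H x 0) (idc (Suc r)) = ?lo"
    by (auto simp: fun_eq_iff prism_def push_def restrict_def idc_def upd_unit_cube)
  have id: "push (Suc r) (\<lambda>x. ?H x 1) (idc (Suc r)) = idc (Suc r)"
    by (auto simp: fun_eq_iff push_def restrict_def idc_def)
  have cof: "prismc r ?H (cofaces r r (frag_of (idc r))) = cofaces (Suc r) r (shear (r - 1))"
  proof (cases r)
    case (Suc q)
    show ?thesis
      unfolding Suc diff_Suc_1 shear_def
      by (rule prismc_cofaces) (auto simp: insert_coord_def fun_eq_iff)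
  qed simp
  have bd: "sbd (Suc (Suc r)) (shear r) = prismc r ?H (sbd (Suc r) (frag_of (idc (Suc r))))
      + frag_cmul ((-1) ^ Suc (Suc r)) (pushc (Suc r) (\<lambda>x. ?H x 0) (frag_of (idc (Suc r)))
          - pushc (Suc r) (\<lambda>x. ?H x 1) (frag_of (idc (Suc r))))"
    unfolding shear_def by (simp only: sbd_prismc diff_Suc_1)
  have bd_id: "sbd (Suc r) (frag_of (idc (Suc r))) = cofaces r r (frag_of (idc r))
      + frag_cmul ((-1) ^ Suc r) (frag_of (push r (insert_coord r 0) (idc r)) - frag_of (push r (insert_coord r 1) (idc r)))"
    by (simp only: sbd_idc cofaces_Suc pushc_of)
  have "sbd (Suc (Suc r)) (shear r) = cofaces (Suc r) r (shear (r - 1))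
      + frag_cmul ((-1) ^ Suc r) (frag_of Z - frag_of ?hi)
      + frag_cmul ((-1) ^ Suc (Suc r)) (frag_of ?lo - frag_of (idc (Suc r)))"
    unfolding bd bd_id prismc_add prismc_cmul prismc_diff prismc_of pushc_of cof hi lo id Z_def ..
  also have "\<dots> = cofaces (Suc r) r (shear (r - 1))
      + frag_cmul ((-1) ^ r) (halves r r (frag_of (idc r)) - frag_of (idc (Suc r))) + frag_cmul ((-1) ^ Suc r) (frag_of Z)"
    unfolding halves_def prismc_of
    by (rule poly_mapping_eqI) (simp add: lookup_add lookup_minus right_diff_distrib distrib_left del: lookup_frag_of)
  finally show ?thesis
    using Z by (auto intro!: bexI[of _ "frag_cmul ((-1) ^ Suc r) (frag_of Z)"] chains_cmul)
qed

lemma halves_cont: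
  "continuous_map (prod_topology (top_of_set (unit_cube r)) (top_of_set {0..1})) (top_of_set (unit_cube (Suc r))) (\<lambda>(x, u). x(r := u / 2))"
  "continuous_map (prod_topology (top_of_set (unit_cube r)) (top_of_set {0..1})) (top_of_set (unit_cube (Suc r))) (\<lambda>(x, u). x(r := (1 + u) / 2))"
proof -
  have "continuous_on (unit_cube r \<times> {0..1}) (\<lambda>p. (fst p)(r := snd p / 2))"
    "continuous_on (unit_cube r \<times> {0..1}) (\<lambda>p. (fst p)(r := (1 + snd p) / 2))"
    by (intro continuous_on_upd continuous_intros; simp)+
  moreover have "(fst p)(r := snd p / 2) \<in> unit_cube (Suc r)" "(fst p)(r := (1 + snd p) / 2) \<in> unit_cube (Suc r)"
    if "p \<in> unit_cube r \<times> {0..1}" for p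
    using that by (auto intro!: upd_unit_cube)
  ultimately show
  "continuous_map (prod_topology (top_of_set (unit_cube r)) (top_of_set {0..1})) (top_of_set (unit_cube (Suc r))) (\<lambda>(x, u). x(r := u / 2))"
  "continuous_map (prod_topology (top_of_set (unit_cube r)) (top_of_set {0..1})) (top_of_set (unit_cube (Suc r))) (\<lambda>(x, u). x(r := (1 + u) / 2))"
    by (auto simp: prod_top_of_set case_prod_unfold)
qed

text \<open>The boundary of a product homotopy. Induction on the number of factors: the homotopy already found
  is multiplied with the subdivided interval, and the new factor contributes \<open>shear\<close>; the two terms
  with the identity on the first factors and the subdivision on the last one cancel.\<close>

lemma sbd_hd: "\<exists>d \<in> chains (relc r (top_of_set (unit_cube r)) {}).
    sbd (Suc r) (hdm r) = - cofaces r r (hdm (r - 1)) + (sdm r - frag_of (idc r)) + d"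
proof (induction r)
  case 0
  show ?case by (rule bexI[of _ 0]) auto
next
  case (Suc r)
  obtain d where d: "d \<in> chains (relc r (top_of_set (unit_cube r)) {})"
    "sbd (Suc r) (hdm r) = - cofaces r r (hdm (r - 1)) + (sdm r - frag_of (idc r)) + d"
    using Suc.IH by blast
  obtain z where z: "z \<in> chains (relc (Suc r) (top_of_set (unit_cube (Suc r))) {})"
    "sbd (Suc (Suc r)) (shear r) = cofaces (Suc r) r (shear (r - 1))
      + frag_cmul ((-1) ^ r) (halves r r (frag_of (idc r)) - frag_of (idc (Suc r))) + z"
    using sbd_shear by blast
  define e where "e = halves r r d + frag_cmul ((-1) ^ r) z"
  have e: "e \<in> chains (relc (Suc r) (top_of_set (unit_cube (Suc r))) {})"
    unfolding e_def halves_def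
    by (intro chains_add chains_cmul z(1) prismc_relc[OF d(1)] halves_cont) auto
  have "halves r r (cofaces r r (hdm (r - 1))) - frag_cmul ((-1) ^ r) (cofaces (Suc r) r (shear (r - 1)))
      = cofaces (Suc r) r (hdm r)"
  proof (cases r)
    case (Suc q)
    show ?thesis
      unfolding Suc diff_Suc_1 halves_cofaces hdm.simps cofaces_add cofaces_cmul
      by (rule poly_mapping_eqI) (simp add: lookup_add lookup_minus)
  qed simp
  then have A: "- halves r r (cofaces r r (hdm (r - 1))) + frag_cmul ((-1) ^ r) (cofaces (Suc r) r (shear (r - 1)))
      = - cofaces (Suc r) r (hdm r)"
    by (metis minus_diff_eq uminus_add_conv_diff)
  have "sbd (Suc (Suc r)) (hdm (Suc r)) = halves r r (sbd (Suc r) (hdm r))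
      + frag_cmul ((-1) ^ Suc (Suc r)) (pushc (Suc r) (insert_coord r 0) (hdm r) - pushc (Suc r) (insert_coord r 1) (hdm r))
      + frag_cmul ((-1) ^ r) (sbd (Suc (Suc r)) (shear r))"
    unfolding hdm.simps sbd_add sbd_cmul sbd_halves[OF hd_model] diff_Suc_1 ..
  also have "\<dots> = (- halves r r (cofaces r r (hdm (r - 1))) + frag_cmul ((-1) ^ r) (cofaces (Suc r) r (shear (r - 1))))
      - frag_cmul ((-1) ^ Suc r) (pushc (Suc r) (insert_coord r 0) (hdm r) - pushc (Suc r) (insert_coord r 1) (hdm r))
      + (sdm (Suc r) - frag_of (idc (Suc r))) + e"
  proof -
    have "(-1) ^ r * (-1) ^ r = (1::int)" by (simp flip: power_add)
    then show ?thesis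
      unfolding d(2) z(2) e_def halves_add halves_diff halves_minus sdm.simps frag_cmul_distrib2 frag_cmul_cmul
      by (intro poly_mapping_eqI) (simp add: lookup_add lookup_minus del: lookup_frag_of)
  qed
  also have "\<dots> = - cofaces (Suc r) (Suc r) (hdm r) + (sdm (Suc r) - frag_of (idc (Suc r))) + e"
    unfolding A cofaces_Suc by (rule poly_mapping_eqI) (simp add: lookup_add lookup_minus del: lookup_frag_of)
  finally show ?case unfolding diff_Suc_1 using e by blast
qed

definition nop :: "nat \<Rightarrow> (nat \<Rightarrow> real) cube_chain \<Rightarrow> 'x cube_chain \<Rightarrow> 'x cube_chain" where
  "nop n c = frag_extend (\<lambda>T. pushc n T c)"

lemma nop_0 [simp]: "nop n c 0 = 0"
  and nop_of: "nop n c (frag_of T) = pushc n T c"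
  and nop_diff: "nop n c (C - D) = nop n c C - nop n c D"
  and nop_cmul: "nop n c (frag_cmul a C) = frag_cmul a (nop n c C)"
  and nop_sum: "nop n c (\<Sum>i\<in>I. f i) = (\<Sum>i\<in>I. nop n c (f i))"
  by (simp_all add: nop_def frag_extend_diff frag_extend_add frag_extend_cmul frag_extend_sum')

lemma nop_model_diff: "nop n (c - d) C = nop n c C - nop n d C"
  by (simp add: nop_def pushc_diff frag_extend_fun_diff)

lemma nop_model_0 [simp]: "nop n 0 C = 0"
  by (simp add: nop_def frag_extend_eq_0)

lemma nop_model_minus: "nop n (- c) C = - nop n c C"
  using nop_model_diff[of n 0 c C] by simp

lemma nop_model_add: "nop n (c + d) C = nop n c C + nop n d C"
  using nop_model_diff[of n c "- d" C] by (simp add: nop_model_minus)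

lemma sbd_nop: "sbd n (nop n c C) = nop (n - 1) (sbd n c) C"
  using chains_UNIV[of C]
  by (induction rule: chains_induct) (simp_all add: nop_diff sbd_diff nop_of sbd_pushc)

lemma nop_sbd:
  assumes c: "c \<in> chains (model_cubes n q)"
  shows "nop n c (sbd (Suc q) C) = nop n (cofaces n (Suc q) c) C"
  using chains_UNIV[of C]
proof (induction rule: chains_induct)
  case (one T)
  have *: "pushc n (cube_face (Suc q) i a T) c = pushc n (T \<circ> insert_coord i a) c" for i a
    by (rule pushc_cong[OF c]) (simp add: cube_face_app model_cubes_unit_cube)
  show ?case
    unfolding sbd_of nop_sum nop_cmul nop_diff nop_of cofaces_def pushc_sum pushc_cmul pushc_diff pushc_pushc * ..
qed (simp_all add: nop_diff sbd_diff)

lemma nop_pushc: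
  assumes c: "c \<in> chains (model_cubes n r)"
  shows "nop n c (pushc r f C) = pushc n f (nop n c C)"
  using chains_UNIV[of C]
proof (induction rule: chains_induct)
  case (one T)
  show ?case
    unfolding pushc_of nop_of pushc_pushc
    by (rule pushc_cong[OF c]) (simp add: push_def model_cubes_unit_cube)
qed (simp_all add: nop_diff pushc_diff)

lemma degenerate_spread:
  assumes "degenerate_cube r T" "m \<in> model_cubes n r"
  shows "degenerate_cube n (push n T m)"
proof -
  obtain i where i: "i < r" and T: "\<forall>s\<in>unit_cube r. \<forall>t\<in>unit_cube r. (\<forall>j. j \<noteq> i \<longrightarrow> s j = t j) \<longrightarrow> T s = T t"
    using assms(1) unfolding degenerate_cube_def by meson
  have "spread n r m" using assms(2) by (simp add: model_cubes_def)
  then obtain i' where i': "i' < n" and S: "\<forall>s\<in>unit_cube n. \<forall>t\<in>unit_cube n.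
          (\<forall>j. j \<noteq> i' \<longrightarrow> s j = t j) \<longrightarrow> (\<forall>j. j \<noteq> i \<longrightarrow> m s j = m t j)"
    using i unfolding spread_def by meson
  show ?thesis
  proof (rule degenerate_cubeI[OF i'])
    fix s t assume st: "s \<in> unit_cube n" "t \<in> unit_cube n" "\<And>j. j \<noteq> i' \<Longrightarrow> s j = t j"
    have "\<forall>j. j \<noteq> i \<longrightarrow> m s j = m t j"
      using S[THEN bspec, THEN bspec, OF st(1,2)] st(3) by simp
    then have "T (m s) = T (m t)"
      using T[THEN bspec, THEN bspec, OF model_cubes_unit_cube[OF assms(2) st(1)] model_cubes_unit_cube[OF assms(2) st(2)]]
      by simp
    then show "push n T m s = push n T m t"
      using st by (simp add: push_def)
  qed
qed

lemma singular_push_model: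
  "\<lbrakk>singular_cube r X T; m \<in> model_cubes n r\<rbrakk> \<Longrightarrow> singular_cube n X (push n T m)"
  unfolding model_cubes_def singular_cube_iff[of r X T] using singular_cube_push by blast

lemma nop_scubes:
  assumes "C \<in> chains (scubes r X)" "c \<in> chains (model_cubes n r)"
  shows "nop n c C \<in> chains (scubes n X)"
  unfolding nop_def pushc_def
  by (rule chains_extend[OF assms(1)], rule chains_extend[OF assms(2)])
    (simp add: scubes_def singular_push_model)

lemma nop_relc:
  assumes "C \<in> chains (relc r X A)" "c \<in> chains (model_cubes n r)"
  shows "nop n c C \<in> chains (relc n X A)"
  unfolding nop_def pushc_def
proof (rule chains_extend[OF assms(1)], rule chains_extend[OF assms(2)])
  fix T m assume T: "T \<in> relc r X A" and m: "m \<in> model_cubes n r"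
  have "push n T m ` unit_cube n \<subseteq> T ` unit_cube r"
    using model_cubes_unit_cube[OF m] by (auto simp: push_image)
  then show "frag_of (push n T m) \<in> chains (relc n X A)"
    using T singular_push_model[OF _ m, of X T] degenerate_spread[OF _ m, of T]
    unfolding relc_def chains_of mem_Collect_eq by (meson order_trans)
qed

lemma nop_relc_model:
  assumes "C \<in> chains (scubes r X)" "c \<in> chains (relc n (top_of_set (unit_cube r)) {})"
  shows "nop n c C \<in> chains (relc n X {})"
  unfolding nop_def
proof (rule chains_extend[OF assms(1)])
  fix T assume "T \<in> scubes r X"
  then show "pushc n T c \<in> chains (relc n X {})"
    by (intro pushc_relc[OF assms(2)]) (auto simp: scubes_def singular_cube_iff)
qed

definition subd :: "nat \<Rightarrow> 'x cube_chain \<Rightarrow> 'x cube_chain" where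
  "subd r = nop r (sdm r)"

definition subd_homotopy :: "nat \<Rightarrow> 'x cube_chain \<Rightarrow> 'x cube_chain" where
  "subd_homotopy r = nop (Suc r) (hdm r)"

lemma nop_idc:
  assumes "C \<in> chains (scubes r X)" shows "nop r (frag_of (idc r)) C = C"
  using assms
proof (induction rule: chains_induct)
  case (one T)
  then have "T \<in> extensional (unit_cube r)"
    by (simp add: scubes_def singular_cube_iff)
  then have "push r T (idc r) = T"
    by (auto simp: fun_eq_iff push_def idc_def restrict_def extensional_def)
  then show ?case by (simp add: nop_of)
qed (simp_all add: nop_diff)

lemma sbd_subd: "sbd r (subd r C) = subd (r - 1) (sbd r C)"
proof (cases r)
  case (Suc q)
  show ?thesis
    unfolding Suc subd_def sbd_nop diff_Suc_1 sbd_sd nop_sbd[OF sd_model] ..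
qed (simp add: subd_def)

text \<open>The boundary formula for the model homotopy, composed with every cube of the chain.\<close>

lemma subd_homotopic:
  assumes C: "C \<in> chains (scubes r X)"
  shows "sbd (Suc r) (subd_homotopy r C) + subd_homotopy (r - 1) (sbd r C) - (subd r C - C) \<in> chains (relc r X {})"
proof -
  obtain d where d: "d \<in> chains (relc r (top_of_set (unit_cube r)) {})"
    "sbd (Suc r) (hdm r) = - cofaces r r (hdm (r - 1)) + (sdm r - frag_of (idc r)) + d"
    using sbd_hd by blast
  have "subd_homotopy (r - 1) (sbd r C) = nop r (cofaces r r (hdm (r - 1))) C"
  proof (cases r)
    case (Suc q)
    show ?thesis unfolding Suc subd_homotopy_def diff_Suc_1 nop_sbd[OF hd_model] ..
  qed (simp add: subd_homotopy_def)
  moreover have "sbd (Suc r) (subd_homotopy r C) = - nop r (cofaces r r (hdm (r - 1))) C + (subd r C - C) + nop r d C"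
    unfolding subd_homotopy_def sbd_nop diff_Suc_1 d(2) nop_model_add nop_model_diff nop_model_minus nop_idc[OF C] subd_def ..
  ultimately have "sbd (Suc r) (subd_homotopy r C) + subd_homotopy (r - 1) (sbd r C) - (subd r C - C) = nop r d C"
    by simp
  then show ?thesis using nop_relc_model[OF C d(1)] by simp
qed

lemma subd_diff: "subd r (c - d) = subd r c - subd r d"
  by (simp add: subd_def nop_diff)

lemma subd_0 [simp]: "subd r 0 = 0"
  by (simp add: subd_def)

lemma subd_scubes: "c \<in> chains (scubes r X) \<Longrightarrow> subd r c \<in> chains (scubes r X)"
  unfolding subd_def by (rule nop_scubes[OF _ sd_model])

lemma subd_relc: "c \<in> chains (relc r X A) \<Longrightarrow> subd r c \<in> chains (relc r X A)"
  unfolding subd_def by (rule nop_relc[OF _ sd_model])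

lemma subd_pow_scubes: "c \<in> chains (scubes r X) \<Longrightarrow> (subd r ^^ N) c \<in> chains (scubes r X)"
  by (induction N) (auto intro: subd_scubes)

lemma subd_pow_relc: "c \<in> chains (relc r X A) \<Longrightarrow> (subd r ^^ N) c \<in> chains (relc r X A)"
  by (induction N) (auto intro: subd_relc)

lemma subd_pow_diff: "(subd r ^^ N) (c - d) = (subd r ^^ N) c - (subd r ^^ N) d"
  by (induction N) (auto simp: subd_diff)

lemma subd_pow_0 [simp]: "(subd r ^^ N) 0 = 0"
  by (induction N) auto

lemma sbd_subd_pow: "sbd r ((subd r ^^ N) c) = (subd (r - 1) ^^ N) (sbd r c)"
  by (induction N) (auto simp: sbd_subd)

lemma subd_pow_pushc: "(subd r ^^ N) (pushc r f c) = pushc r f ((subd r ^^ N) c)"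
  by (induction N) (auto simp: subd_def nop_pushc[OF sd_model])

text \<open>Each subdivision step changes the chain by a boundary, up to the homotopy applied to its boundary;
  the latter lies in \<open>A\<close> because natural operations keep chains in \<open>A\<close>.\<close>

lemma subd_pow_homologous:
  assumes c: "c \<in> chains (scubes r X)" and bd: "sbd r c \<in> chains (relc (r - 1) X A)"
  shows "\<exists>w \<in> chains (scubes (Suc r) X). (subd r ^^ N) c - c - sbd (Suc r) w \<in> chains (relc r X A)"
proof (induction N)
  case 0
  show ?case by (rule bexI[of _ 0]) auto
next
  case (Suc N)
  then obtain w where w: "w \<in> chains (scubes (Suc r) X)" "(subd r ^^ N) c - c - sbd (Suc r) w \<in> chains (relc r X A)"
    by blast
  let ?c = "(subd r ^^ N) c"
  have c': "?c \<in> chains (scubes r X)" using c by (rule subd_pow_scubes)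
  have "sbd r ?c \<in> chains (relc (r - 1) X A)"
    unfolding sbd_subd_pow using bd by (rule subd_pow_relc)
  then have H: "subd_homotopy (r - 1) (sbd r ?c) \<in> chains (relc r X A)"
  proof (cases r)
    case (Suc q)
    then show ?thesis
      using \<open>sbd r ?c \<in> _\<close> nop_relc[OF _ hd_model] by (simp add: subd_homotopy_def)
  qed (simp add: subd_homotopy_def)
  have D: "sbd (Suc r) (subd_homotopy r ?c) + subd_homotopy (r - 1) (sbd r ?c) - (subd r ?c - ?c) \<in> chains (relc r X A)"
    using subd_homotopic[OF c'] by (rule chains_mono) (simp add: relc_mono)
  have "w + subd_homotopy r ?c \<in> chains (scubes (Suc r) X)"
    unfolding subd_homotopy_def by (intro chains_add w nop_scubes[OF c' hd_model])
  moreover have eq: "(subd r ^^ Suc N) c - c - sbd (Suc r) (w + subd_homotopy r ?c)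
    = (?c - c - sbd (Suc r) w) + subd_homotopy (r - 1) (sbd r ?c)
      - (sbd (Suc r) (subd_homotopy r ?c) + subd_homotopy (r - 1) (sbd r ?c) - (subd r ?c - ?c))"
    by (simp add: sbd_add)
  have "(subd r ^^ Suc N) c - c - sbd (Suc r) (w + subd_homotopy r ?c) \<in> chains (relc r X A)"
    unfolding eq by (rule chains_diff[OF chains_add[OF w(2) H] D])
  ultimately show ?case by blast
qed

section \<open>Small chains\<close>

lemma compact_unit_cube: "compact (unit_cube r)"
proof -
  have "unit_cube r = PiE UNIV (\<lambda>i. if i < r then {0..1} else {0})"
  proof (rule subset_antisym; rule subsetI)
    fix t :: "nat \<Rightarrow> real" assume "t \<in> unit_cube r"
    then show "t \<in> PiE UNIV (\<lambda>i. if i < r then {0..1} else {0})"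
      by (simp add: PiE_iff unit_cube_def)
  next
    fix t :: "nat \<Rightarrow> real" assume "t \<in> PiE UNIV (\<lambda>i. if i < r then {0..1} else {0})"
    then have t: "t i \<in> (if i < r then {0..1} else {0})" for i
      by (simp add: PiE_iff)
    show "t \<in> unit_cube r"
      unfolding unit_cube_def
    proof (intro CollectI conjI allI impI)
      fix i assume "i < r"
      then show "0 \<le> t i" "t i \<le> 1" using t[of i] by auto
    next
      fix i assume "r \<le> i"
      then show "t i = 0" using t[of i] by auto
    qed
  qed
  moreover have "compactin (product_topology (\<lambda>i. euclidean) UNIV) (PiE UNIV (\<lambda>i. if i < r then {0..1::real} else {0}))"
    by (simp add: compactin_PiE)
  ultimately show ?thesis
    by (simp add: euclidean_product_topology)
qed

text \<open>The metric on sequences is a weighted sum of coordinate distances; a bound that is uniform over the coordinates is inherited up to a factor.\<close>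

lemma dist_fun_small:
  fixes x y :: "nat \<Rightarrow> real"
  assumes "\<And>j. \<bar>x j - y j\<bar> \<le> (1/2) ^ N" shows "dist x y \<le> 3 * (1/2) ^ N"
proof -
  have "Max {dist (x (from_nat n)) (y (from_nat n)) |n. n \<le> N} \<le> (1/2) ^ N"
  proof (rule Max.boundedI)
    show "finite {dist (x (from_nat n)) (y (from_nat n)) |n. n \<le> N}"
      using finite_image_set[of "\<lambda>n. n \<le> N"] by simp
    show "{dist (x (from_nat n)) (y (from_nat n)) |n. n \<le> N} \<noteq> {}"
      by blast
    fix a assume "a \<in> {dist (x (from_nat n)) (y (from_nat n)) |n. n \<le> N}"
    then obtain n :: nat where "a = dist (x (from_nat n)) (y (from_nat n))" by blast
    then show "a \<le> (1/2) ^ N" using assms by (simp add: dist_real_def)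
  qed
  then show ?thesis
    using dist_fun_le_dist_first_terms[of x y N] by simp
qed

lemma cube_lebesgue:
  assumes T: "singular_cube r X T" and op: "\<And>U. U \<in> \<U> \<Longrightarrow> openin X U" and cov: "topspace X \<subseteq> \<Union>\<U>"
  obtains N where "\<And>S. \<lbrakk>S \<subseteq> unit_cube r; \<And>s t j. \<lbrakk>s \<in> S; t \<in> S\<rbrakk> \<Longrightarrow> \<bar>s j - t j\<bar> \<le> (1/2) ^ N\<rbrakk> \<Longrightarrow> \<exists>U\<in>\<U>. T ` S \<subseteq> U"
proof -
  define \<C> where "\<C> = {V. open V \<and> (\<exists>U\<in>\<U>. T ` (unit_cube r \<inter> V) \<subseteq> U)}"
  have cov': "\<exists>V\<in>\<C>. t \<in> V" if t: "t \<in> unit_cube r" for t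
  proof -
    obtain U where U: "U \<in> \<U>" "T t \<in> U"
      using cov singular_cube_in_topspace[OF T t] by blast
    have "continuous_map (top_of_set (unit_cube r)) X T"
      using T by (simp add: singular_cube_iff)
    from openin_continuous_map_preimage[OF this op[OF U(1)]]
    have "openin (top_of_set (unit_cube r)) {t \<in> unit_cube r. T t \<in> U}"
      by simp
    then obtain V where V: "open V" "{t \<in> unit_cube r. T t \<in> U} = unit_cube r \<inter> V"
      unfolding openin_open by blast
    then have "T ` (unit_cube r \<inter> V) \<subseteq> U" by blast
    then have "V \<in> \<C>" using U(1) V(1) by (auto simp: \<C>_def)
    moreover have "t \<in> V" using V(2) U(2) t by blast
    ultimately show ?thesis by blast
  qed
  have ne: "\<C> \<noteq> {}" using cov'[OF unit_cube_nonempty] by blast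
  have sub: "unit_cube r \<subseteq> \<Union>\<C>" using cov' by blast
  have op': "open B" if "B \<in> \<C>" for B using that by (simp add: \<C>_def)
  obtain \<delta> where d: "0 < \<delta>" "\<And>S. \<lbrakk>S \<subseteq> unit_cube r; diameter S < \<delta>\<rbrakk> \<Longrightarrow> \<exists>B\<in>\<C>. S \<subseteq> B"
  proof (rule Lebesgue_number_lemma[OF compact_unit_cube ne sub])
    fix \<delta>' assume a: "0 < \<delta>'" and b: "\<And>S. \<lbrakk>S \<subseteq> unit_cube r; diameter S < \<delta>'\<rbrakk> \<Longrightarrow> \<exists>B\<in>\<C>. S \<subseteq> B"
    show thesis by (rule that[OF a b])
  qed (rule op')
  obtain N where N: "(1/2) ^ N < \<delta> / 6"
    by (rule exE[OF real_arch_pow_inv[of "\<delta> / 6" "1/2"]]) (use d(1) in simp_all)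
  show ?thesis
  proof (rule that[of N])
    fix S assume S: "S \<subseteq> unit_cube r" "\<And>s t j. \<lbrakk>s \<in> S; t \<in> S\<rbrakk> \<Longrightarrow> \<bar>s j - t j\<bar> \<le> (1/2) ^ N"
    have "diameter S \<le> \<delta> / 2"
    proof (cases "S = {}")
      case False
      then have "(SUP (x, y)\<in>S \<times> S. dist x y) \<le> \<delta> / 2"
      proof (intro cSUP_least)
        fix p assume "p \<in> S \<times> S"
        then have "dist (fst p) (snd p) \<le> 3 * (1/2) ^ N"
          by (intro dist_fun_small S(2)) auto
        then show "(case p of (x, y) \<Rightarrow> dist x y) \<le> \<delta> / 2"
          using N by (simp add: case_prod_unfold)
      qed auto
      then show ?thesis using False by (simp add: diameter_def)
    qed (use d(1) in \<open>simp add: diameter_def\<close>)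
    then have "diameter S < \<delta>" using d(1) by linarith
    then obtain B where B: "B \<in> \<C>" "S \<subseteq> B"
      using d(2)[OF S(1)] by blast
    then obtain U where "U \<in> \<U>" "T ` (unit_cube r \<inter> B) \<subseteq> U"
      unfolding \<C>_def by blast
    then show "\<exists>U\<in>\<U>. T ` S \<subseteq> U"
      using B(2) S(1) by blast
  qed
qed

text \<open>The estimate is imposed on each coordinate separately, which is what products preserve and what
  \<open>cube_lebesgue\<close> asks for.\<close>

definition contracting :: "nat \<Rightarrow> nat \<Rightarrow> ((nat \<Rightarrow> real) \<Rightarrow> nat \<Rightarrow> real) set" where
  "contracting N r = {m. m ` unit_cube r \<subseteq> unit_cube r \<and>
     (\<forall>s\<in>unit_cube r. \<forall>t\<in>unit_cube r. \<forall>j. \<bar>m s j - m t j\<bar> \<le> (1/2) ^ N * \<bar>s j - t j\<bar>)}"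

lemma contracting_unit_cube: "\<lbrakk>m \<in> contracting N r; t \<in> unit_cube r\<rbrakk> \<Longrightarrow> m t \<in> unit_cube r"
  by (auto simp: contracting_def)

lemma contracting_le:
  "\<lbrakk>m \<in> contracting N r; s \<in> unit_cube r; t \<in> unit_cube r\<rbrakk> \<Longrightarrow> \<bar>m s j - m t j\<bar> \<le> (1/2) ^ N * \<bar>s j - t j\<bar>"
  by (simp add: contracting_def)

lemma prism_contracting:
  assumes m: "m \<in> contracting 1 r" and a: "\<And>u v. \<bar>a u - a v\<bar> \<le> (1/2) * \<bar>u - v\<bar>" "a ` {0..1} \<subseteq> {0..1}"
  shows "prism r (\<lambda>x u. x(r := a u)) m \<in> contracting 1 (Suc r)"
proof -
  have P: "prism r (\<lambda>x u. x(r := a u)) m t = (m (t(r := 0)))(r := a (t r))" if "t \<in> unit_cube (Suc r)" for t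
    using that by (simp add: prism_def)
  have "(m (t(r := 0)))(r := a (t r)) \<in> unit_cube (Suc r)" if t: "t \<in> unit_cube (Suc r)" for t
  proof (rule upd_unit_cube(2))
    show "m (t(r := 0)) \<in> unit_cube r" using m upd_unit_cube(1)[OF t] by (auto simp: contracting_def)
    have "t r \<in> {0..1}" using unit_cube_coord[OF t] by simp
    then have "a (t r) \<in> {0..1}" using a(2) by blast
    then show "0 \<le> a (t r)" "a (t r) \<le> 1" by auto
  qed
  moreover have "\<bar>((m (s(r := 0)))(r := a (s r))) j - ((m (t(r := 0)))(r := a (t r))) j\<bar> \<le> (1/2) ^ 1 * \<bar>s j - t j\<bar>"
    if "s \<in> unit_cube (Suc r)" "t \<in> unit_cube (Suc r)" for s t j
  proof (cases "j = r")
    case False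
    have "\<forall>j. \<bar>m (s(r := 0)) j - m (t(r := 0)) j\<bar> \<le> (1/2) ^ 1 * \<bar>(s(r := 0)) j - (t(r := 0)) j\<bar>"
      using m upd_unit_cube(1)[OF that(1)] upd_unit_cube(1)[OF that(2)] unfolding contracting_def by blast
    from spec[OF this, of j] show ?thesis using False by simp
  qed (use a(1) in simp)
  ultimately show ?thesis
    unfolding contracting_def by (auto simp: P)
qed

lemma sdm_contracting: "sdm r \<in> chains (contracting 1 r)"
proof (induction r)
  case 0
  show ?case by (auto simp: contracting_def idc_def unit_cube_beyond)
next
  case (Suc r)
  have half: "\<bar>u / 2 - v / 2\<bar> \<le> (1/2) * \<bar>u - v\<bar>" "\<bar>(1 + u) / 2 - (1 + v) / 2\<bar> \<le> (1/2) * \<bar>u - v\<bar>" for u v :: real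
    by (auto simp: abs_if field_simps)
  have lo: "frag_of (prism r (\<lambda>x u. x(r := u / 2)) m) \<in> chains (contracting 1 (Suc r))" if "m \<in> contracting 1 r" for m
    unfolding chains_of by (rule prism_contracting[OF that half(1)]) auto
  have hi: "frag_of (prism r (\<lambda>x u. x(r := (1 + u) / 2)) m) \<in> chains (contracting 1 (Suc r))" if "m \<in> contracting 1 r" for m
    unfolding chains_of by (rule prism_contracting[OF that half(2)]) auto
  show ?case
    unfolding sdm.simps halves_def prismc_def
    by (intro chains_add chains_extend[OF Suc.IH]) (erule lo, erule hi)
qed

lemma subd_pow_contracting:
  assumes T: "singular_cube r X T"
  shows "(subd r ^^ N) (frag_of T) \<in> chains (push r T ` contracting N r)"
proof (induction N)
  case 0
  have "T = push r T (\<lambda>t. t)"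
    using T by (auto simp: fun_eq_iff push_def singular_cube_iff restrict_def extensional_def)
  moreover have "(\<lambda>t. t) \<in> contracting 0 r"
    by (simp add: contracting_def)
  ultimately have "T \<in> push r T ` contracting 0 r" by blast
  then show ?case by simp
next
  case (Suc N)
  have "subd r C \<in> chains (push r T ` contracting (Suc N) r)" if C: "C \<in> chains (push r T ` contracting N r)" for C
    unfolding subd_def nop_def pushc_def
  proof (rule chains_extend[OF C], rule chains_extend[OF sdm_contracting])
    fix P m assume "P \<in> push r T ` contracting N r" and m: "m \<in> contracting 1 r"
    then obtain m' where m': "m' \<in> contracting N r" "P = push r T m'" by blast
    have im: "m t \<in> unit_cube r" if "t \<in> unit_cube r" for t
      by (rule contracting_unit_cube[OF m that])
    have "push r P m = push r T (m' \<circ> m)"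
      unfolding m'(2) by (auto simp: push_def restrict_def fun_eq_iff im)
    moreover have "m' \<circ> m \<in> contracting (Suc N) r"
      unfolding contracting_def mem_Collect_eq
    proof (intro conjI ballI allI)
      show "(m' \<circ> m) ` unit_cube r \<subseteq> unit_cube r"
        using contracting_unit_cube[OF m'(1)] im by auto
      fix s t j assume st: "s \<in> unit_cube r" "t \<in> unit_cube r"
      have "\<bar>m' (m s) j - m' (m t) j\<bar> \<le> (1/2) ^ N * \<bar>m s j - m t j\<bar>"
        by (rule contracting_le[OF m'(1) im[OF st(1)] im[OF st(2)]])
      also have "\<dots> \<le> (1/2) ^ N * ((1/2) ^ 1 * \<bar>s j - t j\<bar>)"
        by (rule mult_left_mono[OF contracting_le[OF m st]]) simp
      finally show "\<bar>(m' \<circ> m) s j - (m' \<circ> m) t j\<bar> \<le> (1/2) ^ Suc N * \<bar>s j - t j\<bar>"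
        by simp
    qed
    ultimately have "push r P m \<in> push r T ` contracting (Suc N) r" by blast
    then show "frag_of (push r P m) \<in> chains (push r T ` contracting (Suc N) r)" by simp
  qed
  from this[OF Suc.IH] show ?case by simp
qed

definition small_cubes :: "nat \<Rightarrow> 'x set set \<Rightarrow> ((nat \<Rightarrow> real) \<Rightarrow> 'x) set" where
  "small_cubes r \<U> = {T. \<exists>U\<in>\<U>. T ` unit_cube r \<subseteq> U}"

lemma contracting_mono: "N \<le> M \<Longrightarrow> contracting M r \<subseteq> contracting N r"
proof
  fix m assume le: "N \<le> M" and m: "m \<in> contracting M r"
  have "(1/2) ^ M * \<bar>x\<bar> \<le> (1/2) ^ N * \<bar>x\<bar>" for x :: real
    using le by (intro mult_right_mono power_decreasing) auto
  then show "m \<in> contracting N r"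
    using m unfolding contracting_def by (blast intro: order_trans)
qed

text \<open>The conclusion holds for all large \<open>M\<close> and not just for one, so that it passes to differences of
  chains.\<close>

lemma subd_pow_small:
  assumes c: "c \<in> chains (scubes r X)" and op: "\<And>U. U \<in> \<U> \<Longrightarrow> openin X U" and cov: "topspace X \<subseteq> \<Union>\<U>"
  shows "\<exists>N. \<forall>M\<ge>N. (subd r ^^ M) c \<in> chains (small_cubes r \<U>)"
  using c
proof (induction rule: chains_induct)
  case (one T)
  then have T: "singular_cube r X T" by (simp add: scubes_def)
  obtain N where N: "\<And>S. \<lbrakk>S \<subseteq> unit_cube r; \<And>s t j. \<lbrakk>s \<in> S; t \<in> S\<rbrakk> \<Longrightarrow> \<bar>s j - t j\<bar> \<le> (1/2) ^ N\<rbrakk> \<Longrightarrow> \<exists>U\<in>\<U>. T ` S \<subseteq> U"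
    by (rule cube_lebesgue[OF T op cov]) blast+
  have "push r T m \<in> small_cubes r \<U>" if m: "m \<in> contracting N r" for m
  proof -
    have "\<bar>s j - t j\<bar> \<le> (1/2) ^ N" if st: "s \<in> m ` unit_cube r" "t \<in> m ` unit_cube r" for s t j
    proof -
      obtain a b where ab: "a \<in> unit_cube r" "b \<in> unit_cube r" "s = m a" "t = m b"
        using st by blast
      have "\<bar>m a j - m b j\<bar> \<le> (1/2) ^ N * \<bar>a j - b j\<bar>"
        by (rule contracting_le[OF m ab(1,2)])
      also have "\<dots> \<le> (1/2) ^ N * 1"
        using unit_cube_coord[OF ab(1), of j] unit_cube_coord[OF ab(2), of j] by (intro mult_left_mono) auto
      finally show ?thesis using ab by simp
    qed
    moreover have "m ` unit_cube r \<subseteq> unit_cube r"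
      using m by (simp add: contracting_def)
    ultimately show ?thesis
      using N[of "m ` unit_cube r"] unfolding small_cubes_def by (simp add: push_image)
  qed
  then have sub: "push r T ` contracting M r \<subseteq> small_cubes r \<U>" if "N \<le> M" for M
    using contracting_mono[OF that, of r] by blast
  show ?case
    by (intro exI allI impI, rule chains_mono[OF subd_pow_contracting[OF T]], erule sub)
next
  case (diff a b)
  then obtain N1 N2 where "\<forall>M\<ge>N1. (subd r ^^ M) a \<in> chains (small_cubes r \<U>)" "\<forall>M\<ge>N2. (subd r ^^ M) b \<in> chains (small_cubes r \<U>)"
    by blast
  then have "\<forall>M\<ge>max N1 N2. (subd r ^^ M) (a - b) \<in> chains (small_cubes r \<U>)"
    by (simp add: subd_pow_diff chains_diff)
  then show ?case by blast
qed auto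

section \<open>Chains on a cylinder relative to its two ends\<close>

lemma pushc_prismc: "pushc (Suc r) f (prismc r H c) = prismc r (\<lambda>x u. f (H x u)) c"
proof -
  have "push (Suc r) f (prism r H T) = prism r (\<lambda>x u. f (H x u)) T" for T
    by (auto simp: push_def prism_def restrict_def fun_eq_iff)
  then show ?thesis by (simp add: pushc_def prismc_def frag_extend_extend)
qed

lemma pushc_id:
  assumes "c \<in> chains (scubes r X)" "\<And>x. x \<in> topspace X \<Longrightarrow> f x = x"
  shows "pushc r f c = c"
  using assms(1)
proof (induction rule: chains_induct)
  case (one T)
  then have T: "singular_cube r X T" by (simp add: scubes_def)
  then have "T \<in> extensional (unit_cube r)" by (simp add: singular_cube_iff)
  then have "push r f T = T"
    using singular_cube_in_topspace[OF T] assms(2)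
    by (auto simp: fun_eq_iff push_def restrict_def extensional_def)
  then show ?case by simp
qed (simp_all add: pushc_diff)

lemma prismc_cong:
  assumes "c \<in> chains (scubes r X)" "\<And>x u. \<lbrakk>x \<in> topspace X; u \<in> {0..1}\<rbrakk> \<Longrightarrow> H x u = H' x u"
  shows "prismc r H c = prismc r H' c"
proof -
  have "prism r H T = prism r H' T" if T: "T \<in> scubes r X" for T
  proof (rule ext)
    fix t
    have T': "singular_cube r X T" using T by (simp add: scubes_def)
    show "prism r H T t = prism r H' T t"
      using singular_cube_in_topspace[OF T' upd_unit_cube(1)] unit_cube_coord[of t "Suc r" r] assms(2)
      by (simp add: prism_def restrict_def)
  qed
  then show ?thesis
    unfolding prismc_def by (intro frag_extend_eq_on[OF assms(1)]) simp
qed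

lemma connected_unit_cube: "connected (unit_cube r)"
proof -
  have eq: "unit_cube r = (\<lambda>t i. if i < r then t i else 0) ` (PiE UNIV (\<lambda>i. {0..1}))"
  proof (rule subset_antisym; rule subsetI)
    fix t :: "nat \<Rightarrow> real" assume t: "t \<in> unit_cube r"
    show "t \<in> (\<lambda>t i. if i < r then t i else 0) ` (PiE UNIV (\<lambda>i. {0..1}))"
    proof (rule image_eqI[of _ _ t])
      show "t = (\<lambda>i. if i < r then t i else 0)"
        using unit_cube_beyond[OF t] by (auto simp: fun_eq_iff)
    qed (use unit_cube_coord[OF t] in \<open>simp add: PiE_iff\<close>)
  next
    fix t :: "nat \<Rightarrow> real" assume "t \<in> (\<lambda>t i. if i < r then t i else 0) ` (PiE UNIV (\<lambda>i. {0..1}))"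
    then show "t \<in> unit_cube r" by (auto simp: unit_cube_def PiE_iff)
  qed
  have conn: "connected (PiE UNIV (\<lambda>i. {0..1::real}) :: (nat \<Rightarrow> real) set)"
    using connectedin_PiE[of "\<lambda>i::nat. euclideanreal" UNIV "\<lambda>i. {0..1}"]
    by (simp add: euclidean_product_topology)
  have cont: "continuous_on S (\<lambda>t i. if i < r then t i else 0)" for S :: "(nat \<Rightarrow> real) set"
  proof (rule continuous_on_coordinatewise_then_product)
    fix i show "continuous_on S (\<lambda>x. if i < r then x i else 0)"
      by (cases "i < r") (auto intro: continuous_on_coord)
  qed
  show ?thesis
    unfolding eq by (rule connected_continuous_image[OF cont conn])
qed

text \<open>The homology of the cylinder over \<open>Y\<close> relative to its two ends is that of \<open>Y\<close> with degrees
  raised by one. The proof uses just the contraction to the bottom and the top end of the boundary.\<close>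

definition cyl :: "'y topology \<Rightarrow> ('y \<times> real) topology" where
  "cyl Y = prod_topology Y (top_of_set {0..1})"

definition cyl_ends :: "'y topology \<Rightarrow> ('y \<times> real) set" where
  "cyl_ends Y = topspace Y \<times> {0, 1}"

lemma cyl_fst: "continuous_map (cyl Y) Y fst"
  unfolding cyl_def by (rule continuous_map_fst)

lemma cyl_pair: "continuous_map (prod_topology Y (top_of_set {0..1})) (cyl Y) (\<lambda>(y, u). (y, u))"
  by (simp add: cyl_def case_prod_unfold)

lemma cyl_incl: "a \<in> {0..1} \<Longrightarrow> continuous_map Y (cyl Y) (\<lambda>y. (y, a))"
  unfolding cyl_def continuous_map_paired by simp

lemma cyl_map_snd:
  assumes "continuous_on {0..1} f" "f ` {0..1} \<subseteq> {0..1}"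
  shows "continuous_map (cyl Y) (cyl Y) (\<lambda>(y, u). (y, f u))"
proof -
  have "continuous_map (top_of_set {0..1}) (top_of_set {0..1}) f"
    using assms by auto
  then have "continuous_map (cyl Y) (top_of_set {0..1}) (f \<circ> snd)"
    unfolding cyl_def using continuous_map_compose[OF continuous_map_snd] by blast
  then show ?thesis
    using cyl_fst[of Y] unfolding cyl_def case_prod_unfold
    by (simp add: continuous_map_paired o_def)
qed

lemma cyl_contract: "continuous_map (prod_topology (cyl Y) (top_of_set {0..1})) (cyl Y) (\<lambda>(x, u). (fst x, u * snd x))"
proof -
  let ?P = "prod_topology (cyl Y) (top_of_set {0..1::real})"
  have 1: "continuous_map ?P Y (\<lambda>p. fst (fst p))"
    using continuous_map_compose[OF continuous_map_fst cyl_fst] by (simp add: o_def)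
  have 2: "continuous_map ?P (top_of_set {0..1::real}) (\<lambda>p. snd (fst p))"
    using continuous_map_compose[OF continuous_map_fst[of "cyl Y"] continuous_map_snd[of Y "top_of_set {0..1::real}", folded cyl_def]]
    by (simp add: o_def)
  have 3: "continuous_map ?P (top_of_set {0..1::real}) snd"
    by (rule continuous_map_snd)
  have "continuous_map ?P euclideanreal (\<lambda>p. snd p * snd (fst p))"
    using 2 3 by (intro continuous_map_real_mult) (auto simp: continuous_map_in_subtopology)
  moreover have "snd p * snd (fst p) \<in> {0..1}" if "p \<in> topspace ?P" for p
    using that by (auto simp: cyl_def mult_le_one)
  ultimately have "continuous_map ?P (top_of_set {0..1}) (\<lambda>p. snd p * snd (fst p))"
    by (intro continuous_map_into_subtopology Pi_I)
  with 1 show ?thesis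
    by (simp add: cyl_def continuous_map_paired case_prod_unfold)
qed

definition end_cubes :: "nat \<Rightarrow> 'y topology \<Rightarrow> real \<Rightarrow> ((nat \<Rightarrow> real) \<Rightarrow> 'y \<times> real) set" where
  "end_cubes r Y a = scubes r (subtopology (cyl Y) (topspace Y \<times> {a}))"

lemma end_cubes_iff: "T \<in> end_cubes r Y a \<longleftrightarrow> singular_cube r (cyl Y) T \<and> T ` unit_cube r \<subseteq> topspace Y \<times> {a}"
  by (simp add: end_cubes_def scubes_def singular_cube_subtopology)

text \<open>The two ends are disjoint and a cube is connected, so a cube in their union lies in one of them.\<close>

lemma relc_cyl_ends: "relc r (cyl Y) (cyl_ends Y) \<subseteq> relc r (cyl Y) (topspace Y \<times> {0}) \<union> end_cubes r Y 1"
proof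
  fix T assume T: "T \<in> relc r (cyl Y) (cyl_ends Y)"
  show "T \<in> relc r (cyl Y) (topspace Y \<times> {0}) \<union> end_cubes r Y 1"
  proof (cases "degenerate_cube r T")
    case False
    then have sing: "singular_cube r (cyl Y) T" and im: "T ` unit_cube r \<subseteq> cyl_ends Y"
      using T by (auto simp: relc_def)
    have "continuous_map (top_of_set (unit_cube r)) (cyl Y) T"
      using sing by (simp add: singular_cube_iff)
    then have "continuous_map (top_of_set (unit_cube r)) (top_of_set {0..1::real}) (snd \<circ> T)"
      unfolding cyl_def by (rule continuous_map_compose[OF _ continuous_map_snd])
    then have "continuous_on (unit_cube r) (snd \<circ> T)"
      by simp
    then have conn: "connected ((snd \<circ> T) ` unit_cube r)"
      by (rule connected_continuous_image[OF _ connected_unit_cube])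
    have sub: "(snd \<circ> T) ` unit_cube r \<subseteq> {0, 1}"
      using im by (auto simp: cyl_ends_def)
    then have fin: "finite ((snd \<circ> T) ` unit_cube r)"
      by (rule finite_subset) simp
    have "(snd \<circ> T) ` unit_cube r = {} \<or> (\<exists>x. (snd \<circ> T) ` unit_cube r = {x})"
      using connected_finite_iff_sing[OF conn] fin by blast
    then obtain a where a: "(snd \<circ> T) ` unit_cube r = {a}"
      using unit_cube_nonempty[of r] by blast
    have "a = 0 \<or> a = 1"
      using sub unfolding a by simp
    moreover have "T ` unit_cube r \<subseteq> topspace Y \<times> {a}"
    proof
      fix x assume "x \<in> T ` unit_cube r"
      then obtain t where "t \<in> unit_cube r" "x = T t" by blast
      moreover have "T t \<in> cyl_ends Y" "snd (T t) = a"
        using im a \<open>t \<in> unit_cube r\<close> by auto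
      ultimately show "x \<in> topspace Y \<times> {a}"
        by (auto simp: cyl_ends_def)
    qed
    ultimately show ?thesis
      using sing by (auto simp: relc_def end_cubes_iff)
  qed (use T in \<open>auto simp: relc_def\<close>)
qed

text \<open>No cube lies in both ends; only degenerate cubes can be listed for the bottom while living in the
  top.\<close>

lemma end_cubes_Int: "relc r (cyl Y) (topspace Y \<times> {0}) \<inter> end_cubes r Y 1 \<subseteq> relc r (cyl Y) {}"
proof
  fix T assume T: "T \<in> relc r (cyl Y) (topspace Y \<times> {0}) \<inter> end_cubes r Y 1"
  then have "T (\<lambda>_. 0) \<in> topspace Y \<times> {1}"
    using unit_cube_nonempty[of r] by (auto simp: end_cubes_iff)
  moreover have "T (\<lambda>_. 0) \<in> topspace Y \<times> {0}" if "\<not> degenerate_cube r T"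
    using T unit_cube_nonempty[of r] that by (auto simp: relc_def)
  ultimately show "T \<in> relc r (cyl Y) {}"
    using T by (cases "degenerate_cube r T") (auto simp: relc_def)
qed

lemma sbd_end_cubes: "c \<in> chains (end_cubes r Y a) \<Longrightarrow> sbd r c \<in> chains (end_cubes (r - 1) Y a)"
  unfolding end_cubes_def by (rule sbd_scubes)

lemma cyl_end_split:
  assumes "c \<in> chains (relc r (cyl Y) (cyl_ends Y))"
  obtains z0 z1 where "z0 \<in> chains (relc r (cyl Y) (topspace Y \<times> {0}))" "z1 \<in> chains (end_cubes r Y 1)" "c = z0 + z1"
  using chains_split[OF chains_mono[OF assms relc_cyl_ends]] by metis

lemma sbd_cyl_contract:
  assumes c: "c \<in> chains (scubes r (cyl Y))"
  shows "sbd (Suc r) (prismc r (\<lambda>x u. (fst x, u * snd x)) c)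
     = prismc (r - 1) (\<lambda>x u. (fst x, u * snd x)) (sbd r c) + frag_cmul ((-1) ^ Suc r) (pushc r (\<lambda>x. (fst x, 0)) c - c)"
proof -
  have "pushc r (\<lambda>x. (fst x, 1 * snd x)) c = c"
    by (rule pushc_id[OF c]) simp
  then show ?thesis unfolding sbd_prismc by simp
qed

lemma pushc_bottom: "c \<in> chains (scubes r (cyl Y)) \<Longrightarrow> pushc r (\<lambda>x. (fst x, 0)) c \<in> chains (relc r (cyl Y) (topspace Y \<times> {0}))"
proof -
  assume c: "c \<in> chains (scubes r (cyl Y))"
  have "continuous_map (cyl Y) (cyl Y) ((\<lambda>y. (y, 0)) \<circ> fst)"
    by (rule continuous_map_compose[OF cyl_fst cyl_incl]) simp
  then have cont: "continuous_map (cyl Y) (cyl Y) (\<lambda>x. (fst x, 0))"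
    by (simp add: o_def)
  have "c \<in> chains (relc r (cyl Y) (topspace (cyl Y)))"
    using c by (rule chains_mono) (use singular_cube_in_topspace in \<open>fastforce simp: relc_def scubes_def\<close>)
  then show ?thesis
    by (rule pushc_relc[OF _ cont]) (auto simp: cyl_def)
qed

lemma cyl_bottom_sub: "relc r (cyl Y) (topspace Y \<times> {0}) \<subseteq> relc r (cyl Y) (cyl_ends Y)"
  by (rule relc_mono) (auto simp: cyl_ends_def)

lemma cyl_surj_0:
  assumes c: "c \<in> chains (scubes 0 (cyl Y))"
  shows "\<exists>b \<in> chains (scubes 1 (cyl Y)). c - sbd 1 b \<in> chains (relc 0 (cyl Y) (cyl_ends Y))"
proof (rule bexI)
  let ?b = "prismc 0 (\<lambda>x u. (fst x, u * snd x)) c"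
  have "c - sbd 1 ?b = pushc 0 (\<lambda>x. (fst x, 0)) c"
    using sbd_cyl_contract[OF c] by simp
  then show "c - sbd 1 ?b \<in> chains (relc 0 (cyl Y) (cyl_ends Y))"
    using chains_mono[OF pushc_bottom[OF c] cyl_bottom_sub] by simp
  show "?b \<in> chains (scubes 1 (cyl Y))"
    using prismc_scubes[OF c cyl_contract] by simp
qed

lemma fst_end_cubes: "z \<in> chains (end_cubes r Y a) \<Longrightarrow> pushc r fst z \<in> chains (scubes r Y)"
  by (rule pushc_scubes[OF _ cyl_fst]) (erule chains_mono, auto simp: end_cubes_iff scubes_def)

text \<open>Contract \<open>c\<close> to the bottom. The contraction has the boundary \<open>c\<close>, up to a chain in the bottom and
  to the trace of the contraction on the boundary of \<open>c\<close>. On the bottom part \<open>z0\<close> of this boundary the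
  trace stays in the bottom, and on the top part \<open>z1\<close> it is \<open>z1 \<times> [0,1]\<close>; so \<open>s\<close> is \<open>z1\<close> up to sign. Its
  boundary lies both in the top and in the bottom, hence is degenerate.\<close>

lemma cyl_surj:
  assumes c: "c \<in> chains (scubes (Suc q) (cyl Y))" and bd: "sbd (Suc q) c \<in> chains (relc q (cyl Y) (cyl_ends Y))"
  shows "\<exists>s \<in> chains (scubes q Y). sbd q s \<in> chains (relc (q - 1) Y {}) \<and>
    (\<exists>b \<in> chains (scubes (Suc (Suc q)) (cyl Y)).
       c - prismc q Pair s - sbd (Suc (Suc q)) b \<in> chains (relc (Suc q) (cyl Y) (cyl_ends Y)))"
proof -
  let ?H = "\<lambda>x u. (fst x, u * snd x)" and ?s = "(-1) ^ q :: int"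
  obtain z0 z1 where z: "z0 \<in> chains (relc q (cyl Y) (topspace Y \<times> {0}))" "z1 \<in> chains (end_cubes q Y 1)"
    "sbd (Suc q) c = z0 + z1"
    using cyl_end_split[OF bd] by blast
  have ss: "?s * ?s = 1" by (simp flip: power_add)
  have z1Y: "pushc q fst z1 \<in> chains (scubes q Y)"
    using z(2) by (rule fst_end_cubes)
  define s where "s = frag_cmul ?s (pushc q fst z1)"
  define b where "b = frag_cmul (- ?s) (prismc (Suc q) ?H c)"
  have "sbd q z1 = - sbd q z0"
    using sbd_sbd[of q c] unfolding z(3) sbd_add by (simp add: add_eq_0_iff2)
  then have "sbd q z1 \<in> chains (relc (q - 1) (cyl Y) (topspace Y \<times> {0}))"
    using sbd_relc[OF z(1)] by simp
  then have "sbd q z1 \<in> chains (relc (q - 1) (cyl Y) {})"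
    using chains_mono[OF chains_Int[OF _ sbd_end_cubes[OF z(2)]] end_cubes_Int] by blast
  then have s1: "sbd q s \<in> chains (relc (q - 1) Y {})"
    unfolding s_def sbd_cmul sbd_pushc by (intro chains_cmul pushc_relc[OF _ cyl_fst]) auto
  have H1: "prismc q ?H z1 = prismc q Pair (pushc q fst z1)"
  proof -
    have "prismc q ?H z1 = prismc q (\<lambda>x u. (fst x, u)) z1"
      by (rule prismc_cong[OF z(2)[unfolded end_cubes_def]]) auto
    also have "\<dots> = prismc q Pair (pushc q fst z1)"
    proof -
      have "prism q (\<lambda>x u. (fst x, u)) T = prism q Pair (push q fst T)" for T :: "(nat \<Rightarrow> real) \<Rightarrow> 'a \<times> real"
        by (auto simp: fun_eq_iff prism_def push_def restrict_def upd_unit_cube)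
      then show ?thesis by (simp add: prismc_def pushc_def frag_extend_extend)
    qed
    finally show ?thesis .
  qed
  have "sbd (Suc (Suc q)) (prismc (Suc q) ?H c) = prismc q ?H z0 + prismc q Pair (pushc q fst z1)
      + frag_cmul ?s (pushc (Suc q) (\<lambda>x. (fst x, 0)) c - c)"
    unfolding sbd_cyl_contract[OF c] diff_Suc_1 z(3) prismc_add H1 by simp
  then have "sbd (Suc (Suc q)) b = - frag_cmul ?s (prismc q ?H z0) - prismc q Pair s - pushc (Suc q) (\<lambda>x. (fst x, 0)) c + c"
    unfolding b_def s_def sbd_cmul prismc_cmul
    by (intro poly_mapping_eqI) (simp add: lookup_add lookup_minus distrib_left right_diff_distrib mult.assoc[symmetric] ss
       del: lookup_frag_of)
  then have "c - prismc q Pair s - sbd (Suc (Suc q)) b = frag_cmul ?s (prismc q ?H z0) + pushc (Suc q) (\<lambda>x. (fst x, 0)) c"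
    by simp
  moreover have "frag_cmul ?s (prismc q ?H z0) + pushc (Suc q) (\<lambda>x. (fst x, 0)) c \<in> chains (relc (Suc q) (cyl Y) (topspace Y \<times> {0}))"
    by (intro chains_add chains_cmul pushc_bottom[OF c] prismc_relc[OF z(1) cyl_contract]) auto
  ultimately have "c - prismc q Pair s - sbd (Suc (Suc q)) b \<in> chains (relc (Suc q) (cyl Y) (cyl_ends Y))"
    using chains_mono[OF _ cyl_bottom_sub] by simp
  moreover have "b \<in> chains (scubes (Suc (Suc q)) (cyl Y))"
    unfolding b_def by (intro chains_cmul prismc_scubes[OF c cyl_contract])
  moreover have "s \<in> chains (scubes q Y)"
    unfolding s_def by (intro chains_cmul z1Y)
  ultimately show ?thesis using s1 by blast
qed

text \<open>Again the top part is the witness: if \<open>a \<times> [0,1]\<close> bounds relative to the ends, then the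
  top part \<open>z1\<close> of this relation has the top end of \<open>a \<times> [0,1]\<close>, a copy of \<open>a\<close>, as boundary up to sign. The interval may be reparametrised by \<open>f\<close>, since the
  argument sees only the two ends.\<close>

lemma cyl_inj:
  assumes y: "y \<in> chains (scubes (Suc (Suc q)) (cyl Y))" and a: "a \<in> chains (scubes q Y)"
    and da: "sbd q a \<in> chains (relc (q - 1) Y {})"
    and f: "continuous_on {0..1} f" "f ` {0..1} \<subseteq> {0..1}" "f 0 = 0" "f 1 = 1"
    and bd: "sbd (Suc (Suc q)) y - prismc q (\<lambda>y u. (y, f u)) a \<in> chains (relc (Suc q) (cyl Y) (cyl_ends Y))"
  shows "\<exists>s \<in> chains (scubes (Suc q) Y). sbd (Suc q) s - a \<in> chains (relc q Y {})"
proof -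
  let ?P = "\<lambda>y u. (y, f u)" and ?t = "(-1) ^ Suc q :: int"
  have tt: "?t * ?t = 1" by (simp flip: power_add)
  obtain z0 z1 where z: "z0 \<in> chains (relc (Suc q) (cyl Y) (topspace Y \<times> {0}))" "z1 \<in> chains (end_cubes (Suc q) Y 1)"
    "sbd (Suc (Suc q)) y - prismc q ?P a = z0 + z1"
    using cyl_end_split[OF bd] by blast
  have Pcont: "continuous_map (prod_topology Y (top_of_set {0..1})) (cyl Y) (\<lambda>(y, u). (y, f u))"
    using cyl_map_snd[OF f(1,2), of Y] by (simp add: cyl_def)
  have Pda: "prismc (q - 1) ?P (sbd q a) \<in> chains (relc q (cyl Y) (topspace Y \<times> {0}))"
  proof (cases q)
    case (Suc p)
    show ?thesis
      using prismc_relc[OF da Pcont, of "topspace Y \<times> {0}"] by (simp add: Suc)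
  qed simp
  have i0: "pushc q (\<lambda>y. (y, 0)) a \<in> chains (relc q (cyl Y) (topspace Y \<times> {0}))"
  proof -
    have "a \<in> chains (relc q Y (topspace Y))"
      using a by (rule chains_mono) (use singular_cube_in_topspace in \<open>fastforce simp: relc_def scubes_def\<close>)
    then show ?thesis
      by (rule pushc_relc[OF _ cyl_incl]) auto
  qed
  have i1: "pushc q (\<lambda>y. (y, 1)) a \<in> chains (end_cubes q Y 1)"
    unfolding end_cubes_def
    by (rule pushc_scubes[OF a]) (use cyl_incl[of 1 Y] in \<open>auto intro!: continuous_map_into_subtopology\<close>)
  have "sbd (Suc q) (sbd (Suc (Suc q)) y - prismc q ?P a) = - sbd (Suc q) (prismc q ?P a)"
    by (simp add: sbd_diff sbd_sbd)
  also have "\<dots> = - prismc (q - 1) ?P (sbd q a) - frag_cmul ?t (pushc q (\<lambda>y. (y, 0)) a - pushc q (\<lambda>y. (y, 1)) a)"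
    unfolding sbd_prismc f by simp
  finally have eq: "sbd (Suc q) z1 - frag_cmul ?t (pushc q (\<lambda>y. (y, 1)) a)
      = - prismc (q - 1) ?P (sbd q a) - frag_cmul ?t (pushc q (\<lambda>y. (y, 0)) a) - sbd (Suc q) z0"
    unfolding z(3) sbd_add frag_cmul_diff by (simp add: algebra_simps eq_diff_eq del: power_Suc)
  have "sbd (Suc q) z1 - frag_cmul ?t (pushc q (\<lambda>y. (y, 1)) a) \<in> chains (relc q (cyl Y) (topspace Y \<times> {0}))"
    unfolding eq using sbd_relc[OF z(1)] Pda i0 by (intro chains_diff chains_cmul) (simp_all add: chains_minus)
  moreover have "sbd (Suc q) z1 - frag_cmul ?t (pushc q (\<lambda>y. (y, 1)) a) \<in> chains (end_cubes q Y 1)"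
    using sbd_end_cubes[OF z(2)] i1 by (intro chains_diff chains_cmul) simp_all
  ultimately have "sbd (Suc q) z1 - frag_cmul ?t (pushc q (\<lambda>y. (y, 1)) a) \<in> chains (relc q (cyl Y) {})"
    using chains_mono[OF chains_Int end_cubes_Int] by blast
  then have "pushc q fst (sbd (Suc q) z1 - frag_cmul ?t (pushc q (\<lambda>y. (y, 1)) a)) \<in> chains (relc q Y {})"
    by (rule pushc_relc[OF _ cyl_fst]) simp
  moreover have "pushc q fst (pushc q (\<lambda>y. (y, 1::real)) a) = a"
    unfolding pushc_pushc by (rule pushc_id[OF a]) simp
  ultimately have "sbd (Suc q) (pushc (Suc q) fst z1) - frag_cmul ?t a \<in> chains (relc q Y {})"
    by (simp only: pushc_diff pushc_cmul sbd_pushc diff_Suc_1)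
  then have "frag_cmul ?t (sbd (Suc q) (pushc (Suc q) fst z1) - frag_cmul ?t a) \<in> chains (relc q Y {})"
    by (rule chains_cmul)
  then have "sbd (Suc q) (frag_cmul ?t (pushc (Suc q) fst z1)) - a \<in> chains (relc q Y {})"
    by (simp only: frag_cmul_diff frag_cmul_cmul tt sbd_cmul frag_cmul_one)
  moreover have "frag_cmul ?t (pushc (Suc q) fst z1) \<in> chains (scubes (Suc q) Y)"
    using fst_end_cubes[OF z(2)] by (rule chains_cmul)
  ultimately show ?thesis by blast
qed

section \<open>Attaching a cylinder\<close>

text \<open>Constant on the outer thirds of the interval, so that a neighbourhood of each end of a cylinder is
  pushed into the end.\<close>

definition stretch :: "real \<Rightarrow> real" where
  "stretch u = min 1 (max 0 (3 * u - 1))"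

lemma stretch_cont: "continuous_on S stretch"
  unfolding stretch_def by (intro continuous_intros)

lemma stretch_vals [simp]: "stretch 0 = 0" "stretch 1 = 1"
  and stretch_low: "u \<le> 1/3 \<Longrightarrow> stretch u = 0"
  and stretch_high: "2/3 \<le> u \<Longrightarrow> stretch u = 1"
  and stretch_range: "0 \<le> stretch u" "stretch u \<le> 1"
  by (auto simp: stretch_def)

text \<open>\<open>X\<close> consists of the closed set \<open>Z\<close> and an open cylinder with base \<open>Y\<close>; the map \<open>e\<close> parametrises the
  closed cylinder, and \<open>p\<close> and \<open>h\<close> are the base point and the height in the open cylinder. The homotopy \<open>g\<close>
  stretches the middle third of every interval over the whole interval, pushing the outer thirds into
  \<open>Z\<close>: a neighbourhood \<open>U\<close> of \<open>Z\<close> is deformed into \<open>Z\<close>.\<close>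

locale attached_cylinder =
  fixes X :: "'x topology" and Z :: "'x set" and Y :: "'y topology"
    and e :: "'y \<Rightarrow> real \<Rightarrow> 'x" and p :: "'x \<Rightarrow> 'y" and h :: "'x \<Rightarrow> real" and g :: "'x \<Rightarrow> real \<Rightarrow> 'x"
  assumes Z_closed: "closedin X Z"
    and e_cont: "continuous_map (prod_topology Y (top_of_set {0..1})) X (\<lambda>(y, u). e y u)"
    and e_ends: "y \<in> topspace Y \<Longrightarrow> e y 0 \<in> Z" "y \<in> topspace Y \<Longrightarrow> e y 1 \<in> Z"
    and p_cont: "continuous_map (subtopology X (topspace X - Z)) Y p"
    and h_cont: "continuous_map (subtopology X (topspace X - Z)) euclideanreal h"
    and h_range: "x \<in> topspace X - Z \<Longrightarrow> 0 < h x" "x \<in> topspace X - Z \<Longrightarrow> h x < 1"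
    and e_p_h: "x \<in> topspace X - Z \<Longrightarrow> e (p x) (h x) = x"
    and e_inner: "\<lbrakk>y \<in> topspace Y; 0 < u; u < 1\<rbrakk> \<Longrightarrow> e y u \<notin> Z"
    and p_e: "\<lbrakk>y \<in> topspace Y; 0 < u; u < 1\<rbrakk> \<Longrightarrow> p (e y u) = y"
    and h_e: "\<lbrakk>y \<in> topspace Y; 0 < u; u < 1\<rbrakk> \<Longrightarrow> h (e y u) = u"
    and U_open: "openin X (Z \<union> {x \<in> topspace X - Z. h x < 1/3 \<or> 2/3 < h x})"
    and g_cont: "continuous_map (prod_topology X (top_of_set {0..1})) X (\<lambda>(x, s). g x s)"
    and g_0: "x \<in> topspace X \<Longrightarrow> g x 0 = x"
    and g_Z: "\<lbrakk>z \<in> Z; s \<in> {0..1}\<rbrakk> \<Longrightarrow> g z s = z"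
    and g_e: "\<lbrakk>y \<in> topspace Y; u \<in> {0..1}\<rbrakk> \<Longrightarrow> g (e y u) 1 = e y (stretch u)"
begin

definition V where "V = topspace X - Z"
definition U where "U = Z \<union> {x \<in> topspace X - Z. h x < 1/3 \<or> 2/3 < h x}"

lemma Z_sub: "Z \<subseteq> topspace X"
  using Z_closed closedin_subset by blast

lemma cover_open: "W \<in> {U, V} \<Longrightarrow> openin X W"
  using U_open Z_closed by (auto simp: U_def V_def)

lemma cover: "topspace X \<subseteq> \<Union>{U, V}"
  by (auto simp: U_def V_def)

lemma p_top: "x \<in> V \<Longrightarrow> p x \<in> topspace Y"
  using continuous_map_image_subset_topspace[OF p_cont] by (auto simp: V_def)

text \<open>The retraction of the open cylinder to the closed one. The stretching is what makes a cube near \<open>Z\<close>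
  land in the ends of the cylinder, so that lifting to the cylinder respects the relative complexes.\<close>

definition rho where "rho x = (p x, stretch (h x))"

lemma rho_cont: "continuous_map (subtopology X V) (cyl Y) rho"
proof -
  have "continuous_map euclideanreal (top_of_set {0..1}) stretch"
    using stretch_cont stretch_range by (auto simp: continuous_map_in_subtopology)
  then have "continuous_map (subtopology X V) (top_of_set {0..1}) (stretch \<circ> h)"
    using continuous_map_compose[OF h_cont] unfolding V_def by blast
  then show ?thesis
    using p_cont unfolding cyl_def rho_def V_def by (simp add: continuous_map_paired o_def)
qed

text \<open>Cubes that leave the open cylinder are dropped; for small chains these cubes lie in \<open>U\<close> and are
  negligible.\<close>

definition lift :: "nat \<Rightarrow> 'x cube_chain \<Rightarrow> (((nat \<Rightarrow> real) \<Rightarrow> 'y \<times> real) \<Rightarrow>\<^sub>0 int)" where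
  "lift r = frag_extend (\<lambda>T. if T ` unit_cube r \<subseteq> V then frag_of (push r rho T) else 0)"

lemma lift_0 [simp]: "lift r 0 = 0"
  and lift_diff: "lift r (c - d) = lift r c - lift r d"
  and lift_of: "lift r (frag_of T) = (if T ` unit_cube r \<subseteq> V then frag_of (push r rho T) else 0)"
  by (simp_all add: lift_def frag_extend_diff)

lemma push_rho_singular:
  "\<lbrakk>singular_cube r X T; T ` unit_cube r \<subseteq> V\<rbrakk> \<Longrightarrow> singular_cube r (cyl Y) (push r rho T)"
  by (rule singular_cube_push_on[OF _ rho_cont])

lemma lift_scubes:
  assumes "c \<in> chains (scubes r X)" shows "lift r c \<in> chains (scubes r (cyl Y))"
  unfolding lift_def by (rule chains_extend[OF assms]) (simp add: scubes_def push_rho_singular)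

lemma not_V: "T ` unit_cube r \<subseteq> Z \<Longrightarrow> \<not> T ` unit_cube r \<subseteq> V"
  using unit_cube_nonempty[of r] by (auto simp: V_def)

lemma lift_relc:
  assumes "c \<in> chains (relc r X Z)" shows "lift r c \<in> chains (relc r (cyl Y) (cyl_ends Y))"
  unfolding lift_def
proof (rule chains_extend[OF assms])
  fix T assume T: "T \<in> relc r X Z"
  show "(if T ` unit_cube r \<subseteq> V then frag_of (push r rho T) else 0) \<in> chains (relc r (cyl Y) (cyl_ends Y))"
  proof (cases "T ` unit_cube r \<subseteq> V")
    case True
    then have "degenerate_cube r T" "singular_cube r X T"
      using T not_V[of T r] by (auto simp: relc_def)
    then show ?thesis
      using True push_rho_singular[OF _ True] by (simp add: relc_def degenerate_push)
  qed simp
qed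

lemma rho_U:
  assumes "x \<in> V" "x \<in> U" shows "rho x \<in> cyl_ends Y"
proof -
  have "h x < 1/3 \<or> 2/3 < h x" using assms by (auto simp: U_def V_def)
  then have "stretch (h x) = 0 \<or> stretch (h x) = 1"
    using stretch_low stretch_high by force
  then show ?thesis using p_top[OF assms(1)] by (auto simp: rho_def cyl_ends_def)
qed

lemma lift_U:
  assumes "c \<in> chains (scubes r (subtopology X U))" shows "lift r c \<in> chains (relc r (cyl Y) (cyl_ends Y))"
  unfolding lift_def
proof (rule chains_extend[OF assms])
  fix T assume T: "T \<in> scubes r (subtopology X U)"
  show "(if T ` unit_cube r \<subseteq> V then frag_of (push r rho T) else 0) \<in> chains (relc r (cyl Y) (cyl_ends Y))"
  proof (cases "T ` unit_cube r \<subseteq> V")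
    case True
    have TU: "T ` unit_cube r \<subseteq> U"
      using T by (simp add: scubes_def singular_cube_subtopology)
    have "push r rho T ` unit_cube r \<subseteq> cyl_ends Y"
      unfolding push_image
    proof (rule image_subsetI)
      fix x assume "x \<in> T ` unit_cube r"
      then show "rho x \<in> cyl_ends Y" using TU True rho_U by blast
    qed
    then show ?thesis
      using True T push_rho_singular[OF _ True] by (simp add: relc_def scubes_def singular_cube_subtopology)
  qed simp
qed

lemma lift_V:
  assumes "c \<in> chains (scubes r (subtopology X V))" shows "lift r c = pushc r rho c"
  unfolding lift_def pushc_def
  by (rule frag_extend_eq_on[OF assms]) (simp add: scubes_def singular_cube_subtopology)

lemma small_cases:
  assumes "T \<in> scubes r X \<inter> small_cubes r {U, V}"
  shows "T \<in> scubes r (subtopology X V) \<or> T \<in> scubes r (subtopology X U)"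
  using assms by (auto simp: small_cubes_def scubes_def singular_cube_subtopology)

lemma sbd_lift:
  assumes "c \<in> chains (scubes r X \<inter> small_cubes r {U, V})"
  shows "sbd r (lift r c) - lift (r - 1) (sbd r c) \<in> chains (relc (r - 1) (cyl Y) (cyl_ends Y))"
  using assms
proof (induction rule: chains_induct)
  case (one T)
  consider "T \<in> scubes r (subtopology X V)" | "T \<notin> scubes r (subtopology X V)" "T \<in> scubes r (subtopology X U)"
    using small_cases[OF one] by blast
  then show ?case
  proof cases
    case 1
    then have T: "frag_of T \<in> chains (scubes r (subtopology X V))" by simp
    show ?thesis
      unfolding lift_V[OF T] lift_V[OF sbd_scubes[OF T]] sbd_pushc by simp
  next
    case 2
    then have "lift r (frag_of T) = 0"
      by (auto simp: lift_of scubes_def singular_cube_subtopology)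
    moreover have "lift (r - 1) (sbd r (frag_of T)) \<in> chains (relc (r - 1) (cyl Y) (cyl_ends Y))"
      by (rule lift_U[OF sbd_scubes]) (use 2 in simp)
    ultimately show ?thesis by simp
  qed
next
  case (diff a b)
  show ?case using chains_diff[OF diff] by (simp add: sbd_diff lift_diff algebra_simps)
qed simp

abbreviation "ee \<equiv> \<lambda>(y, u). e y u"

lemma ee_cont: "continuous_map (cyl Y) X ee"
  unfolding cyl_def by (rule e_cont)

lemma ee_ends: "ee ` cyl_ends Y \<subseteq> Z"
  using e_ends by (auto simp: cyl_ends_def)

lemma g_U: "x \<in> U \<Longrightarrow> g x 1 \<in> Z"
proof -
  assume x: "x \<in> U"
  show ?thesis
  proof (cases "x \<in> Z")
    case False
    then have xV: "x \<in> topspace X - Z" and hx: "h x < 1/3 \<or> 2/3 < h x"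
      using x by (auto simp: U_def)
    then have "g x 1 = e (p x) (stretch (h x))"
      using g_e[of "p x" "h x"] e_p_h[OF xV] h_range[OF xV] p_top[of x] by (simp add: V_def)
    moreover have "stretch (h x) = 0 \<or> stretch (h x) = 1"
      using hx stretch_low stretch_high by force
    ultimately show ?thesis
      using e_ends p_top[of x] xV by (auto simp: V_def)
  qed (use g_Z in auto)
qed

text \<open>Lifting and mapping back is the end \<open>g 1\<close> of the deformation, up to chains in \<open>Z\<close>.\<close>

lemma ee_lift:
  assumes "c \<in> chains (scubes r X \<inter> small_cubes r {U, V})"
  shows "pushc r ee (lift r c) - pushc r (\<lambda>x. g x 1) c \<in> chains (relc r X Z)"
  using assms
proof (induction rule: chains_induct)
  case (one T)
  consider "T \<in> scubes r (subtopology X V)" | "T \<notin> scubes r (subtopology X V)" "T \<in> scubes r (subtopology X U)"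
    using small_cases[OF one] by blast
  then show ?case
  proof cases
    case 1
    then have T: "frag_of T \<in> chains (scubes r (subtopology X V))" by simp
    have "ee (rho x) = g x 1" if "x \<in> V" for x
      using g_e[of "p x" "h x"] e_p_h[of x] h_range[of x] p_top[of x] that by (simp add: rho_def V_def)
    then have "push r (ee \<circ> rho) T = push r (\<lambda>x. g x 1) T"
      using 1 by (auto simp: fun_eq_iff push_def restrict_def scubes_def singular_cube_subtopology)
    then show ?thesis
      unfolding lift_V[OF T] pushc_pushc by simp
  next
    case 2
    then have "lift r (frag_of T) = 0"
      by (auto simp: lift_of scubes_def singular_cube_subtopology)
    moreover have "pushc r (\<lambda>x. g x 1) (frag_of T) \<in> chains (relc r X Z)"
    proof (rule pushc_relc)
      show "frag_of T \<in> chains (relc r X U)"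
        using 2 by (auto simp: relc_def scubes_def singular_cube_subtopology)
      have "continuous_map X (prod_topology X (top_of_set {0..1::real})) (\<lambda>x. (x, 1))"
        by (simp add: continuous_map_paired)
      from continuous_map_compose[OF this g_cont] show "continuous_map X X (\<lambda>x. g x 1)"
        by (simp add: o_def)
    qed (use g_U in blast)
    ultimately show ?thesis by simp
  qed
next
  case (diff a b)
  show ?case using chains_diff[OF diff] by (simp add: pushc_diff lift_diff algebra_simps)
qed simp

text \<open>In the other order the composite is the stretching of the cylinder.\<close>

lemma lift_ee:
  assumes "c \<in> chains (scubes r (cyl Y) \<inter> small_cubes r {ee -` U \<inter> topspace (cyl Y), ee -` V \<inter> topspace (cyl Y)})"
  shows "lift r (pushc r ee c) - pushc r (\<lambda>(y, u). (y, stretch u)) c \<in> chains (relc r (cyl Y) (cyl_ends Y))"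
  using assms
proof (induction rule: chains_induct)
  case (one T)
  then have T: "singular_cube r (cyl Y) T" by (simp add: scubes_def)
  have im: "T ` unit_cube r \<subseteq> topspace Y \<times> {0..1}"
    using singular_cube_in_topspace[OF T] by (force simp: cyl_def)
  have inner: "0 < u \<and> u < 1" if "(y, u) \<in> topspace Y \<times> {0..1}" "e y u \<in> V" for y u
  proof -
    have "u \<noteq> 0" "u \<noteq> 1" using that e_ends[of y] by (auto simp: V_def)
    then show ?thesis using that by auto
  qed
  show ?case
  proof (cases "(push r ee T) ` unit_cube r \<subseteq> V")
    case True
    have "push r rho (push r ee T) = push r (\<lambda>(y, u). (y, stretch u)) T"
    proof (rule ext)
      fix t
      show "push r rho (push r ee T) t = push r (\<lambda>(y, u). (y, stretch u)) T t"
      proof (cases "t \<in> unit_cube r")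
        case t: True
        obtain y u where yu1: "T t = (y, u)" by (cases "T t")
        have "T t \<in> topspace Y \<times> {0..1}" using im t by blast
        then have yu: "T t = (y, u)" "(y, u) \<in> topspace Y \<times> {0..1}" using yu1 by simp_all
        have "ee (T t) \<in> V" using True t unfolding push_image by blast
        then have "e y u \<in> V" using yu1 by simp
        then show ?thesis
          using inner[OF yu(2)] yu t p_e[of y u] h_e[of y u] by (simp add: push_def rho_def)
      qed (simp add: push_def)
    qed
    then show ?thesis using True by (simp add: lift_of)
  next
    case False
    have "(push r ee T) ` unit_cube r \<subseteq> U"
      using one False unfolding push_image small_cubes_def by blast
    have "push r (\<lambda>(y, u). (y, stretch u)) T \<in> relc r (cyl Y) (cyl_ends Y)"
      unfolding relc_def mem_Collect_eq
    proof (intro conjI disjI2)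
      show "singular_cube r (cyl Y) (push r (\<lambda>(y, u). (y, stretch u)) T)"
        by (rule singular_cube_push[OF T cyl_map_snd]) (auto simp: stretch_cont stretch_range)
      show "push r (\<lambda>(y, u). (y, stretch u)) T ` unit_cube r \<subseteq> cyl_ends Y"
        unfolding push_image
      proof (clarify)
        fix y u t assume t: "t \<in> unit_cube r" "(y, u) = T t"
        have yu: "(y, u) \<in> topspace Y \<times> {0..1}" using im t by auto
        have eU: "e y u \<in> U"
        proof -
          have "ee (T t) \<in> U"
            using \<open>(push r ee T) ` unit_cube r \<subseteq> U\<close> t(1) unfolding push_image by blast
          then show ?thesis by (simp add: t(2)[symmetric])
        qed
        have "stretch u = 0 \<or> stretch u = 1"
        proof (cases "u = 0 \<or> u = 1")
          case False
          then have u: "0 < u" "u < 1" "y \<in> topspace Y" using yu by auto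
          have "u < 1/3 \<or> 2/3 < u"
            using eU e_inner[OF u(3,1,2)] h_e[OF u(3,1,2)] by (auto simp: U_def)
          then show ?thesis using stretch_low stretch_high by force
        qed auto
        then show "(y, stretch u) \<in> cyl_ends Y" using yu by (auto simp: cyl_ends_def)
      qed
    qed
    then show ?thesis using False by (simp add: lift_of)
  qed
next
  case (diff a b)
  show ?case using chains_diff[OF diff] by (simp add: pushc_diff lift_diff algebra_simps)
qed simp

lemma prismc_e: "pushc (Suc r) ee (prismc r Pair c) = prismc r e c"
  by (simp add: pushc_prismc)

text \<open>Excision: after subdivision the relative cycle is small, so its lift is a relative cycle, and the
  deformation \<open>g\<close> shows that the image of the lift is homologous to the original.\<close>

lemma reduce_to_cylinder:
  assumes c: "c \<in> chains (scubes r X)" and bd: "sbd r c \<in> chains (relc (r - 1) X Z)"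
  shows "\<exists>d \<in> chains (scubes r (cyl Y)). sbd r d \<in> chains (relc (r - 1) (cyl Y) (cyl_ends Y)) \<and>
    (\<exists>b \<in> chains (scubes (Suc r) X). c - pushc r ee d - sbd (Suc r) b \<in> chains (relc r X Z))"
proof -
  obtain N where "\<forall>M\<ge>N. (subd r ^^ M) c \<in> chains (small_cubes r {U, V})"
    using subd_pow_small[OF c cover_open cover] by blast
  then have small: "(subd r ^^ N) c \<in> chains (small_cubes r {U, V})" by simp
  let ?c = "(subd r ^^ N) c"
  obtain w where w: "w \<in> chains (scubes (Suc r) X)" "?c - c - sbd (Suc r) w \<in> chains (relc r X Z)"
    using subd_pow_homologous[OF c bd] by blast
  have c': "?c \<in> chains (scubes r X)" using c by (rule subd_pow_scubes)
  have cs: "?c \<in> chains (scubes r X \<inter> small_cubes r {U, V})"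
    using chains_Int[OF c' small] .
  have bd': "sbd r ?c \<in> chains (relc (r - 1) X Z)"
    unfolding sbd_subd_pow using bd by (rule subd_pow_relc)
  let ?t = "(-1) ^ Suc r :: int"
  have tt: "?t * ?t = 1" by (simp flip: power_add)
  have "prismc (r - 1) g (sbd r ?c) \<in> chains (relc r X Z)"
  proof (cases r)
    case (Suc q)
    then show ?thesis
      using prismc_relc[OF bd' g_cont, of Z] g_Z by simp
  qed simp
  moreover have "sbd (Suc r) (prismc r g ?c) = prismc (r - 1) g (sbd r ?c) + frag_cmul ?t (?c - pushc r (\<lambda>x. g x 1) ?c)"
    unfolding sbd_prismc using pushc_id[OF c' g_0] by simp
  ultimately have "sbd (Suc r) (prismc r g ?c) - frag_cmul ?t (?c - pushc r (\<lambda>x. g x 1) ?c) \<in> chains (relc r X Z)"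
    by simp
  from chains_cmul[OF this, of ?t]
  have 1: "sbd (Suc r) (frag_cmul ?t (prismc r g ?c)) - (?c - pushc r (\<lambda>x. g x 1) ?c) \<in> chains (relc r X Z)"
    by (simp only: frag_cmul_diff[of ?t "sbd _ _"] frag_cmul_cmul tt sbd_cmul frag_cmul_one)
  let ?b = "- frag_cmul ?t (prismc r g ?c)"
  have b: "- w - ?b \<in> chains (scubes (Suc r) X)"
    using w(1) prismc_scubes[OF c' g_cont] by (intro chains_diff) (simp_all add: chains_cmul del: minus_frag_cmul)
  have eq: "c - pushc r ee (lift r ?c) - sbd (Suc r) (- w - ?b)
     = - (pushc r ee (lift r ?c) - pushc r (\<lambda>x. g x 1) ?c) - (?c - c - sbd (Suc r) w)
       - (sbd (Suc r) (frag_cmul ?t (prismc r g ?c)) - (?c - pushc r (\<lambda>x. g x 1) ?c))"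
    by (simp add: sbd_diff sbd_minus del: minus_frag_cmul)
  have 2: "c - pushc r ee (lift r ?c) - sbd (Suc r) (- w - ?b) \<in> chains (relc r X Z)"
    unfolding eq by (rule chains_diff[OF chains_diff[OF chains_minus[THEN iffD2, OF ee_lift[OF cs]] w(2)] 1])
  have "sbd r (lift r ?c) \<in> chains (relc (r - 1) (cyl Y) (cyl_ends Y))"
    using chains_diff_iff[OF sbd_lift[OF cs]] lift_relc[OF bd'] by blast
  then show ?thesis
    using lift_scubes[OF c'] 2 b by blast
qed

lemma attach_surj_0:
  assumes c: "c \<in> chains (scubes 0 X)"
  shows "\<exists>b \<in> chains (scubes 1 X). c - sbd 1 b \<in> chains (relc 0 X Z)"
proof -
  obtain d b where d: "d \<in> chains (scubes 0 (cyl Y))" and b: "b \<in> chains (scubes 1 X)"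
    "c - pushc 0 ee d - sbd 1 b \<in> chains (relc 0 X Z)"
    using reduce_to_cylinder[OF c] by auto
  obtain b' where b': "b' \<in> chains (scubes 1 (cyl Y))" "d - sbd 1 b' \<in> chains (relc 0 (cyl Y) (cyl_ends Y))"
    using cyl_surj_0[OF d] by blast
  have "pushc 0 ee (d - sbd 1 b') \<in> chains (relc 0 X Z)"
    by (rule pushc_relc[OF b'(2) ee_cont ee_ends])
  then have "(c - pushc 0 ee d - sbd 1 b) + pushc 0 ee (d - sbd 1 b') \<in> chains (relc 0 X Z)"
    by (rule chains_add[OF b(2)])
  moreover have "pushc 0 ee (sbd 1 b') = sbd 1 (pushc 1 ee b')"
    by (simp add: sbd_pushc)
  ultimately have "c - sbd 1 (b + pushc 1 ee b') \<in> chains (relc 0 X Z)"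
    by (simp add: pushc_diff sbd_add algebra_simps)
  then show ?thesis
    using chains_add[OF b(1) pushc_scubes[OF b'(1) ee_cont]] by blast
qed

lemma attach_surj:
  assumes c: "c \<in> chains (scubes (Suc q) X)" and bd: "sbd (Suc q) c \<in> chains (relc q X Z)"
  shows "\<exists>s \<in> chains (scubes q Y). sbd q s \<in> chains (relc (q - 1) Y {}) \<and>
    (\<exists>b \<in> chains (scubes (Suc (Suc q)) X). c - prismc q e s - sbd (Suc (Suc q)) b \<in> chains (relc (Suc q) X Z))"
proof -
  obtain d b where d: "d \<in> chains (scubes (Suc q) (cyl Y))" "sbd (Suc q) d \<in> chains (relc q (cyl Y) (cyl_ends Y))"
    and b: "b \<in> chains (scubes (Suc (Suc q)) X)" "c - pushc (Suc q) ee d - sbd (Suc (Suc q)) b \<in> chains (relc (Suc q) X Z)"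
    using reduce_to_cylinder[OF c] bd by auto
  obtain s b' where s: "s \<in> chains (scubes q Y)" "sbd q s \<in> chains (relc (q - 1) Y {})"
    and b': "b' \<in> chains (scubes (Suc (Suc q)) (cyl Y))"
      "d - prismc q Pair s - sbd (Suc (Suc q)) b' \<in> chains (relc (Suc q) (cyl Y) (cyl_ends Y))"
    using cyl_surj[OF d] by blast
  have "pushc (Suc q) ee (d - prismc q Pair s - sbd (Suc (Suc q)) b') \<in> chains (relc (Suc q) X Z)"
    by (rule pushc_relc[OF b'(2) ee_cont ee_ends])
  then have mem: "(c - pushc (Suc q) ee d - sbd (Suc (Suc q)) b) + pushc (Suc q) ee (d - prismc q Pair s - sbd (Suc (Suc q)) b')
      \<in> chains (relc (Suc q) X Z)"
    by (rule chains_add[OF b(2)])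
  have push_b': "pushc (Suc q) ee (sbd (Suc (Suc q)) b') = sbd (Suc (Suc q)) (pushc (Suc (Suc q)) ee b')"
    by (simp add: sbd_pushc)
  have eq: "c - prismc q e s - sbd (Suc (Suc q)) (b + pushc (Suc (Suc q)) ee b')
      = (c - pushc (Suc q) ee d - sbd (Suc (Suc q)) b) + pushc (Suc q) ee (d - prismc q Pair s - sbd (Suc (Suc q)) b')"
    unfolding pushc_diff prismc_e push_b' sbd_add by simp
  have "c - prismc q e s - sbd (Suc (Suc q)) (b + pushc (Suc (Suc q)) ee b') \<in> chains (relc (Suc q) X Z)"
    unfolding eq by (rule mem)
  then show ?thesis
    using chains_add[OF b(1) pushc_scubes[OF b'(1) ee_cont]] s by blast
qed

text \<open>A chain witnessing that \<open>a \<times> [0,1]\<close> bounds in \<open>X\<close> is lifted to the cylinder, where the lift of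
  \<open>a \<times> [0,1]\<close> is the same up to subdivision and stretching; then \<open>cyl_inj\<close> applies with \<open>f = stretch\<close>.\<close>

lemma attach_inj:
  assumes c: "c \<in> chains (scubes (Suc (Suc q)) X)" and a: "a \<in> chains (scubes q Y)"
    and da: "sbd q a \<in> chains (relc (q - 1) Y {})"
    and bd: "sbd (Suc (Suc q)) c - prismc q e a \<in> chains (relc (Suc q) X Z)"
  shows "\<exists>s \<in> chains (scubes (Suc q) Y). sbd (Suc q) s - a \<in> chains (relc q Y {})"
proof -
  let ?S = "\<lambda>(y, u). (y, stretch u)" and ?a = "prismc q Pair a"
  let ?U' = "ee -` U \<inter> topspace (cyl Y)" and ?V' = "ee -` V \<inter> topspace (cyl Y)"
  have a': "?a \<in> chains (scubes (Suc q) (cyl Y))"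
    by (rule prismc_scubes[OF a]) (rule cyl_pair)
  have op': "openin (cyl Y) W" if W: "W \<in> {?U', ?V'}" for W
  proof -
    have "openin (cyl Y) {x \<in> topspace (cyl Y). ee x \<in> A}" if "openin X A" for A
      using openin_continuous_map_preimage[OF ee_cont that] .
    moreover have "ee -` A \<inter> topspace (cyl Y) = {x \<in> topspace (cyl Y). ee x \<in> A}" for A
      by blast
    ultimately show ?thesis using W cover_open by auto
  qed
  have cov': "topspace (cyl Y) \<subseteq> \<Union>{?U', ?V'}"
  proof
    fix x assume x: "x \<in> topspace (cyl Y)"
    have "ee x \<in> topspace X"
      using subsetD[OF continuous_map_image_subset_topspace[OF ee_cont] imageI[OF x]] .
    then have "ee x \<in> U \<or> ee x \<in> V" using cover by blast
    then show "x \<in> \<Union>{?U', ?V'}" using x by blast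
  qed
  obtain N1 where N1: "\<forall>M\<ge>N1. (subd (Suc (Suc q)) ^^ M) c \<in> chains (small_cubes (Suc (Suc q)) {U, V})"
    using subd_pow_small[OF c cover_open cover] by blast
  obtain N2 where N2: "\<forall>M\<ge>N2. (subd (Suc q) ^^ M) ?a \<in> chains (small_cubes (Suc q) {?U', ?V'})"
    using subd_pow_small[OF a' op' cov'] by blast
  \<comment> \<open>One number of subdivisions for both chains, to keep them comparable.\<close>
  define N where "N = max N1 N2"
  let ?c = "(subd (Suc (Suc q)) ^^ N) c" and ?A = "(subd (Suc q) ^^ N) ?a"
  have c': "?c \<in> chains (scubes (Suc (Suc q)) X)" using c by (rule subd_pow_scubes)
  have cs: "?c \<in> chains (scubes (Suc (Suc q)) X \<inter> small_cubes (Suc (Suc q)) {U, V})"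
    using N1 by (intro chains_Int c') (simp add: N_def)
  have As: "?A \<in> chains (scubes (Suc q) (cyl Y) \<inter> small_cubes (Suc q) {?U', ?V'})"
    using N2 by (intro chains_Int subd_pow_scubes[OF a']) (simp add: N_def)
  have "(subd (Suc q) ^^ N) (sbd (Suc (Suc q)) c - prismc q e a) \<in> chains (relc (Suc q) X Z)"
    using bd by (rule subd_pow_relc)
  then have "sbd (Suc (Suc q)) ?c - pushc (Suc q) ee ?A \<in> chains (relc (Suc q) X Z)"
    by (simp add: subd_pow_diff sbd_subd_pow subd_pow_pushc[symmetric] prismc_e)
  from lift_relc[OF this]
  have 1: "lift (Suc q) (sbd (Suc (Suc q)) ?c) - lift (Suc q) (pushc (Suc q) ee ?A) \<in> chains (relc (Suc q) (cyl Y) (cyl_ends Y))"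
    by (simp add: lift_diff)
  have 2: "sbd (Suc (Suc q)) (lift (Suc (Suc q)) ?c) - lift (Suc q) (sbd (Suc (Suc q)) ?c) \<in> chains (relc (Suc q) (cyl Y) (cyl_ends Y))"
    using sbd_lift[OF cs] by simp
  have 3: "lift (Suc q) (pushc (Suc q) ee ?A) - pushc (Suc q) ?S ?A \<in> chains (relc (Suc q) (cyl Y) (cyl_ends Y))"
    by (rule lift_ee[OF As])
  have da': "sbd (Suc q) ?a \<in> chains (relc q (cyl Y) (cyl_ends Y))"
  proof -
    have "prismc (q - 1) Pair (sbd q a) \<in> chains (relc q (cyl Y) (cyl_ends Y))"
    proof (cases q)
      case (Suc m)
      show ?thesis using prismc_relc[OF da cyl_pair, of "cyl_ends Y"] by (simp add: Suc)
    qed simp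
    moreover have "pushc q (\<lambda>y. (y, u)) a \<in> chains (relc q (cyl Y) (cyl_ends Y))" if "u = 0 \<or> u = 1" for u :: real
    proof -
      have "a \<in> chains (relc q Y (topspace Y))"
        using a by (rule chains_mono) (use singular_cube_in_topspace in \<open>fastforce simp: relc_def scubes_def\<close>)
      then show ?thesis
        by (rule pushc_relc[OF _ cyl_incl]) (use that in \<open>auto simp: cyl_ends_def\<close>)
    qed
    ultimately show ?thesis
      unfolding sbd_prismc by (intro chains_add chains_cmul chains_diff) auto
  qed
  obtain w where w: "w \<in> chains (scubes (Suc (Suc q)) (cyl Y))"
    "?A - ?a - sbd (Suc (Suc q)) w \<in> chains (relc (Suc q) (cyl Y) (cyl_ends Y))"
    using subd_pow_homologous[OF a', of "cyl_ends Y" N] da' by auto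
  have S_cont: "continuous_map (cyl Y) (cyl Y) ?S"
    by (rule cyl_map_snd) (auto simp: stretch_cont stretch_range)
  have 4: "pushc (Suc q) ?S (?A - ?a - sbd (Suc (Suc q)) w) \<in> chains (relc (Suc q) (cyl Y) (cyl_ends Y))"
    by (rule pushc_relc[OF w(2) S_cont]) (auto simp: cyl_ends_def)
  have 5: "pushc (Suc q) ?S ?a = prismc q (\<lambda>y u. (y, stretch u)) a"
    by (simp add: pushc_prismc)
  have 6: "pushc (Suc q) ?S (sbd (Suc (Suc q)) w) = sbd (Suc (Suc q)) (pushc (Suc (Suc q)) ?S w)"
    by (simp add: sbd_pushc)
  let ?y = "lift (Suc (Suc q)) ?c - pushc (Suc (Suc q)) ?S w"
  have "sbd (Suc (Suc q)) ?y - prismc q (\<lambda>y u. (y, stretch u)) a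
    = (sbd (Suc (Suc q)) (lift (Suc (Suc q)) ?c) - lift (Suc q) (sbd (Suc (Suc q)) ?c))
      + (lift (Suc q) (sbd (Suc (Suc q)) ?c) - lift (Suc q) (pushc (Suc q) ee ?A))
      + (lift (Suc q) (pushc (Suc q) ee ?A) - pushc (Suc q) ?S ?A)
      + pushc (Suc q) ?S (?A - ?a - sbd (Suc (Suc q)) w)"
    unfolding pushc_diff 5 6 sbd_diff by simp
  moreover have "\<dots> \<in> chains (relc (Suc q) (cyl Y) (cyl_ends Y))"
    by (intro chains_add 1 2 3 4)
  ultimately have bd': "sbd (Suc (Suc q)) ?y - prismc q (\<lambda>y u. (y, stretch u)) a \<in> chains (relc (Suc q) (cyl Y) (cyl_ends Y))"
    by simp
  have "?y \<in> chains (scubes (Suc (Suc q)) (cyl Y))"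
    by (intro chains_diff lift_scubes[OF c'] pushc_scubes[OF w(1) S_cont])
  then show ?thesis
    by (rule cyl_inj[OF _ a da _ _ _ _ bd']) (auto simp: stretch_cont stretch_range)
qed

end

section \<open>Cubical complexes with coloured directions\<close>

definition coord_box :: "nat set \<Rightarrow> (nat \<Rightarrow> real) set" where
  "coord_box D = {t. (\<forall>i\<in>D. 0 \<le> t i \<and> t i \<le> 1) \<and> (\<forall>i. i \<notin> D \<longrightarrow> t i = 0)}"

definition open_coord_box :: "nat set \<Rightarrow> (nat \<Rightarrow> real) set" where
  "open_coord_box D = {t. (\<forall>i\<in>D. 0 < t i \<and> t i < 1) \<and> (\<forall>i. i \<notin> D \<longrightarrow> t i = 0)}"

lemma open_box_sub: "t \<in> open_coord_box D \<Longrightarrow> t \<in> coord_box D"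
  by (simp add: coord_box_def open_coord_box_def less_imp_le)

lemma box_coord: "t \<in> coord_box D \<Longrightarrow> 0 \<le> t i \<and> t i \<le> 1"
  unfolding coord_box_def by (cases "i \<in> D") auto

lemma box_upd: "\<lbrakk>t \<in> coord_box D; i \<in> D; 0 \<le> u; u \<le> 1\<rbrakk> \<Longrightarrow> t(i := u) \<in> coord_box D"
  unfolding coord_box_def by auto

lemma box_upd_remove: "t \<in> coord_box D \<Longrightarrow> t(i := 0) \<in> coord_box (D - {i})"
  unfolding coord_box_def by auto

lemma box_upd_insert: "\<lbrakk>t \<in> coord_box (D - {i}); i \<in> D; 0 \<le> u; u \<le> 1\<rbrakk> \<Longrightarrow> t(i := u) \<in> coord_box D"
  unfolding coord_box_def by auto

lemma closed_coord: "closed {t :: nat \<Rightarrow> real. t i \<in> K}" if "closed K"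
  using closed_vimage[OF that, of "\<lambda>t. t i"] continuous_on_coord[of UNIV i]
  by (simp add: vimage_def)

lemma closed_box: "closed (coord_box D)"
proof -
  have eq: "coord_box D = (\<Inter>i\<in>D. {t. t i \<in> {0..1}}) \<inter> (\<Inter>i\<in>-D. {t. t i \<in> {0}})"
    unfolding coord_box_def by auto
  show ?thesis
    unfolding eq by (intro closed_Int closed_INT ballI closed_coord closed_singleton closed_atLeastAtMost)
qed

lemma continuous_map_prod_sum:
  assumes "\<And>x. x \<in> Q \<Longrightarrow> continuous_map (prod_topology (B x) I) W (\<lambda>(t, s). f ((x, t), s))"
  shows "continuous_map (prod_topology (sum_topology B Q) I) W f"
  unfolding continuous_map_def
proof (intro conjI allI impI)
  have top: "((x, t), s) \<in> topspace (prod_topology (sum_topology B Q) I) \<longleftrightarrow> x \<in> Q \<and> (t, s) \<in> topspace (prod_topology (B x) I)" for x t s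
    by auto
  show "f \<in> topspace (prod_topology (sum_topology B Q) I) \<rightarrow> topspace W"
  proof (rule Pi_I)
    fix q assume q: "q \<in> topspace (prod_topology (sum_topology B Q) I)"
    obtain x t s where xts: "q = ((x, t), s)" by (metis surj_pair)
    then have "x \<in> Q" "(t, s) \<in> topspace (prod_topology (B x) I)" using q top by blast+
    from subsetD[OF continuous_map_image_subset_topspace[OF assms[OF this(1)]] imageI[OF this(2)]]
    show "f q \<in> topspace W" using xts by simp
  qed
  fix O' assume O': "openin W O'"
  let ?P = "{q \<in> topspace (prod_topology (sum_topology B Q) I). f q \<in> O'}"
  show "openin (prod_topology (sum_topology B Q) I) ?P"
    unfolding openin_prod_topology_alt
  proof (intro allI impI)
    fix xt s assume "(xt, s) \<in> ?P"
    then obtain x t where xt: "xt = (x, t)" and x: "x \<in> Q" and ts: "(t, s) \<in> topspace (prod_topology (B x) I)" "f ((x, t), s) \<in> O'"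
      using top by (cases xt) auto
    have "openin (prod_topology (B x) I) {p \<in> topspace (prod_topology (B x) I). (case p of (t, s) \<Rightarrow> f ((x, t), s)) \<in> O'}"
      by (rule openin_continuous_map_preimage[OF assms[OF x] O'])
    moreover have "(t, s) \<in> {p \<in> topspace (prod_topology (B x) I). (case p of (t, s) \<Rightarrow> f ((x, t), s)) \<in> O'}"
      using ts by simp
    ultimately have "\<exists>U V. openin (B x) U \<and> openin I V \<and> t \<in> U \<and> s \<in> V \<and>
      U \<times> V \<subseteq> {p \<in> topspace (prod_topology (B x) I). (case p of (t, s) \<Rightarrow> f ((x, t), s)) \<in> O'}"
      by (rule openin_prod_topology_alt[THEN iffD1, rule_format])
    then obtain U V where UV: "openin (B x) U" "openin I V" "t \<in> U" "s \<in> V"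
      "U \<times> V \<subseteq> {p \<in> topspace (prod_topology (B x) I). (case p of (t, s) \<Rightarrow> f ((x, t), s)) \<in> O'}"
      by (elim exE conjE)
    have "openin (sum_topology B Q) (Pair x ` U)"
      unfolding openin_sum_topology
    proof (intro conjI ballI)
      show "Pair x ` U \<subseteq> Sigma Q (topspace \<circ> B)"
        using openin_subset[OF UV(1)] x by auto
      fix y assume "y \<in> Q"
      show "openin (B y) {z. (y, z) \<in> Pair x ` U}"
      proof (cases "y = x")
        case True
        then have "{z. (y, z) \<in> Pair x ` U} = U" by auto
        then show ?thesis using UV(1) True by simp
      next
        case False
        then have "{z. (y, z) \<in> Pair x ` U} = {}" by auto
        then show ?thesis by simp
      qed
    qed
    moreover have "Pair x ` U \<times> V \<subseteq> ?P"
    proof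
      fix q assume "q \<in> Pair x ` U \<times> V"
      then obtain u v where uv: "q = ((x, u), v)" "u \<in> U" "v \<in> V" by auto
      then have "(u, v) \<in> topspace (prod_topology (B x) I)" "f ((x, u), v) \<in> O'"
        using UV(5) by auto
      then show "q \<in> ?P" using uv(1) x by auto
    qed
    moreover have "xt \<in> Pair x ` U" using UV(3) xt by simp
    ultimately show "\<exists>U V. openin (sum_topology B Q) U \<and> openin I V \<and> xt \<in> U \<and> s \<in> V \<and> U \<times> V \<subseteq> ?P"
      using UV(2,4) by (intro exI conjI)
  qed
qed

text \<open>A cell \<open>x\<close> has the set \<open>D x\<close> of its directions, the lower and upper faces \<open>F 0 i x\<close> and
  \<open>F 1 i x\<close> in direction \<open>i\<close>, and the characteristic map \<open>ch x\<close> on the box with sides \<open>D x\<close>. Boxes live in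
  the space of all sequences and vanish outside \<open>D x\<close>; thus passing to a face sets a coordinate to
  0 and needs no renumbering.\<close>

locale cubical_complex =
  fixes k :: nat and X :: "'x topology" and Q :: "'c set" and D :: "'c \<Rightarrow> nat set"
    and F :: "nat \<Rightarrow> nat \<Rightarrow> 'c \<Rightarrow> 'c" and ch :: "'c \<Rightarrow> (nat \<Rightarrow> real) \<Rightarrow> 'x"
  assumes D_sub: "x \<in> Q \<Longrightarrow> D x \<subseteq> {..<k}"
    and F_Q: "\<lbrakk>x \<in> Q; i \<in> D x; l \<in> {0, 1}\<rbrakk> \<Longrightarrow> F l i x \<in> Q"
    and D_F: "\<lbrakk>x \<in> Q; i \<in> D x; l \<in> {0, 1}\<rbrakk> \<Longrightarrow> D (F l i x) = D x - {i}"
    and chi_cont: "x \<in> Q \<Longrightarrow> continuous_map (top_of_set (coord_box (D x))) X (ch x)"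
    and chi_face: "\<lbrakk>x \<in> Q; i \<in> D x; l \<in> {0, 1}; t \<in> coord_box (D x); t i = real l\<rbrakk> \<Longrightarrow> ch x t = ch (F l i x) (t(i := 0))"
    and cells_cover: "p \<in> topspace X \<Longrightarrow> \<exists>x\<in>Q. \<exists>t\<in>open_coord_box (D x). p = ch x t"
    and cells_inj: "\<lbrakk>x \<in> Q; y \<in> Q; s \<in> open_coord_box (D x); t \<in> open_coord_box (D y); ch x s = ch y t\<rbrakk> \<Longrightarrow> x = y \<and> s = t"
    and closed_crit: "\<lbrakk>C \<subseteq> topspace X; \<And>x. x \<in> Q \<Longrightarrow> closed {t \<in> coord_box (D x). ch x t \<in> C}\<rbrakk> \<Longrightarrow> closedin X C"
begin

lemma D_finite: "x \<in> Q \<Longrightarrow> finite (D x)"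
  using D_sub finite_subset by blast

lemma chi_top: "\<lbrakk>x \<in> Q; t \<in> coord_box (D x)\<rbrakk> \<Longrightarrow> ch x t \<in> topspace X"
  using continuous_map_image_subset_topspace[OF chi_cont] by auto

lemma point_cases:
  assumes "p \<in> topspace X" obtains x t where "x \<in> Q" "t \<in> open_coord_box (D x)" "t \<in> coord_box (D x)" "p = ch x t"
  using cells_cover[OF assms] open_box_sub by blast

text \<open>Every point lies in exactly one open cell, so functions on the cells define a function on the
  complex; if they are compatible with faces, it has the expected values on closed cells too.\<close>

definition desc :: "('c \<Rightarrow> (nat \<Rightarrow> real) \<Rightarrow> 'w) \<Rightarrow> 'x \<Rightarrow> 'w" where
  "desc \<phi> p = (THE w. \<exists>x\<in>Q. \<exists>t\<in>open_coord_box (D x). p = ch x t \<and> w = \<phi> x t)"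

lemma desc_open: "\<lbrakk>x \<in> Q; t \<in> open_coord_box (D x)\<rbrakk> \<Longrightarrow> desc \<phi> (ch x t) = \<phi> x t"
  unfolding desc_def by (rule the_equality) (use cells_inj in blast)+

text \<open>Induction on the dimension of the cell: a point outside the open box is moved to a face.\<close>

lemma desc_eq:
  assumes comp: "\<And>x i l t. \<lbrakk>x \<in> Q; i \<in> D x; l \<in> {0, 1}; t \<in> coord_box (D x); t i = real l\<rbrakk> \<Longrightarrow> \<phi> x t = \<phi> (F l i x) (t(i := 0))"
    and "x \<in> Q" "t \<in> coord_box (D x)"
  shows "desc \<phi> (ch x t) = \<phi> x t"
  using assms(2,3)
proof (induction "card (D x)" arbitrary: x t)
  case 0
  then have "D x = {}" using D_finite by simp
  then have "t \<in> open_coord_box (D x)" using 0 by (simp add: coord_box_def open_coord_box_def)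
  then show ?case using desc_open 0 by blast
next
  case (Suc n)
  show ?case
  proof (cases "t \<in> open_coord_box (D x)")
    case False
    then obtain i where i: "i \<in> D x" "t i = 0 \<or> t i = 1"
      using Suc.prems(2) unfolding coord_box_def open_coord_box_def by force
    then obtain l :: nat where l: "l \<in> {0, 1}" "t i = real l"
      by (metis insert_iff of_nat_0 of_nat_1)
    have "n = card (D (F l i x))"
      using Suc.hyps(2) D_F[OF Suc.prems(1) i(1) l(1)] i(1) D_finite[OF Suc.prems(1)] by simp
    moreover have "t(i := 0) \<in> coord_box (D (F l i x))"
      unfolding D_F[OF Suc.prems(1) i(1) l(1)] by (rule box_upd_remove[OF Suc.prems(2)])
    ultimately have "desc \<phi> (ch (F l i x) (t(i := 0))) = \<phi> (F l i x) (t(i := 0))"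
      using Suc.hyps(1) F_Q[OF Suc.prems(1) i(1) l(1)] by blast
    then show ?thesis
      using chi_face[OF Suc.prems(1) i(1) l(1) Suc.prems(2) l(2)] comp[OF Suc.prems(1) i(1) l(1) Suc.prems(2) l(2)] by simp
  qed (use desc_open Suc.prems in blast)
qed

lemma open_crit:
  assumes S: "S \<subseteq> topspace X" and op: "\<And>x. x \<in> Q \<Longrightarrow> openin (top_of_set (coord_box (D x))) {t \<in> coord_box (D x). ch x t \<in> S}"
  shows "openin X S"
proof -
  have "closedin X (topspace X - S)"
  proof (rule closed_crit)
    fix x assume x: "x \<in> Q"
    have "{t \<in> coord_box (D x). ch x t \<in> topspace X - S} = coord_box (D x) - {t \<in> coord_box (D x). ch x t \<in> S}"
      using chi_top[OF x] by auto
    moreover have "closedin (top_of_set (coord_box (D x))) (coord_box (D x) - {t \<in> coord_box (D x). ch x t \<in> S})"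
      using closedin_diff[OF closedin_topspace op[OF x]] by simp
    ultimately show "closed {t \<in> coord_box (D x). ch x t \<in> topspace X - S}"
      using closedin_closed_eq[OF closed_box, of "D x"] by simp
  qed blast
  then show ?thesis
    using S by (simp add: openin_closedin_eq)
qed

lemma cells_quotient: "quotient_map (sum_topology (\<lambda>x. top_of_set (coord_box (D x))) Q) X (\<lambda>(x, t). ch x t)"
  unfolding quotient_map_def
proof (intro conjI allI impI)
  show "(\<lambda>(x, t). ch x t) ` topspace (sum_topology (\<lambda>x. top_of_set (coord_box (D x))) Q) = topspace X"
  proof (rule subset_antisym; rule subsetI)
    fix p assume "p \<in> topspace X"
    then obtain x t where "x \<in> Q" "t \<in> coord_box (D x)" "p = ch x t" by (rule point_cases)
    then show "p \<in> (\<lambda>(x, t). ch x t) ` topspace (sum_topology (\<lambda>x. top_of_set (coord_box (D x))) Q)"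
      by (intro image_eqI[of _ _ "(x, t)"]) auto
  qed (use chi_top in auto)
  fix S assume S: "S \<subseteq> topspace X"
  let ?P = "{q \<in> topspace (sum_topology (\<lambda>x. top_of_set (coord_box (D x))) Q). (case q of (x, t) \<Rightarrow> ch x t) \<in> S}"
  have slice: "{t. (x, t) \<in> ?P} = {t \<in> coord_box (D x). ch x t \<in> S}" if "x \<in> Q" for x
    using that by auto
  show "openin (sum_topology (\<lambda>x. top_of_set (coord_box (D x))) Q) ?P = openin X S"
  proof
    assume "openin (sum_topology (\<lambda>x. top_of_set (coord_box (D x))) Q) ?P"
    then have "openin (top_of_set (coord_box (D x))) {t \<in> coord_box (D x). ch x t \<in> S}" if "x \<in> Q" for x
      using that unfolding openin_sum_topology slice[OF that, symmetric] by blast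
    then show "openin X S" by (rule open_crit[OF S])
  next
    assume op: "openin X S"
    show "openin (sum_topology (\<lambda>x. top_of_set (coord_box (D x))) Q) ?P"
      unfolding openin_sum_topology
    proof (intro conjI ballI)
      fix x assume x: "x \<in> Q"
      show "openin (top_of_set (coord_box (D x))) {t. (x, t) \<in> ?P}"
        unfolding slice[OF x] using openin_continuous_map_preimage[OF chi_cont[OF x] op] by simp
    qed auto
  qed
qed

text \<open>The interval is locally compact, so the product of the gluing map with it is still a quotient map.\<close>

lemma continuous_prod_cells:
  assumes "\<And>x. x \<in> Q \<Longrightarrow> continuous_map (top_of_set (coord_box (D x) \<times> {0..1::real})) W (\<lambda>(t, s). f (ch x t, s))"
  shows "continuous_map (prod_topology X (top_of_set {0..1})) W f"
proof -
  have "quotient_map (prod_topology (sum_topology (\<lambda>x. top_of_set (coord_box (D x))) Q) (top_of_set {0..1}))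
      (prod_topology X (top_of_set {0..1::real})) (\<lambda>(q, s). ((\<lambda>(x, t). ch x t) q, s))"
    by (rule quotient_map_prod_left[OF _ _ cells_quotient])
      (auto simp: Hausdorff_space_subtopology intro!: compact_imp_locally_compact_space compact_space_subtopology)
  moreover have "continuous_map (prod_topology (sum_topology (\<lambda>x. top_of_set (coord_box (D x))) Q) (top_of_set {0..1})) W
      (f \<circ> (\<lambda>(q, s). ((\<lambda>(x, t). ch x t) q, s)))"
    by (rule continuous_map_prod_sum) (use assms in \<open>simp add: prod_top_of_set case_prod_unfold\<close>)
  ultimately show ?thesis
    by (rule continuous_compose_quotient_map)
qed

lemma continuous_open_cells:
  assumes V: "openin X V" and f: "\<And>x. x \<in> Q \<Longrightarrow> continuous_map (top_of_set {t \<in> coord_box (D x). ch x t \<in> V}) W (\<lambda>t. f (ch x t))"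
  shows "continuous_map (subtopology X V) W f"
  unfolding continuous_map_def
proof (intro conjI allI impI)
  have VX: "V \<subseteq> topspace X" using V openin_subset by blast
  show "f \<in> topspace (subtopology X V) \<rightarrow> topspace W"
  proof (rule Pi_I)
    fix p assume p: "p \<in> topspace (subtopology X V)"
    then obtain x t where xt: "x \<in> Q" "t \<in> coord_box (D x)" "p = ch x t" using VX by (auto elim: point_cases)
    have t: "t \<in> topspace (top_of_set {t \<in> coord_box (D x). ch x t \<in> V})" using p xt by simp
    from subsetD[OF continuous_map_image_subset_topspace[OF f[OF xt(1)]] imageI[OF t]]
    show "f p \<in> topspace W" using xt by simp
  qed
  fix O' assume O': "openin W O'"
  have "openin X {p \<in> V. f p \<in> O'}"
  proof (rule open_crit)
    fix x assume x: "x \<in> Q"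
    have "openin (top_of_set {t \<in> coord_box (D x). ch x t \<in> V}) {t \<in> topspace (top_of_set {t \<in> coord_box (D x). ch x t \<in> V}). f (ch x t) \<in> O'}"
      by (rule openin_continuous_map_preimage[OF f[OF x] O'])
    moreover have "openin (top_of_set (coord_box (D x))) {t \<in> coord_box (D x). ch x t \<in> V}"
      using openin_continuous_map_preimage[OF chi_cont[OF x] V] by simp
    ultimately have "openin (top_of_set (coord_box (D x))) {t \<in> topspace (top_of_set {t \<in> coord_box (D x). ch x t \<in> V}). f (ch x t) \<in> O'}"
      by (rule openin_trans)
    moreover have "{t \<in> topspace (top_of_set {t \<in> coord_box (D x). ch x t \<in> V}). f (ch x t) \<in> O'} = {t \<in> coord_box (D x). ch x t \<in> {p \<in> V. f p \<in> O'}}"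
      by auto
    ultimately show "openin (top_of_set (coord_box (D x))) {t \<in> coord_box (D x). ch x t \<in> {p \<in> V. f p \<in> O'}}"
      by simp
  qed (use VX in auto)
  moreover have "{x \<in> topspace (subtopology X V). f x \<in> O'} = {p \<in> V. f p \<in> O'}"
    using VX by auto
  ultimately show "openin (subtopology X V) {x \<in> topspace (subtopology X V). f x \<in> O'}"
    using openin_open_subtopology[OF V] by auto
qed

end

lemma continuous_on_upd_coord: "continuous_on S (\<lambda>t :: nat \<Rightarrow> real. t(i := a))"
  by (intro continuous_on_upd continuous_on_id continuous_on_const)

text \<open>The last direction is singled out: \<open>Z\<close> collects the points whose height is 0 or 1 or that
  belong to cells without this direction, and \<open>Yset\<close> is the slice at height one half.\<close>

locale cubical_complex_Suc = cubical_complex "Suc k" X Q D F ch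
  for k :: nat and X :: "'x topology" and Q :: "'c set" and D :: "'c \<Rightarrow> nat set"
    and F :: "nat \<Rightarrow> nat \<Rightarrow> 'c \<Rightarrow> 'c" and ch :: "'c \<Rightarrow> (nat \<Rightarrow> real) \<Rightarrow> 'x"
begin

definition flat :: "'c \<Rightarrow> (nat \<Rightarrow> real) \<Rightarrow> bool" where
  "flat x t \<longleftrightarrow> k \<notin> D x \<or> t k = 0 \<or> t k = 1"

lemma flat_face:
  assumes "x \<in> Q" "i \<in> D x" "l \<in> {0, 1}" "t i = real l"
  shows "flat x t = flat (F l i x) (t(i := 0))"
  using assms D_F[OF assms(1-3)] by (auto simp: flat_def)

text \<open>Being flat is compatible with faces and so is a property of points.\<close>

definition Z :: "'x set" where "Z = {p \<in> topspace X. desc flat p}"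

lemma Z_iff: "\<lbrakk>x \<in> Q; t \<in> coord_box (D x)\<rbrakk> \<Longrightarrow> ch x t \<in> Z \<longleftrightarrow> flat x t"
  using desc_eq[of flat x t] flat_face chi_top by (simp add: Z_def)

definition midheight :: "'c \<Rightarrow> (nat \<Rightarrow> real) \<Rightarrow> bool" where
  "midheight x t \<longleftrightarrow> k \<in> D x \<and> t k = 1/2"

definition Yset :: "'x set" where "Yset = {p \<in> topspace X. desc midheight p}"

lemma Yset_iff: "\<lbrakk>x \<in> Q; t \<in> coord_box (D x)\<rbrakk> \<Longrightarrow> ch x t \<in> Yset \<longleftrightarrow> midheight x t"
proof -
  assume x: "x \<in> Q" "t \<in> coord_box (D x)"
  have "midheight x t = midheight (F l i x) (t(i := 0))"
    if "x \<in> Q" "i \<in> D x" "l \<in> {0, 1}" "t i = real l" for x i l t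
  proof (cases "i = k")
    case True
    have "t k \<noteq> 1/2" using that(3,4) True by auto
    then show ?thesis using D_F[OF that(1-3)] True by (simp add: midheight_def)
  next
    case False
    then show ?thesis using D_F[OF that(1-3)] by (simp add: midheight_def)
  qed
  then show ?thesis
    using desc_eq[of midheight x t] x chi_top by (simp add: Yset_def)
qed

lemma closed_slice:
  assumes "closed K"
  shows "closed {t \<in> coord_box E. t i = a \<and> t(i := 0) \<in> K}"
proof -
  have cl: "closed ((\<lambda>t. t(i := 0)) -` K)"
    by (rule closed_vimage[OF assms continuous_on_upd_coord])
  have eq: "{t \<in> coord_box E. t i = a \<and> t(i := 0) \<in> K} = coord_box E \<inter> {t. t i \<in> {a}} \<inter> ((\<lambda>t. t(i := 0)) -` K)"
    by auto
  show ?thesis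
    unfolding eq by (intro closed_Int closed_box closed_coord closed_singleton cl)
qed

text \<open>The flat points are those of the cells without direction \<open>k\<close>: in the other cells the flat points
  lie in the two faces in direction \<open>k\<close>.\<close>

lemma Z_complex: "cubical_complex k (subtopology X Z) {x \<in> Q. k \<notin> D x} D F ch"
proof
  have in_Z: "ch x t \<in> Z" if "x \<in> Q" "k \<notin> D x" "t \<in> coord_box (D x)" for x t
    using Z_iff[OF that(1,3)] that(2) by (simp add: flat_def)
  show "D x \<subseteq> {..<k}" if "x \<in> {x \<in> Q. k \<notin> D x}" for x
    using D_sub[of x] that by (auto simp: less_Suc_eq)
  show "F l i x \<in> {x \<in> Q. k \<notin> D x}" if "x \<in> {x \<in> Q. k \<notin> D x}" "i \<in> D x" "l \<in> {0, 1}" for x i l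
    using F_Q[of x i l] D_F[of x i l] that by auto
  show "D (F l i x) = D x - {i}" if "x \<in> {x \<in> Q. k \<notin> D x}" "i \<in> D x" "l \<in> {0, 1}" for x i l
    using D_F[of x i l] that by auto
  show "continuous_map (top_of_set (coord_box (D x))) (subtopology X Z) (ch x)" if "x \<in> {x \<in> Q. k \<notin> D x}" for x
    using that by (intro continuous_map_into_subtopology chi_cont) (auto intro: in_Z)
  show "ch x t = ch (F l i x) (t(i := 0))"
    if "x \<in> {x \<in> Q. k \<notin> D x}" "i \<in> D x" "l \<in> {0, 1}" "t \<in> coord_box (D x)" "t i = real l" for x i l t
    using chi_face[of x i l t] that by auto
  show "\<exists>x\<in>{x \<in> Q. k \<notin> D x}. \<exists>t\<in>open_coord_box (D x). p = ch x t" if "p \<in> topspace (subtopology X Z)" for p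
  proof -
    have "p \<in> topspace X" using that by simp
    then obtain x t where xt: "x \<in> Q" "t \<in> open_coord_box (D x)" "t \<in> coord_box (D x)" "p = ch x t" by (rule point_cases)
    have "flat x t" using that xt Z_iff by simp
    then have "k \<notin> D x" using xt(2) by (auto simp: flat_def open_coord_box_def)
    then show ?thesis using xt by blast
  qed
  show "x = y \<and> s = t" if "x \<in> {x \<in> Q. k \<notin> D x}" "y \<in> {x \<in> Q. k \<notin> D x}" "s \<in> open_coord_box (D x)" "t \<in> open_coord_box (D y)" "ch x s = ch y t" for x y s t
    using cells_inj[of x y s t] that by auto
  show "closedin (subtopology X Z) C"
    if C: "C \<subseteq> topspace (subtopology X Z)" and cl: "\<And>x. x \<in> {x \<in> Q. k \<notin> D x} \<Longrightarrow> closed {t \<in> coord_box (D x). ch x t \<in> C}" for C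
  proof -
    have "closedin X C"
    proof (rule closed_crit)
      show "C \<subseteq> topspace X" using C by auto
      fix x assume x: "x \<in> Q"
      show "closed {t \<in> coord_box (D x). ch x t \<in> C}"
      proof (cases "k \<in> D x")
        case True
        define K where "K l = {t \<in> coord_box (D (F l k x)). ch (F l k x) t \<in> C}" for l :: nat
        have K: "closed (K l)" if "l \<in> {0, 1}" for l
          unfolding K_def by (rule cl) (use F_Q[OF x True that] D_F[OF x True that] in auto)
        have face: "ch x t \<in> C \<longleftrightarrow> t(k := 0) \<in> K l" if "t \<in> coord_box (D x)" "t k = real l" "l \<in> {0, 1}" for t l
          using chi_face[OF x True that(3,1,2)] box_upd_remove[OF that(1), of k] D_F[OF x True that(3)] by (simp add: K_def)
        have flat: "t k = 0 \<or> t k = 1" if "t \<in> coord_box (D x)" "ch x t \<in> C" for t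
        proof -
          have "ch x t \<in> Z" using C that(2) by auto
          then have "flat x t" using Z_iff[OF x that(1)] by simp
          then show ?thesis using True by (simp add: flat_def)
        qed
        have "{t \<in> coord_box (D x). ch x t \<in> C} = {t \<in> coord_box (D x). t k = real 0 \<and> t(k := 0) \<in> K 0} \<union> {t \<in> coord_box (D x). t k = real 1 \<and> t(k := 0) \<in> K 1}"
        proof (rule subset_antisym; rule subsetI)
          fix t assume t: "t \<in> {t \<in> coord_box (D x). ch x t \<in> C}"
          then consider "t k = real 0" | "t k = real 1" using flat[of t] by force
          then show "t \<in> {t \<in> coord_box (D x). t k = real 0 \<and> t(k := 0) \<in> K 0} \<union> {t \<in> coord_box (D x). t k = real 1 \<and> t(k := 0) \<in> K 1}"
            using t face[of t 0] face[of t 1] by cases auto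
        next
          fix t assume t: "t \<in> {t \<in> coord_box (D x). t k = real 0 \<and> t(k := 0) \<in> K 0} \<union> {t \<in> coord_box (D x). t k = real 1 \<and> t(k := 0) \<in> K 1}"
          then show "t \<in> {t \<in> coord_box (D x). ch x t \<in> C}"
            using face[of t 0] face[of t 1] by auto
        qed
        then show ?thesis
          using closed_slice[OF K[of 0], of "D x" k "real 0"] closed_slice[OF K[of 1], of "D x" k "real 1"] by (simp add: closed_Un)
      qed (use cl x in simp)
    qed
    then show ?thesis
      using C by (simp add: closedin_subset_topspace)
  qed
qed

abbreviation "Y \<equiv> subtopology X Yset"
abbreviation "chiY \<equiv> \<lambda>x t. ch x (t(k := 1/2))"

lemma open_box_Diff:
  assumes "k \<in> D x" shows "t \<in> open_coord_box (D x - {k}) \<Longrightarrow> 0 < u \<Longrightarrow> u < 1 \<Longrightarrow> t(k := u) \<in> open_coord_box (D x)"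
    and "t \<in> open_coord_box (D x) \<Longrightarrow> t(k := 0) \<in> open_coord_box (D x - {k})"
  using assms by (auto simp: open_coord_box_def)

lemma chi_upd_cont:
  assumes "x \<in> Q" "k \<in> D x" "continuous_on S f" "continuous_on S u" "\<And>s. s \<in> S \<Longrightarrow> f s \<in> coord_box (D x - {k})" "\<And>s. s \<in> S \<Longrightarrow> u s \<in> {0..1}"
  shows "continuous_map (top_of_set S) X (\<lambda>s. ch x ((f s)(k := u s)))"
proof -
  have "continuous_map (top_of_set S) (top_of_set (coord_box (D x))) (\<lambda>s. (f s)(k := u s))"
    using assms by (auto intro!: continuous_on_upd box_upd_insert)
  from continuous_map_compose[OF this chi_cont[OF assms(1)]] show ?thesis
    by (simp add: o_def)
qed

lemma chiY_in: "\<lbrakk>x \<in> Q; k \<in> D x; t \<in> coord_box (D x - {k})\<rbrakk> \<Longrightarrow> chiY x t \<in> Yset"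
  using Yset_iff[of x "t(k := 1/2)"] box_upd_insert[of t "D x" k "1/2"] by (simp add: midheight_def)

lemma Y_complex: "cubical_complex k Y {x \<in> Q. k \<in> D x} (\<lambda>x. D x - {k}) F chiY"
proof
  show "D x - {k} \<subseteq> {..<k}" if "x \<in> {x \<in> Q. k \<in> D x}" for x
    using D_sub[of x] that by (auto simp: less_Suc_eq)
  show "F l i x \<in> {x \<in> Q. k \<in> D x}" if "x \<in> {x \<in> Q. k \<in> D x}" "i \<in> D x - {k}" "l \<in> {0, 1}" for x i l
    using F_Q[of x i l] D_F[of x i l] that by auto
  show "D (F l i x) - {k} = D x - {k} - {i}" if "x \<in> {x \<in> Q. k \<in> D x}" "i \<in> D x - {k}" "l \<in> {0, 1}" for x i l
    using D_F[of x i l] that by auto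
  show "continuous_map (top_of_set (coord_box (D x - {k}))) Y (chiY x)" if x: "x \<in> {x \<in> Q. k \<in> D x}" for x
  proof (rule continuous_map_into_subtopology)
    show "continuous_map (top_of_set (coord_box (D x - {k}))) X (chiY x)"
      using x by (intro chi_upd_cont) auto
  qed (use x chiY_in in auto)
  show "chiY x t = chiY (F l i x) (t(i := 0))"
    if "x \<in> {x \<in> Q. k \<in> D x}" "i \<in> D x - {k}" "l \<in> {0, 1}" "t \<in> coord_box (D x - {k})" "t i = real l" for x i l t
  proof -
    have "t(k := 1/2) \<in> coord_box (D x)" using that by (intro box_upd_insert) auto
    then have "ch x (t(k := 1/2)) = ch (F l i x) ((t(k := 1/2))(i := 0))"
      using that by (intro chi_face) auto
    then show ?thesis using that(2) by (simp add: fun_upd_twist)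
  qed
  show "\<exists>x\<in>{x \<in> Q. k \<in> D x}. \<exists>t\<in>open_coord_box (D x - {k}). p = chiY x t" if "p \<in> topspace Y" for p
  proof -
    have "p \<in> topspace X" using that by simp
    then obtain x t where xt: "x \<in> Q" "t \<in> open_coord_box (D x)" "t \<in> coord_box (D x)" "p = ch x t" by (rule point_cases)
    have m: "midheight x t" using that xt Yset_iff by simp
    then have pe: "p = chiY x (t(k := 0))" using xt by (auto simp: midheight_def fun_upd_idem)
    have kD: "k \<in> D x" using m by (simp add: midheight_def)
    have mem: "t(k := 0) \<in> open_coord_box (D x - {k})" using xt(2) open_box_Diff(2)[OF kD] by blast
    have "\<exists>t\<in>open_coord_box (D x - {k}). p = chiY x t"
      by (rule bexI[of "\<lambda>t. p = chiY x t", OF pe mem])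
    then show ?thesis by (rule bexI) (use xt(1) kD in simp)
  qed
  show "x = y \<and> s = t" if "x \<in> {x \<in> Q. k \<in> D x}" "y \<in> {x \<in> Q. k \<in> D x}" "s \<in> open_coord_box (D x - {k})" "t \<in> open_coord_box (D y - {k})" "chiY x s = chiY y t" for x y s t
  proof -
    have "x = y \<and> s(k := 1/2) = t(k := 1/2)"
      by (rule cells_inj) (use that in \<open>auto intro!: open_box_Diff(1)\<close>)
    moreover have "s = (s(k := 1/2))(k := 0)" "t = (t(k := 1/2))(k := 0)"
      using that(3,4) by (auto simp: open_coord_box_def fun_eq_iff)
    ultimately show ?thesis by metis
  qed
  show "closedin Y C"
    if C: "C \<subseteq> topspace Y" and cl: "\<And>x. x \<in> {x \<in> Q. k \<in> D x} \<Longrightarrow> closed {t \<in> coord_box (D x - {k}). chiY x t \<in> C}" for C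
  proof -
    have "closedin X C"
    proof (rule closed_crit)
      show "C \<subseteq> topspace X" using C by auto
      fix x assume x: "x \<in> Q"
      have mid: "midheight x t" if "t \<in> coord_box (D x)" "ch x t \<in> C" for t
        using C that Yset_iff[OF x that(1)] by auto
      show "closed {t \<in> coord_box (D x). ch x t \<in> C}"
      proof (cases "k \<in> D x")
        case True
        define K where "K = {t \<in> coord_box (D x - {k}). chiY x t \<in> C}"
        have "closed K" unfolding K_def by (rule cl) (use x True in simp)
        moreover have "{t \<in> coord_box (D x). ch x t \<in> C} = {t \<in> coord_box (D x). t k = 1/2 \<and> t(k := 0) \<in> K}"
        proof (rule subset_antisym; rule subsetI)
          fix t assume "t \<in> {t \<in> coord_box (D x). ch x t \<in> C}"
          then have t: "t \<in> coord_box (D x)" "ch x t \<in> C" by auto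
          then have "t k = 1/2" using mid[OF t] by (simp add: midheight_def)
          moreover from this have "t(k := 1/2) = t" by (auto simp: fun_eq_iff)
          ultimately show "t \<in> {t \<in> coord_box (D x). t k = 1/2 \<and> t(k := 0) \<in> K}"
            using t box_upd_remove[OF t(1), of k] by (simp add: K_def)
        next
          fix t assume t: "t \<in> {t \<in> coord_box (D x). t k = 1/2 \<and> t(k := 0) \<in> K}"
          then have "t(k := 1/2) = t" by (auto simp: fun_eq_iff)
          then show "t \<in> {t \<in> coord_box (D x). ch x t \<in> C}" using t by (simp add: K_def)
        qed
        ultimately show ?thesis using closed_slice[of K "D x" k "1/2"] by simp
      next
        case False
        then have eq: "{t \<in> coord_box (D x). ch x t \<in> C} = {}" using mid by (auto simp: midheight_def)
        show ?thesis unfolding eq by (rule closed_empty)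
      qed
    qed
    then show ?thesis
      using C by (simp add: closedin_subset_topspace)
  qed
qed

end

section \<open>The last direction as an attached cylinder\<close>

context cubical_complex_Suc
begin

interpretation YC: cubical_complex k Y "{x \<in> Q. k \<in> D x}" "\<lambda>x. D x - {k}" F chiY
  by (rule Y_complex)

definition e :: "'x \<Rightarrow> real \<Rightarrow> 'x" where
  "e y u = YC.desc (\<lambda>x t. ch x (t(k := u))) y"

lemma e_eq:
  assumes x: "x \<in> Q" "k \<in> D x" "t \<in> coord_box (D x - {k})" and u: "0 \<le> u" "u \<le> 1"
  shows "e (chiY x t) u = ch x (t(k := u))"
  unfolding e_def
proof (rule YC.desc_eq)
  fix x i l t assume a: "x \<in> {x \<in> Q. k \<in> D x}" "i \<in> D x - {k}" "l \<in> {0, 1}" "t \<in> coord_box (D x - {k})" "t i = real l"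
  have "t(k := u) \<in> coord_box (D x)" using a u by (intro box_upd_insert) auto
  then have "ch x (t(k := u)) = ch (F l i x) ((t(k := u))(i := 0))"
    using a by (intro chi_face) auto
  then show "ch x (t(k := u)) = ch (F l i x) ((t(i := 0))(k := u))"
    using a(2) by (simp add: fun_upd_twist)
qed (use x in auto)

lemma nonflat:
  assumes "t \<in> coord_box (D x)" "\<not> flat x t"
  shows "k \<in> D x" "0 < t k" "t k < 1" "t(k := 0) \<in> coord_box (D x - {k})"
proof -
  show "k \<in> D x" using assms(2) by (simp add: flat_def)
  have "t k \<noteq> 0" "t k \<noteq> 1" using assms(2) by (auto simp: flat_def)
  then show "0 < t k" "t k < 1" using box_coord[OF assms(1), of k] by auto
  show "t(k := 0) \<in> coord_box (D x - {k})" by (rule box_upd_remove[OF assms(1)])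
qed

text \<open>On flat points, where the cylinder has no base point, the value is the same for all points, as is
  required for compatibility with faces.\<close>

definition p :: "'x \<Rightarrow> 'x" where
  "p = desc (\<lambda>x t. if flat x t then undefined else chiY x t)"

definition hh :: "'x \<Rightarrow> real" where
  "hh = desc (\<lambda>x t. if flat x t then 0 else t k)"

definition squash :: "real \<Rightarrow> real \<Rightarrow> real" where
  "squash s u = (1 - s) * u + s * stretch u"

text \<open>The straight-line homotopy from the identity to \<open>stretch\<close>, applied to the last coordinate; it fixes
  the endpoints and hence is compatible with faces.\<close>

definition g :: "'x \<Rightarrow> real \<Rightarrow> 'x" where
  "g v s = desc (\<lambda>x t. ch x (if k \<in> D x then t(k := squash s (t k)) else t)) v"

lemma flat_end: "\<lbrakk>l \<in> {0, 1}; t k = real l\<rbrakk> \<Longrightarrow> flat x t"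
  by (auto simp: flat_def)

lemma p_eq:
  assumes x: "x \<in> Q" "t \<in> coord_box (D x)" "\<not> flat x t" shows "p (ch x t) = chiY x t"
proof -
  have "desc (\<lambda>x t. if flat x t then undefined else chiY x t) (ch x t) = (if flat x t then undefined else chiY x t)"
  proof (rule desc_eq)
    fix x i l t assume a: "x \<in> Q" "i \<in> D x" "l \<in> {0, 1}" "t \<in> coord_box (D x)" "t i = real l"
    show "(if flat x t then undefined else chiY x t) = (if flat (F l i x) (t(i := 0)) then undefined else chiY (F l i x) (t(i := 0)))"
    proof (cases "flat x t")
      case False
      then have ik: "i \<noteq> k" using flat_end[of l t x] a(3,5) False by auto
      have "t(k := 1/2) \<in> coord_box (D x)" using nonflat(1)[OF a(4) False] a(4) by (intro box_upd) auto
      then have "ch x (t(k := 1/2)) = ch (F l i x) ((t(k := 1/2))(i := 0))"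
        using a ik by (intro chi_face) auto
      then show ?thesis using False flat_face[of x i l t, OF a(1-3,5)] ik by (simp add: fun_upd_twist)
    qed (use flat_face[of x i l t, OF a(1-3,5)] in simp)
  qed (use x in auto)
  then show ?thesis using x by (simp add: p_def)
qed

lemma hh_eq:
  assumes x: "x \<in> Q" "t \<in> coord_box (D x)" "\<not> flat x t" shows "hh (ch x t) = t k"
proof -
  have "desc (\<lambda>x t. if flat x t then 0 else t k) (ch x t) = (if flat x t then 0 else t k)"
  proof (rule desc_eq)
    fix x i l t assume a: "x \<in> Q" "i \<in> D x" "l \<in> {0, 1}" "t \<in> coord_box (D x)" "t i = real l"
    show "(if flat x t then 0 else t k) = (if flat (F l i x) (t(i := 0)) then 0 else (t(i := 0)) k)"
    proof (cases "flat x t")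
      case False
      then have ik: "i \<noteq> k" using flat_end[of l t x] a(3,5) False by auto
      then show ?thesis using False flat_face[of x i l t, OF a(1-3,5)] by simp
    qed (use flat_face[of x i l t, OF a(1-3,5)] in simp)
  qed (use x in auto)
  then show ?thesis using x by (simp add: hh_def)
qed

lemma squash_range: "\<lbrakk>0 \<le> s; s \<le> 1; 0 \<le> u; u \<le> 1\<rbrakk> \<Longrightarrow> 0 \<le> squash s u \<and> squash s u \<le> 1"
  unfolding squash_def using stretch_range[of u] convex_bound_le[of u 1 "stretch u" "1 - s" s] by simp

lemma squash_ends: "l \<in> {0, 1} \<Longrightarrow> squash s (real l) = real l"
  by (auto simp: squash_def)

lemma g_eq:
  assumes x: "x \<in> Q" "t \<in> coord_box (D x)" and s: "0 \<le> s" "s \<le> 1"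
  shows "g (ch x t) s = ch x (if k \<in> D x then t(k := squash s (t k)) else t)"
  unfolding g_def
proof (rule desc_eq)
  fix x i l t assume a: "x \<in> Q" "i \<in> D x" "l \<in> {0, 1}" "t \<in> coord_box (D x)" "t i = real l"
  show "ch x (if k \<in> D x then t(k := squash s (t k)) else t)
    = ch (F l i x) (if k \<in> D (F l i x) then (t(i := 0))(k := squash s ((t(i := 0)) k)) else t(i := 0))"
  proof (cases "k \<in> D x")
    case kD: True
    have mem: "t(k := squash s (t k)) \<in> coord_box (D x)"
      using squash_range[OF s] box_coord[OF a(4), of k] by (intro box_upd[OF a(4) kD]) auto
    show ?thesis
    proof (cases "i = k")
      case True
      then have "(t(k := squash s (t k))) i = real l" using a(5) squash_ends[OF a(3)] by simp
      from chi_face[of x i l "t(k := squash s (t k))", OF a(1-3) mem this] show ?thesis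
        using D_F[OF a(1-3)] kD True by simp
    next
      case False
      then have "(t(k := squash s (t k))) i = real l" using a(5) by simp
      from chi_face[of x i l "t(k := squash s (t k))", OF a(1-3) mem this] show ?thesis
        using D_F[OF a(1-3)] kD False by (simp add: fun_upd_twist)
    qed
  next
    case False
    then show ?thesis using chi_face[of x i l t, OF a] D_F[OF a(1-3)] by simp
  qed
qed (use x in auto)

lemma squash_cont: "continuous_on S (\<lambda>(u, s). squash s u)"
proof -
  have "continuous_on S (\<lambda>p. stretch (fst p))"
    by (rule continuous_on_compose2[OF stretch_cont continuous_on_fst]) (auto intro: continuous_on_id)
  then show ?thesis
    unfolding squash_def case_prod_unfold by (intro continuous_intros)
qed

lemma openin_coord_box: "open S \<Longrightarrow> openin (top_of_set (coord_box E)) {t \<in> coord_box E. t \<in> S}"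
  by (auto simp: openin_open)

lemma last_direction_cylinder: "attached_cylinder X Z Y e p hh g"
proof
  have Z_sub: "Z \<subseteq> topspace X" by (simp add: Z_def)
  have mem_V: "ch x t \<in> topspace X - Z \<longleftrightarrow> \<not> flat x t" if "x \<in> Q" "t \<in> coord_box (D x)" for x t
    using Z_iff[OF that] chi_top[OF that] by simp
  show Zc: "closedin X Z"
  proof (rule closed_crit[OF Z_sub])
    fix x assume x: "x \<in> Q"
    have eq: "{t \<in> coord_box (D x). ch x t \<in> Z} = (if k \<in> D x then coord_box (D x) \<inter> {t. t k \<in> {0, 1}} else coord_box (D x))"
      using Z_iff[OF x] by (auto simp: flat_def)
    show "closed {t \<in> coord_box (D x). ch x t \<in> Z}"
      unfolding eq by (auto intro!: closed_Int closed_box closed_coord simp del: insert_iff)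
  qed
  have Vo: "openin X (topspace X - Z)" using Zc by blast
  show "continuous_map (prod_topology Y (top_of_set {0..1})) X (\<lambda>(y, u). e y u)"
  proof (rule YC.continuous_prod_cells)
    fix x assume x: "x \<in> {x \<in> Q. k \<in> D x}"
    have "continuous_map (top_of_set (coord_box (D x - {k}) \<times> {0..1})) X (\<lambda>q. ch x ((fst q)(k := snd q)))"
      by (rule chi_upd_cont) (use x in \<open>auto intro!: continuous_on_fst continuous_on_snd continuous_on_id\<close>)
    then show "continuous_map (top_of_set (coord_box (D x - {k}) \<times> {0..1})) X (\<lambda>(t, s). case (chiY x t, s) of (y, u) \<Rightarrow> e y u)"
      by (rule continuous_map_eq) (use x in \<open>auto simp: e_eq\<close>)
  qed
  have Ypt: "\<exists>x\<in>Q. \<exists>t\<in>coord_box (D x - {k}). k \<in> D x \<and> y = chiY x t" if "y \<in> topspace Y" for y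
    using YC.cells_cover[OF that] open_box_sub by blast
  show "e y 0 \<in> Z" "e y 1 \<in> Z" if "y \<in> topspace Y" for y
  proof -
    obtain x t where xt: "x \<in> Q" "t \<in> coord_box (D x - {k})" "k \<in> D x" "y = chiY x t" using Ypt[OF \<open>y \<in> topspace Y\<close>] by blast
    have "ch x (t(k := u)) \<in> Z" if "u = 0 \<or> u = 1" for u
      using Z_iff[OF xt(1) box_upd_insert[OF xt(2,3), of u]] that by (auto simp: flat_def)
    then show "e y 0 \<in> Z" "e y 1 \<in> Z" using xt by (simp_all add: e_eq)
  qed
  have S: "{t \<in> coord_box (D x). ch x t \<in> topspace X - Z} = {t \<in> coord_box (D x). \<not> flat x t}" if "x \<in> Q" for x
    using mem_V[OF that] by blast
  have p_cont: "continuous_map (top_of_set {t \<in> coord_box (D x). \<not> flat x t}) Y (\<lambda>t. p (ch x t))" if x: "x \<in> Q" for x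
  proof (cases "k \<in> D x")
    case True
    have inX: "continuous_map (top_of_set {t \<in> coord_box (D x). \<not> flat x t}) X (\<lambda>t. chiY x (t(k := 0)))"
      by (rule chi_upd_cont[OF x True]) (auto intro!: continuous_on_upd_coord box_upd_remove)
    have inY: "chiY x (t(k := 0)) \<in> Yset" if "t \<in> coord_box (D x)" for t
      by (rule chiY_in[OF x True box_upd_remove[OF that]])
    have "continuous_map (top_of_set {t \<in> coord_box (D x). \<not> flat x t}) Y (\<lambda>t. chiY x (t(k := 0)))"
      by (rule continuous_map_into_subtopology[OF inX]) (rule Pi_I, rule inY, simp)
    then show ?thesis
      by (rule continuous_map_eq) (simp add: p_eq[OF x])
  next
    case False
    then have eq: "{t \<in> coord_box (D x). \<not> flat x t} = {}"
      by (auto simp: flat_def)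
    show ?thesis unfolding eq by (simp add: continuous_map_def)
  qed
  show "continuous_map (subtopology X (topspace X - Z)) Y p"
    by (rule continuous_open_cells[OF Vo]) (simp only: S p_cont)
  show "continuous_map (subtopology X (topspace X - Z)) euclideanreal hh"
  proof (rule continuous_open_cells[OF Vo])
    fix x assume x: "x \<in> Q"
    have "continuous_map (top_of_set {t \<in> coord_box (D x). \<not> flat x t}) euclideanreal (\<lambda>t. t k)"
      by (simp add: continuous_on_coord)
    then have "continuous_map (top_of_set {t \<in> coord_box (D x). \<not> flat x t}) euclideanreal (\<lambda>t. hh (ch x t))"
      by (rule continuous_map_eq) (simp add: hh_eq[OF x])
    then show "continuous_map (top_of_set {t \<in> coord_box (D x). ch x t \<in> topspace X - Z}) euclideanreal (\<lambda>t. hh (ch x t))"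
      by (simp only: S[OF x])
  qed
  have Vpt: "\<exists>x\<in>Q. \<exists>t\<in>coord_box (D x). \<not> flat x t \<and> v = ch x t" if "v \<in> topspace X - Z" for v
  proof -
    obtain x t where "x \<in> Q" "t \<in> coord_box (D x)" "v = ch x t" using \<open>v \<in> topspace X - Z\<close> by (blast elim: point_cases)
    then show ?thesis using mem_V[of x t] that by blast
  qed
  show "0 < hh v" "hh v < 1" "e (p v) (hh v) = v" if "v \<in> topspace X - Z" for v
  proof -
    obtain x t where xt: "x \<in> Q" "t \<in> coord_box (D x)" "\<not> flat x t" "v = ch x t" using Vpt[OF \<open>v \<in> topspace X - Z\<close>] by blast
    note nf = nonflat[OF xt(2,3)]
    show "0 < hh v" "hh v < 1" using hh_eq[OF xt(1-3)] nf xt(4) by simp_all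
    have "e (chiY x (t(k := 0))) (t k) = ch x ((t(k := 0))(k := t k))"
      by (rule e_eq[OF xt(1) nf(1,4)]) (use nf in simp_all)
    then show "e (p v) (hh v) = v" using hh_eq[OF xt(1-3)] p_eq[OF xt(1-3)] xt(4) by simp
  qed
  have inner: "e y u \<notin> Z \<and> p (e y u) = y \<and> hh (e y u) = u" if yu: "y \<in> topspace Y" "0 < u" "u < 1" for y u
  proof -
    obtain x t where xt: "x \<in> Q" "t \<in> coord_box (D x - {k})" "k \<in> D x" "y = chiY x t" using Ypt[OF yu(1)] by blast
    have mem: "t(k := u) \<in> coord_box (D x)" using box_upd_insert[OF xt(2,3)] yu by simp
    have nf: "\<not> flat x (t(k := u))" using yu xt(3) by (simp add: flat_def)
    have "e y u = ch x (t(k := u))" using e_eq[OF xt(1,3,2)] xt(4) yu by simp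
    then show ?thesis using Z_iff[OF xt(1) mem] nf p_eq[OF xt(1) mem nf] hh_eq[OF xt(1) mem nf] xt(4) by simp
  qed
  show "e y u \<notin> Z" "p (e y u) = y" "hh (e y u) = u" if "y \<in> topspace Y" "0 < u" "u < 1" for y u
    using inner[OF that] by blast+
  show "openin X (Z \<union> {x \<in> topspace X - Z. hh x < 1/3 \<or> 2/3 < hh x})"
  proof (rule open_crit)
    fix x assume x: "x \<in> Q"
    have eq: "{t \<in> coord_box (D x). ch x t \<in> Z \<union> {x \<in> topspace X - Z. hh x < 1/3 \<or> 2/3 < hh x}}
      = {t \<in> coord_box (D x). t \<in> (if k \<in> D x then {t. t k < 1/3} \<union> {t. 2/3 < t k} else UNIV)}"
    proof (rule Collect_cong, rule conj_cong[OF refl])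
      fix t assume t: "t \<in> coord_box (D x)"
      show "(ch x t \<in> Z \<union> {x \<in> topspace X - Z. hh x < 1/3 \<or> 2/3 < hh x})
         = (t \<in> (if k \<in> D x then {t. t k < 1/3} \<union> {t. 2/3 < t k} else UNIV))"
      proof (cases "flat x t")
        case True
        then show ?thesis using Z_iff[OF x t] by (auto simp: flat_def)
      next
        case False
        then show ?thesis using Z_iff[OF x t] mem_V[OF x t] hh_eq[OF x t False] nonflat(1)[OF t False] by simp
      qed
    qed
    have o1: "open {t :: nat \<Rightarrow> real. t k < 1/3}" and o2: "open {t :: nat \<Rightarrow> real. 2/3 < t k}"
      by (rule open_Collect_less[OF continuous_on_coord continuous_on_const])
        (rule open_Collect_less[OF continuous_on_const continuous_on_coord])
    have "open (if k \<in> D x then {t :: nat \<Rightarrow> real. t k < 1/3} \<union> {t. 2/3 < t k} else UNIV)"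
      by (cases "k \<in> D x") (simp_all only: if_True if_False open_Un[OF o1 o2] open_UNIV simp_thms)
    then show "openin (top_of_set (coord_box (D x))) {t \<in> coord_box (D x). ch x t \<in> Z \<union> {x \<in> topspace X - Z. hh x < 1/3 \<or> 2/3 < hh x}}"
      unfolding eq by (rule openin_coord_box)
  qed (use Z_sub in auto)
  show "continuous_map (prod_topology X (top_of_set {0..1})) X (\<lambda>(x, s). g x s)"
  proof (rule continuous_prod_cells)
    fix x assume x: "x \<in> Q"
    have "continuous_map (top_of_set (coord_box (D x) \<times> {0..1})) (top_of_set (coord_box (D x)))
        (\<lambda>q. if k \<in> D x then (fst q)(k := squash (snd q) (fst q k)) else fst q)"
    proof (cases "k \<in> D x")
      case True
      have "continuous_on (coord_box (D x) \<times> {0..1}) (\<lambda>q. (fst q)(k := squash (snd q) (fst q k)))"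
      proof (intro continuous_on_upd)
        have "continuous_on (coord_box (D x) \<times> {0..1::real}) (\<lambda>q. (fst q k, snd q))"
          by (intro continuous_on_Pair continuous_on_product_then_coordinatewise[OF continuous_on_fst] continuous_on_snd continuous_on_id)
        from continuous_on_compose2[OF squash_cont[of UNIV] this]
        show "continuous_on (coord_box (D x) \<times> {0..1}) (\<lambda>q. squash (snd q) (fst q k))" by simp
      qed (intro continuous_on_fst continuous_on_id)
      moreover have "(fst q)(k := squash (snd q) (fst q k)) \<in> coord_box (D x)" if "q \<in> coord_box (D x) \<times> {0..1}" for q
        using that squash_range[of "snd q" "fst q k"] box_coord[of "fst q" "D x" k] by (intro box_upd True) auto
      ultimately show ?thesis using True by auto
    next
      case False
      then show ?thesis by (auto intro!: continuous_on_fst continuous_on_id)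
    qed
    from continuous_map_compose[OF this chi_cont[OF x]]
    have "continuous_map (top_of_set (coord_box (D x) \<times> {0..1})) X
        (\<lambda>q. ch x (if k \<in> D x then (fst q)(k := squash (snd q) (fst q k)) else fst q))"
      by (simp only: o_def)
    then show "continuous_map (top_of_set (coord_box (D x) \<times> {0..1})) X (\<lambda>(t, s). case (ch x t, s) of (x, s) \<Rightarrow> g x s)"
      by (rule continuous_map_eq) (use g_eq[OF x] in auto)
  qed
  show "g v 0 = v" if "v \<in> topspace X" for v
  proof -
    obtain x t where "x \<in> Q" "t \<in> coord_box (D x)" "v = ch x t" using \<open>v \<in> topspace X\<close> by (blast elim: point_cases)
    then show ?thesis using g_eq[of x t 0] by (simp add: squash_def)
  qed
  show "g v s = v" if v: "v \<in> Z" "s \<in> {0..1}" for v s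
  proof -
    have "v \<in> topspace X" using v Z_sub by blast
    then obtain x t where xt: "x \<in> Q" "t \<in> coord_box (D x)" "v = ch x t" by (blast elim: point_cases)
    have fl: "flat x t" using Z_iff[OF xt(1,2)] xt(3) v(1) by simp
    have "squash s (t k) = t k" if "k \<in> D x"
      using fl that squash_ends[of 0 s] squash_ends[of 1 s] by (auto simp: flat_def)
    then show ?thesis using g_eq[OF xt(1,2), of s] v(2) xt(3) by simp
  qed
  show "g (e y u) 1 = e y (stretch u)" if yu: "y \<in> topspace Y" "u \<in> {0..1}" for y u
  proof -
    obtain x t where xt: "x \<in> Q" "t \<in> coord_box (D x - {k})" "k \<in> D x" "y = chiY x t" using Ypt[OF yu(1)] by blast
    have mem: "t(k := u) \<in> coord_box (D x)" using box_upd_insert[OF xt(2,3)] yu by simp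
    have "e y u = ch x (t(k := u))" using e_eq[OF xt(1,3,2)] xt(4) yu by simp
    moreover have "e y (stretch u) = ch x (t(k := stretch u))"
      using e_eq[OF xt(1,3,2)] xt(4) stretch_range[of u] by simp
    ultimately show ?thesis using g_eq[OF xt(1) mem, of 1] xt(3) by (simp add: squash_def)
  qed
qed

end

section \<open>Cellular chains\<close>

definition rank :: "nat set \<Rightarrow> nat \<Rightarrow> nat" where
  "rank E i = card {j \<in> E. j < i}"

text \<open>The \<open>r\<close>-cube as the box with sides \<open>E\<close>, in increasing order of the directions.\<close>

definition emb :: "nat set \<Rightarrow> (nat \<Rightarrow> real) \<Rightarrow> nat \<Rightarrow> real" where
  "emb E t = (\<lambda>i. if i \<in> E then t (rank E i) else 0)"

lemma rank_less_card: "\<lbrakk>finite E; i \<in> E\<rbrakk> \<Longrightarrow> rank E i < card E"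
  unfolding rank_def by (rule psubset_card_mono) auto

lemma rank_mono: "\<lbrakk>finite E; i \<in> E; i < j\<rbrakk> \<Longrightarrow> rank E i < rank E j"
  unfolding rank_def by (rule psubset_card_mono) auto

lemma rank_inj: "finite E \<Longrightarrow> inj_on (rank E) E"
proof (rule inj_onI)
  fix i j assume "finite E" "i \<in> E" "j \<in> E" "rank E i = rank E j"
  then show "i = j" using rank_mono[of E i j] rank_mono[of E j i] by (cases i j rule: linorder_cases) auto
qed

lemma rank_bij: assumes "finite E" shows "bij_betw (rank E) E {..<card E}"
proof -
  have "rank E ` E = {..<card E}"
    by (rule card_subset_eq) (use assms rank_less_card in \<open>auto simp: card_image rank_inj\<close>)
  then show ?thesis using rank_inj[OF assms] by (simp add: bij_betw_def)
qed

lemma rank_remove_below: "j \<le> i \<Longrightarrow> rank (E - {i}) j = rank E j"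
  unfolding rank_def by (rule arg_cong[where f=card]) auto

lemma rank_remove_above:
  assumes "finite E" "i \<in> E" "i < j" shows "rank E j = Suc (rank (E - {i}) j)"
proof -
  have "{l \<in> E. l < j} = insert i {l \<in> E - {i}. l < j}" using assms by auto
  then show ?thesis using assms(1) by (simp add: rank_def)
qed

lemma emb_box: "\<lbrakk>finite E; t \<in> unit_cube (card E)\<rbrakk> \<Longrightarrow> emb E t \<in> coord_box E"
  using unit_cube_coord by (auto simp: coord_box_def emb_def)

lemma emb_cont: "continuous_on S (emb E)"
proof (rule continuous_on_coordinatewise_then_product)
  fix i show "continuous_on S (\<lambda>t. emb E t i)"
    unfolding emb_def by (cases "i \<in> E") (auto intro: continuous_on_coord)
qed

lemma emb_insert_coord:
  assumes "finite E" "i \<in> E"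
  shows "emb E (insert_coord (rank E i) a t) i = a" "(emb E (insert_coord (rank E i) a t))(i := 0) = emb (E - {i}) t"
proof -
  show "emb E (insert_coord (rank E i) a t) i = a"
    using assms by (simp add: emb_def insert_coord_def)
  show "(emb E (insert_coord (rank E i) a t))(i := 0) = emb (E - {i}) t"
  proof (rule ext)
    fix j
    consider "j = i" | "j \<notin> E" | "j \<in> E" "j < i" | "j \<in> E" "i < j" by force
    then show "((emb E (insert_coord (rank E i) a t))(i := 0)) j = emb (E - {i}) t j"
    proof cases
      case 3
      then show ?thesis using rank_mono[OF assms(1) 3] by (simp add: emb_def insert_coord_def rank_remove_below)
    next
      case 4
      then show ?thesis using rank_mono[OF assms 4(2)] rank_remove_above[OF assms 4(2)]
        by (simp add: emb_def insert_coord_def)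
    qed (auto simp: emb_def)
  qed
qed

definition cell_cube :: "('c \<Rightarrow> nat set) \<Rightarrow> ('c \<Rightarrow> (nat \<Rightarrow> real) \<Rightarrow> 'x) \<Rightarrow> 'c \<Rightarrow> (nat \<Rightarrow> real) \<Rightarrow> 'x" where
  "cell_cube D ch x = restrict (\<lambda>t. ch x (emb (D x) t)) (unit_cube (card (D x)))"

definition cellc :: "('c \<Rightarrow> nat set) \<Rightarrow> ('c \<Rightarrow> (nat \<Rightarrow> real) \<Rightarrow> 'x) \<Rightarrow> ('c \<Rightarrow>\<^sub>0 int) \<Rightarrow> 'x cube_chain" where
  "cellc D ch = frag_extend (\<lambda>x. frag_of (cell_cube D ch x))"

text \<open>The position of a direction among the directions of the cell determines the sign.\<close>

definition kbd :: "('c \<Rightarrow> nat set) \<Rightarrow> (nat \<Rightarrow> nat \<Rightarrow> 'c \<Rightarrow> 'c) \<Rightarrow> ('c \<Rightarrow>\<^sub>0 int) \<Rightarrow> ('c \<Rightarrow>\<^sub>0 int)" where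
  "kbd D F = frag_extend (\<lambda>x. \<Sum>i\<in>D x. frag_cmul ((-1) ^ Suc (rank (D x) i)) (frag_of (F 0 i x) - frag_of (F 1 i x)))"

lemma cellc_0 [simp]: "cellc D ch 0 = 0"
  and cellc_of [simp]: "cellc D ch (frag_of x) = frag_of (cell_cube D ch x)"
  and cellc_diff: "cellc D ch (a - b) = cellc D ch a - cellc D ch b"
  and cellc_add: "cellc D ch (a + b) = cellc D ch a + cellc D ch b"
  and cellc_cmul: "cellc D ch (frag_cmul n a) = frag_cmul n (cellc D ch a)"
  and cellc_sum: "cellc D ch (\<Sum>i\<in>I. f i) = (\<Sum>i\<in>I. cellc D ch (f i))"
  by (simp_all add: cellc_def frag_extend_diff frag_extend_add frag_extend_cmul frag_extend_sum')

lemma kbd_0 [simp]: "kbd D F 0 = 0"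
  and kbd_diff: "kbd D F (a - b) = kbd D F a - kbd D F b"
  and kbd_add: "kbd D F (a + b) = kbd D F a + kbd D F b"
  by (simp_all add: kbd_def frag_extend_diff frag_extend_add)

lemma kbd_of: "kbd D F (frag_of x) = (\<Sum>i\<in>D x. frag_cmul ((-1) ^ Suc (rank (D x) i)) (frag_of (F 0 i x) - frag_of (F 1 i x)))"
  by (simp add: kbd_def)

context cubical_complex
begin

definition cells :: "nat \<Rightarrow> 'c set" where
  "cells r = {x \<in> Q. card (D x) = r}"

lemma cell_cube_singular: "x \<in> Q \<Longrightarrow> singular_cube (card (D x)) X (cell_cube D ch x)"
proof -
  assume x: "x \<in> Q"
  have "continuous_map (top_of_set (unit_cube (card (D x)))) (top_of_set (coord_box (D x))) (emb (D x))"
    using emb_cont emb_box[OF D_finite[OF x]] by auto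
  from continuous_map_compose[OF this chi_cont[OF x]]
  have "continuous_map (top_of_set (unit_cube (card (D x)))) X (\<lambda>t. ch x (emb (D x) t))"
    by (simp add: o_def)
  then show ?thesis
    unfolding singular_cube_iff cell_cube_def by (auto intro: continuous_map_eq)
qed

lemma cellc_scubes: "a \<in> chains (cells r) \<Longrightarrow> cellc D ch a \<in> chains (scubes r X)"
  unfolding cellc_def by (erule chains_extend) (use cell_cube_singular in \<open>auto simp: cells_def scubes_def\<close>)

lemma face_cell_cube:
  assumes x: "x \<in> Q" "i \<in> D x" "l \<in> {0, 1}"
  shows "cube_face (card (D x)) (rank (D x) i) (real l) (cell_cube D ch x) = cell_cube D ch (F l i x)"
proof -
  obtain q where q: "card (D x) = Suc q"
    using x(2) D_finite[OF x(1)] by (metis card_gt_0_iff empty_iff gr0_conv_Suc)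
  have qF: "card (D (F l i x)) = q"
    using D_F[OF x] x(2) D_finite[OF x(1)] q by simp
  have rk: "rank (D x) i \<le> q"
    using rank_less_card[OF D_finite[OF x(1)] x(2)] q by simp
  have "ch x (emb (D x) (insert_coord (rank (D x) i) (real l) t)) = ch (F l i x) (emb (D (F l i x)) t)"
    if t: "t \<in> unit_cube q" for t
  proof -
    have "insert_coord (rank (D x) i) (real l) t \<in> unit_cube (card (D x))"
      unfolding q using x(3) by (intro insert_coord_unit_cube t rk) auto
    from chi_face[of x i l "emb (D x) (insert_coord (rank (D x) i) (real l) t)", OF x emb_box[OF D_finite[OF x(1)] this] emb_insert_coord(1)[OF D_finite[OF x(1)] x(2)]]
    show ?thesis
      unfolding D_F[OF x] emb_insert_coord(2)[OF D_finite[OF x(1)] x(2)] .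
  qed
  moreover have "insert_coord (rank (D x) i) (real l) t \<in> unit_cube (Suc q)" if "t \<in> unit_cube q" for t
    using x(3) by (intro insert_coord_unit_cube that rk) auto
  ultimately show ?thesis
    unfolding q by (auto simp: fun_eq_iff cube_face_def cell_cube_def restrict_def qF q)
qed

lemma sbd_cellc:
  assumes "a \<in> chains (cells r)" shows "sbd r (cellc D ch a) = cellc D ch (kbd D F a)"
  using assms
proof (induction rule: chains_induct)
  case (one x)
  then have x: "x \<in> Q" "card (D x) = r" by (auto simp: cells_def)
  have "sbd r (frag_of (cell_cube D ch x)) = (\<Sum>i\<in>D x. frag_cmul ((-1) ^ Suc (rank (D x) i))
      (frag_of (cube_face r (rank (D x) i) 0 (cell_cube D ch x)) - frag_of (cube_face r (rank (D x) i) 1 (cell_cube D ch x))))"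
    unfolding sbd_of x(2)[symmetric]
    by (rule sum.reindex_bij_betw[OF rank_bij[OF D_finite[OF x(1)]], symmetric])
  also have "\<dots> = (\<Sum>i\<in>D x. frag_cmul ((-1) ^ Suc (rank (D x) i))
      (frag_of (cell_cube D ch (F 0 i x)) - frag_of (cell_cube D ch (F 1 i x))))"
    using face_cell_cube[OF x(1), of _ 0] face_cell_cube[OF x(1), of _ 1] x(2) by (intro sum.cong refl) simp
  finally show ?case
    by (simp add: kbd_of cellc_sum cellc_cmul cellc_diff)
qed (simp_all add: sbd_diff cellc_diff kbd_diff)

lemma kbd_cells:
  assumes "a \<in> chains (cells r)" shows "kbd D F a \<in> chains (cells (r - 1))"
  unfolding kbd_def
proof (rule chains_extend[OF assms], rule chains_sum, rule chains_cmul, rule chains_diff)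
  fix x i assume x: "x \<in> cells r" "i \<in> D x"
  have "F l i x \<in> cells (r - 1)" if "l \<in> {0, 1}" for l
    using F_Q[of x i l] D_F[of x i l] D_finite[of x] x that by (simp add: cells_def)
  then show "frag_of (F 0 i x) \<in> chains (cells (r - 1))" "frag_of (F 1 i x) \<in> chains (cells (r - 1))" by auto
qed

text \<open>The centre of a cell lies in its open box, and the open boxes are disjoint.\<close>

lemma cell_cube_inj: "inj_on (cell_cube D ch) (cells r)"
proof (rule inj_onI)
  fix x y assume x: "x \<in> cells r" and y: "y \<in> cells r" and eq: "cell_cube D ch x = cell_cube D ch y"
  define c :: "nat \<Rightarrow> real" where "c = (\<lambda>j. if j < r then 1/2 else 0)"
  have c: "c \<in> unit_cube r" by (auto simp: c_def unit_cube_def)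
  have op: "emb (D z) c \<in> open_coord_box (D z)" if "z \<in> cells r" for z
  proof -
    have "rank (D z) i < r" if "i \<in> D z" for i
      using rank_less_card[OF D_finite that] \<open>z \<in> cells r\<close> by (auto simp: cells_def)
    then show ?thesis by (auto simp: open_coord_box_def emb_def c_def)
  qed
  have "ch x (emb (D x) c) = ch y (emb (D y) c)"
    using fun_cong[OF eq, of c] c x y by (simp add: cell_cube_def cells_def)
  then show "x = y"
    using cells_inj[OF _ _ op[OF x] op[OF y]] x y by (simp add: cells_def)
qed

lemma cellc_left_inverse:
  "\<exists>G. \<forall>a \<in> chains (cells r). frag_extend G (cellc D ch a) = a"
proof (rule exI, rule ballI)
  fix a assume "a \<in> chains (cells r)"
  then show "frag_extend (frag_of \<circ> inv_into (cells r) (cell_cube D ch)) (cellc D ch a) = a"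
    by (induction rule: chains_induct) (auto simp: frag_extend_diff cellc_diff inv_into_f_f[OF cell_cube_inj])
qed

lemma cellc_eq_0: "\<lbrakk>a \<in> chains (cells r); cellc D ch a = 0\<rbrakk> \<Longrightarrow> a = 0"
  using cellc_left_inverse[of r] by (metis frag_extend_0)

text \<open>Inherited from the singular boundary, since cellular chains embed into singular chains.\<close>

lemma kbd_kbd:
  assumes "a \<in> chains (cells r)" shows "kbd D F (kbd D F a) = 0"
proof -
  have "cellc D ch (kbd D F (kbd D F a)) = sbd (r - 1) (sbd r (cellc D ch a))"
    using sbd_cellc[OF assms] sbd_cellc[OF kbd_cells[OF assms]] by simp
  also have "\<dots> = 0" by (cases r) (simp_all add: sbd_sbd)
  finally show ?thesis
    using cellc_eq_0 kbd_cells[OF kbd_cells[OF assms]] by blast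
qed

end

text \<open>Acyclicity of the mapping cone of \<open>cellc\<close>, modulo degenerate chains: \<open>(c, a)\<close> is a cycle of the cone
  and \<open>(b, a')\<close> a chain with this boundary.\<close>

definition cell_exact :: "'x topology \<Rightarrow> 'c set \<Rightarrow> ('c \<Rightarrow> nat set) \<Rightarrow> (nat \<Rightarrow> nat \<Rightarrow> 'c \<Rightarrow> 'c) \<Rightarrow> ('c \<Rightarrow> (nat \<Rightarrow> real) \<Rightarrow> 'x) \<Rightarrow> bool" where
  "cell_exact X Q D F ch \<longleftrightarrow> (\<forall>r. \<forall>c \<in> chains (scubes r X). \<forall>a \<in> chains {x \<in> Q. Suc (card (D x)) = r}.
     kbd D F a = 0 \<longrightarrow> sbd r c - cellc D ch a \<in> chains (relc (r - 1) X {}) \<longrightarrow>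
     (\<exists>a' \<in> chains {x \<in> Q. card (D x) = r}. \<exists>b \<in> chains (scubes (Suc r) X).
        kbd D F a' = a \<and> c - cellc D ch a' - sbd (Suc r) b \<in> chains (relc r X {})))"

lemma cell_exactD:
  assumes "cell_exact X Q D F ch" "c \<in> chains (scubes r X)" "a \<in> chains {x \<in> Q. Suc (card (D x)) = r}"
    "kbd D F a = 0" "sbd r c - cellc D ch a \<in> chains (relc (r - 1) X {})"
  obtains a' b where "a' \<in> chains {x \<in> Q. card (D x) = r}" "b \<in> chains (scubes (Suc r) X)"
    "kbd D F a' = a" "c - cellc D ch a' - sbd (Suc r) b \<in> chains (relc r X {})"
  using assms unfolding cell_exact_def by meson

lemma relc_0_empty: "relc 0 X {} = {}"
  by (simp add: relc_empty)

lemma cell_exact_0: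
  assumes "cubical_complex 0 X Q D F ch" shows "cell_exact X Q D F ch"
proof -
  interpret cubical_complex 0 X Q D F ch by (rule assms)
  have D0: "D x = {}" if "x \<in> Q" for x using D_sub[OF that] by simp
  have box0: "coord_box {} = {\<lambda>_. 0}" by (auto simp: coord_box_def)
  have closed: "closedin X C" if "C \<subseteq> topspace X" for C
  proof (rule closed_crit[OF that])
    fix x assume "x \<in> Q"
    then have "{t \<in> coord_box (D x). ch x t \<in> C} \<subseteq> {\<lambda>_. 0}" using D0 box0 by auto
    then show "closed {t \<in> coord_box (D x). ch x t \<in> C}"
      using finite_subset finite_imp_closed by blast
  qed
  have "openin X C" if "C \<subseteq> topspace X" for C
    using closed[of "topspace X - C"] that by (simp add: openin_closedin_eq)
  note discrete = this closed
  have const: "T t = T (\<lambda>_. 0)" if T: "singular_cube r X T" "t \<in> unit_cube r" for T r t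
  proof -
    let ?p = "T (\<lambda>_. 0)"
    have cont: "continuous_map (top_of_set (unit_cube r)) X T" using T(1) by (simp add: singular_cube_iff)
    have p: "{?p} \<subseteq> topspace X" using singular_cube_in_topspace[OF T(1) unit_cube_nonempty] by simp
    let ?S = "{t \<in> unit_cube r. T t \<in> {?p}}"
    have "openin (top_of_set (unit_cube r)) ?S"
      using openin_continuous_map_preimage[OF cont discrete(1)[OF p]] by simp
    moreover have "closedin (top_of_set (unit_cube r)) ?S"
      using closedin_continuous_map_preimage[OF cont discrete(2)[OF p]] by simp
    ultimately have "?S = {} \<or> ?S = unit_cube r"
      using connected_unit_cube[of r] unfolding connected_clopen by blast
    moreover have "(\<lambda>_. 0) \<in> ?S" using unit_cube_nonempty by simp
    ultimately have "t \<in> ?S" using T(2) by auto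
    then show ?thesis by simp
  qed
  have deg: "scubes (Suc q) X \<subseteq> relc (Suc q) X {}" for q
  proof
    fix T assume "T \<in> scubes (Suc q) X"
    then have T: "singular_cube (Suc q) X T" by (simp add: scubes_def)
    have "degenerate_cube (Suc q) T"
      by (rule degenerate_cubeI[of 0]) (use const[OF T] in simp_all)
    then show "T \<in> relc (Suc q) X {}" using T by (simp add: relc_def)
  qed
  have surj: "scubes 0 X \<subseteq> cell_cube D ch ` Q"
  proof
    fix T assume "T \<in> scubes 0 X"
    then have T: "singular_cube 0 X T" by (simp add: scubes_def)
    have z: "t = (\<lambda>_. 0)" if "t \<in> unit_cube 0" for t using that by (auto simp: unit_cube_def)
    obtain x t where xt: "x \<in> Q" "t \<in> coord_box (D x)" "T (\<lambda>_. 0) = ch x t"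
      using singular_cube_in_topspace[OF T unit_cube_nonempty] by (blast elim: point_cases)
    have t0: "t = (\<lambda>_. 0)" using xt(2) D0[OF xt(1)] box0 by simp
    have "T s = cell_cube D ch x s" for s
    proof (cases "s \<in> unit_cube 0")
      case True
      then show ?thesis using z[OF True] xt(3) t0 D0[OF xt(1)] by (simp add: cell_cube_def emb_def)
    next
      case False
      then show ?thesis using T D0[OF xt(1)] by (simp add: singular_cube_iff cell_cube_def extensional_def)
    qed
    then show "T \<in> cell_cube D ch ` Q" using xt(1) by (intro image_eqI[of _ _ x]) auto
  qed
  have kbd0: "kbd D F a = 0" if "a \<in> chains Q" for a
    using that by (induction rule: chains_induct) (simp_all add: kbd_of kbd_diff D0)
  show ?thesis
    unfolding cell_exact_def
  proof (intro allI ballI impI)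
    fix r c a assume c: "c \<in> chains (scubes r X)" and a: "a \<in> chains {x \<in> Q. Suc (card (D x)) = r}"
      and bd: "sbd r c - cellc D ch a \<in> chains (relc (r - 1) X {})"
    show "\<exists>a'\<in>chains {x \<in> Q. card (D x) = r}. \<exists>b\<in>chains (scubes (Suc r) X).
       kbd D F a' = a \<and> c - cellc D ch a' - sbd (Suc r) b \<in> chains (relc r X {})"
    proof (cases r)
      case 0
      have "a = 0" using a 0 by (simp add: chains_empty)
      let ?a = "frag_extend (frag_of \<circ> inv_into Q (cell_cube D ch)) c"
      have c': "c \<in> chains (cell_cube D ch ` Q)" using c surj 0 by (blast intro: chains_mono)
      have aQ: "?a \<in> chains Q"
        by (rule chains_extend[OF c']) (simp add: inv_into_into)
      have "cellc D ch ?a = c"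
        using c' by (induction rule: chains_induct) (simp_all add: frag_extend_diff cellc_diff f_inv_into_f)
      moreover have "{x \<in> Q. card (D x) = r} = Q" using D0 0 by auto
      ultimately show ?thesis
        using aQ kbd0[OF aQ] \<open>a = 0\<close> by (intro bexI[of _ ?a] bexI[of _ 0]) auto
    next
      case (Suc q)
      have cr: "c \<in> chains (relc r X {})" using c deg Suc by (blast intro: chains_mono)
      have "a = 0"
      proof (cases q)
        case 0
        have "cellc D ch a \<in> chains (relc 0 X {})"
          using chains_diff_iff[OF bd] sbd_relc[OF cr] Suc 0 by simp
        then have "cellc D ch a = 0" by (simp add: relc_0_empty chains_empty)
        then show ?thesis using cellc_eq_0[of a 0] a Suc 0 by (simp add: cells_def)
      next
        case (Suc m)
        then have eq: "{x \<in> Q. Suc (card (D x)) = r} = {}" using D0 \<open>r = Suc q\<close> by auto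
        have "a \<in> chains {}" using a unfolding eq .
        then show ?thesis by (simp add: chains_empty)
      qed
      then show ?thesis using cr by (intro bexI[of _ 0] bexI[of _ 0]) auto
    qed
  qed
qed

section \<open>Induction over the directions\<close>

lemma chains_inter_empty: "\<lbrakk>a \<in> chains A; a \<in> chains B; A \<inter> B = {}\<rbrakk> \<Longrightarrow> a = 0"
  using chains_Int chains_empty by metis

lemma relc_split: "relc r X A \<subseteq> scubes r (subtopology X A) \<union> relc r X {}"
  by (auto simp: relc_def scubes_def singular_cube_subtopology)

lemma scubes_subtopology_Int: "scubes r (subtopology X A) \<inter> relc r X {} \<subseteq> relc r (subtopology X A) {}"
  by (auto simp: relc_empty scubes_def singular_cube_subtopology)

lemma relc_subtopology: "relc r (subtopology X A) {} \<subseteq> relc r X {}"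
  by (auto simp: relc_empty singular_cube_subtopology)

lemma scubes_subtopology: "scubes r (subtopology X A) \<subseteq> scubes r X"
  by (auto simp: scubes_def singular_cube_subtopology)

lemma scubes_subtopology_relc: "scubes r (subtopology X A) \<subseteq> relc r X A"
  by (auto simp: relc_def scubes_def singular_cube_subtopology)

context cubical_complex_Suc
begin

interpretation YC: cubical_complex k Y "{x \<in> Q. k \<in> D x}" "\<lambda>x. D x - {k}" F chiY
  by (rule Y_complex)

interpretation ZC: cubical_complex k "subtopology X Z" "{x \<in> Q. k \<notin> D x}" D F ch
  by (rule Z_complex)

interpretation AC: attached_cylinder X Z Y e p hh g
  by (rule last_direction_cylinder)

abbreviation "DY \<equiv> \<lambda>x. D x - {k}"

lemma cardY: "\<lbrakk>x \<in> Q; k \<in> D x\<rbrakk> \<Longrightarrow> Suc (card (D x - {k})) = card (D x)"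
  by (rule card.remove[symmetric, OF D_finite]) auto

lemma rank_top: "\<lbrakk>x \<in> Q; k \<in> D x\<rbrakk> \<Longrightarrow> rank (D x) k = card (D x - {k})"
  unfolding rank_def using D_sub[of x] by (intro arg_cong[where f=card]) (auto simp: less_Suc_eq)

lemma prism_cell_cube:
  assumes x: "x \<in> Q" "k \<in> D x"
  shows "prism (card (D x - {k})) e (cell_cube DY chiY x) = cell_cube D ch x"
proof (rule ext)
  fix t
  let ?q = "card (D x - {k})"
  show "prism ?q e (cell_cube DY chiY x) t = cell_cube D ch x t"
  proof (cases "t \<in> unit_cube (Suc ?q)")
    case True
    have t0: "t(?q := 0) \<in> unit_cube ?q" by (rule upd_unit_cube(1)[OF True])
    have fin: "finite (D x - {k})" using D_finite[OF x(1)] by simp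
    have u: "0 \<le> t ?q" "t ?q \<le> 1" using unit_cube_coord[OF True] by auto
    have "e (chiY x (emb (D x - {k}) (t(?q := 0)))) (t ?q) = ch x ((emb (D x - {k}) (t(?q := 0)))(k := t ?q))"
      by (rule e_eq[OF x emb_box[OF fin t0] u])
    moreover have "(emb (D x - {k}) (t(?q := 0)))(k := t ?q) = emb (D x) t"
    proof (rule ext)
      fix i
      show "((emb (D x - {k}) (t(?q := 0)))(k := t ?q)) i = emb (D x) t i"
      proof (cases "i = k")
        case True
        then show ?thesis using x rank_top[OF x] by (simp add: emb_def)
      next
        case False
        show ?thesis
        proof (cases "i \<in> D x")
          case iD: True
          then have "i < k" using D_sub[OF x(1)] False by (auto simp: less_Suc_eq)
          then have "rank (D x - {k}) i = rank (D x) i" by (simp add: rank_remove_below)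
          moreover have "rank (D x - {k}) i < ?q" by (rule rank_less_card[OF fin]) (use iD False in simp)
          ultimately show ?thesis using iD False by (simp add: emb_def)
        qed (use False in \<open>simp add: emb_def\<close>)
      qed
    qed
    ultimately show ?thesis
      using True t0 cardY[OF x] by (simp add: prism_def cell_cube_def)
  next
    case False
    then show ?thesis using cardY[OF x] by (simp add: prism_def cell_cube_def)
  qed
qed

text \<open>Since \<open>k\<close> is the largest direction, the interval in the last coordinate of a prism is the side in
  direction \<open>k\<close>.\<close>

lemma prismc_cellc:
  assumes "a \<in> chains (YC.cells q)" shows "prismc q e (cellc DY chiY a) = cellc D ch a"
  using assms
proof (induction rule: chains_induct)
  case (one x)
  then have "x \<in> Q" "k \<in> D x" "card (D x - {k}) = q" by (auto simp: YC.cells_def)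
  then show ?case using prism_cell_cube[of x] by (simp only: cellc_of prismc_of)
qed (simp_all add: prismc_diff cellc_diff)

lemma YC_cells: "YC.cells q = {x \<in> Q. k \<in> D x \<and> card (D x) = Suc q}"
  using cardY by (auto simp: YC.cells_def)

lemma ZC_cells: "ZC.cells q = {x \<in> Q. k \<notin> D x \<and> card (D x) = q}"
  by (auto simp: ZC.cells_def)

text \<open>The cellular boundary in \<open>X\<close> of a cell with direction \<open>k\<close> differs from its boundary as a cell of
  \<open>Y\<close> by the two faces in direction \<open>k\<close>, which belong to \<open>Z\<close>.\<close>

lemma kbd_Y:
  assumes "a \<in> chains (YC.cells q)"
  shows "kbd D F a - kbd DY F a \<in> chains (ZC.cells q)"
  using assms
proof (induction rule: chains_induct)
  case (one x)
  then have x: "x \<in> Q" "k \<in> D x" "card (D x) = Suc q" by (auto simp: YC_cells)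
  have "kbd D F (frag_of x) = frag_cmul ((-1) ^ Suc (rank (D x) k)) (frag_of (F 0 k x) - frag_of (F 1 k x))
     + (\<Sum>i\<in>D x - {k}. frag_cmul ((-1) ^ Suc (rank (D x) i)) (frag_of (F 0 i x) - frag_of (F 1 i x)))"
    unfolding kbd_of by (rule sum.remove[OF D_finite[OF x(1)] x(2)])
  also have "(\<Sum>i\<in>D x - {k}. frag_cmul ((-1) ^ Suc (rank (D x) i)) (frag_of (F 0 i x) - frag_of (F 1 i x))) = kbd DY F (frag_of x)"
  proof -
    have "rank (D x - {k}) i = rank (D x) i" if "i \<in> D x - {k}" for i
      using that D_sub[OF x(1)] by (intro rank_remove_below) (auto simp: less_Suc_eq_le)
    then show ?thesis unfolding kbd_of by (intro sum.cong refl) simp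
  qed
  finally have "kbd D F (frag_of x) - kbd DY F (frag_of x)
     = frag_cmul ((-1) ^ Suc (rank (D x) k)) (frag_of (F 0 k x) - frag_of (F 1 k x))" by simp
  moreover have "F l k x \<in> ZC.cells q" if "l \<in> {0, 1}" for l
    using F_Q[OF x(1,2) that] D_F[OF x(1,2) that] x(3) D_finite[OF x(1)] x(2) by (simp add: ZC_cells)
  ultimately show ?case by (simp only:) (intro chains_cmul chains_diff, auto)
next
  case (diff a b)
  show ?case using chains_diff[OF diff] by (simp add: kbd_diff algebra_simps)
qed simp

lemma cells_split: "cells q \<subseteq> ZC.cells q \<union> {x \<in> Q. k \<in> D x \<and> card (D x) = q}"
  by (auto simp: cells_def ZC_cells)

text \<open>Relative to \<open>Z\<close> only the part \<open>aY\<close> of \<open>a\<close> on cells with direction \<open>k\<close> is visible. As \<open>aY\<close> is the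
  boundary of \<open>c\<close> relative to \<open>Z\<close>, the homology of the attached cylinder exhibits \<open>c\<close> as \<open>s \<times> [0,1]\<close> for a chain
  \<open>s\<close> in \<open>Y\<close> with boundary \<open>aY\<close>. Exactness for \<open>Y\<close> replaces \<open>s\<close> by a cellular chain \<open>aY2\<close>, and the difference
  of \<open>c\<close> and \<open>aY2\<close>, as a cell chain of \<open>X\<close>, lives in \<open>Z\<close>, where exactness holds too.\<close>

lemma cell_exact_Suc:
  assumes exY: "cell_exact Y {x \<in> Q. k \<in> D x} DY F chiY"
    and exZ: "cell_exact (subtopology X Z) {x \<in> Q. k \<notin> D x} D F ch"
  shows "cell_exact X Q D F ch"
  unfolding cell_exact_def
proof (intro allI ballI impI)
  fix r c a assume c: "c \<in> chains (scubes r X)" and a: "a \<in> chains {x \<in> Q. Suc (card (D x)) = r}"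
    and kbd_a: "kbd D F a = 0" and bd: "sbd r c - cellc D ch a \<in> chains (relc (r - 1) X {})"
  let ?goal = "\<exists>a'\<in>chains {x \<in> Q. card (D x) = r}. \<exists>b\<in>chains (scubes (Suc r) X).
       kbd D F a' = a \<and> c - cellc D ch a' - sbd (Suc r) b \<in> chains (relc r X {})"
  \<comment> \<open>Once the part of the cycle over the cylinder is matched, what is left lives in \<open>Z\<close>.\<close>
  have finish: ?goal
    if aY: "aY \<in> chains {x \<in> Q. k \<in> D x \<and> card (D x) = r}" and a1: "a - kbd D F aY \<in> chains {x \<in> Q. k \<notin> D x \<and> Suc (card (D x)) = r}"
      and b1: "b1 \<in> chains (scubes (Suc r) X)" and rel: "c - cellc D ch aY - sbd (Suc r) b1 \<in> chains (relc r X Z)" for aY b1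
  proof -
    obtain z d where z: "z \<in> chains (scubes r (subtopology X Z))" and d: "d \<in> chains (relc r X {})"
      and zd: "c - cellc D ch aY - sbd (Suc r) b1 = z + d"
      by (rule chains_split[OF chains_mono[OF rel relc_split]])
    have aYc: "aY \<in> chains (cells r)" using aY by (rule chains_mono) (auto simp: cells_def)
    have eq: "sbd r z - cellc D ch (a - kbd D F aY) = (sbd r c - cellc D ch a) - sbd r d"
    proof -
      have "z = c - cellc D ch aY - sbd (Suc r) b1 - d" using zd by simp
      then show ?thesis by (simp add: sbd_diff sbd_sbd cellc_diff sbd_cellc[OF aYc])
    qed
    have "sbd r z - cellc D ch (a - kbd D F aY) \<in> chains (relc (r - 1) X {})"
      unfolding eq by (rule chains_diff[OF bd sbd_relc[OF d]])
    moreover have "sbd r z - cellc D ch (a - kbd D F aY) \<in> chains (scubes (r - 1) (subtopology X Z))"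
    proof (rule chains_diff[OF sbd_scubes[OF z] ZC.cellc_scubes])
      show "a - kbd D F aY \<in> chains (ZC.cells (r - 1))"
        using a1 by (rule chains_mono) (auto simp: ZC_cells)
    qed
    ultimately have bdZ: "sbd r z - cellc D ch (a - kbd D F aY) \<in> chains (relc (r - 1) (subtopology X Z) {})"
      using chains_mono[OF chains_Int scubes_subtopology_Int] by blast
    have kbdZ: "kbd D F (a - kbd D F aY) = 0"
      by (simp add: kbd_diff kbd_a kbd_kbd[OF aYc])
    have a1': "a - kbd D F aY \<in> chains {x \<in> {x \<in> Q. k \<notin> D x}. Suc (card (D x)) = r}"
      using a1 by (rule chains_mono) auto
    obtain aZ bZ where aZ: "aZ \<in> chains {x \<in> {x \<in> Q. k \<notin> D x}. card (D x) = r}" "bZ \<in> chains (scubes (Suc r) (subtopology X Z))"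
      "kbd D F aZ = a - kbd D F aY" "z - cellc D ch aZ - sbd (Suc r) bZ \<in> chains (relc r (subtopology X Z) {})"
      by (rule cell_exactD[OF exZ z a1' kbdZ bdZ])
    have "aY + aZ \<in> chains {x \<in> Q. card (D x) = r}"
      using chains_mono[OF aY, of "{x \<in> Q. card (D x) = r}"] chains_mono[OF aZ(1), of "{x \<in> Q. card (D x) = r}"]
      by (intro chains_add) auto
    moreover have "b1 + bZ \<in> chains (scubes (Suc r) X)"
      using b1 chains_mono[OF aZ(2) scubes_subtopology] by (rule chains_add)
    moreover have "kbd D F (aY + aZ) = a" by (simp add: kbd_add aZ(3))
    moreover have "c - cellc D ch (aY + aZ) - sbd (Suc r) (b1 + bZ) \<in> chains (relc r X {})"
    proof -
      have "c - cellc D ch (aY + aZ) - sbd (Suc r) (b1 + bZ)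
        = (c - cellc D ch aY - sbd (Suc r) b1) - cellc D ch aZ - sbd (Suc r) bZ"
        by (simp add: cellc_add sbd_add)
      also have "\<dots> = (z - cellc D ch aZ - sbd (Suc r) bZ) + d" unfolding zd by simp
      finally show ?thesis using chains_add[OF chains_mono[OF aZ(4) relc_subtopology] d] by simp
    qed
    ultimately show ?thesis by blast
  qed
  show ?goal
  proof (cases r)
    case 0
    have "a = 0" using a 0 by (simp add: chains_empty)
    obtain b where "b \<in> chains (scubes 1 X)" "c - sbd 1 b \<in> chains (relc 0 X Z)"
      using AC.attach_surj_0 c 0 by blast
    then show ?thesis using finish[of 0 b] \<open>a = 0\<close> 0 by simp
  next
    case (Suc q)
    have aq: "a \<in> chains (cells q)" using a by (rule chains_mono) (auto simp: cells_def Suc)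
    obtain aZ aY where aZ: "aZ \<in> chains (ZC.cells q)" and aY: "aY \<in> chains {x \<in> Q. k \<in> D x \<and> card (D x) = q}"
      and a_split: "a = aZ + aY"
      by (rule chains_split[OF chains_mono[OF aq cells_split]])
    have c': "c \<in> chains (scubes (Suc q) X)" and bd': "sbd (Suc q) c - cellc D ch a \<in> chains (relc q X {})"
      using c bd Suc by auto
    have cellZ: "cellc D ch aZ \<in> chains (relc q X Z)"
      using chains_mono[OF ZC.cellc_scubes[OF aZ] scubes_subtopology_relc] .
    have emptyZ: "relc n X {} \<subseteq> relc n X Z" for n by (rule relc_mono) simp
    have bdZ: "sbd (Suc q) c - cellc D ch aY \<in> chains (relc q X Z)"
    proof -
      have eq: "sbd (Suc q) c - cellc D ch aY = (sbd (Suc q) c - cellc D ch a) + cellc D ch aZ"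
        by (simp add: a_split cellc_add)
      show ?thesis unfolding eq by (rule chains_add[OF chains_mono[OF bd' emptyZ] cellZ])
    qed
    \<comment> \<open>A cell with direction \<open>k\<close> has positive dimension.\<close>
    have aY0: "aY = 0" if "q = 0"
    proof -
      have "0 < card (D x)" if "x \<in> Q" "k \<in> D x" for x
        using that D_finite[of x] by (auto simp: card_gt_0_iff)
      then have eq: "{x \<in> Q. k \<in> D x \<and> card (D x) = q} = {}" using \<open>q = 0\<close> by auto
      have "aY \<in> chains {}" using aY unfolding eq .
      then show ?thesis by (simp add: chains_empty)
    qed
    \<comment> \<open>The difference to the boundary in \<open>X\<close> consists of cells of \<open>Z\<close>, and no cell is of both kinds.\<close>
    have kbdY: "kbd DY F aY = 0"
    proof (cases q)
      case 0
      then show ?thesis using aY0 by simp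
    next
      case (Suc m)
      have aYc: "aY \<in> chains (YC.cells m)" using aY unfolding YC_cells Suc .
      have kZ: "kbd D F aZ \<in> chains (ZC.cells m)" using ZC.kbd_cells[OF aZ] by (simp add: Suc)
      have eq: "kbd DY F aY = - (kbd D F aZ) - (kbd D F aY - kbd DY F aY)"
        using kbd_a by (simp add: a_split kbd_add add_eq_0_iff2)
      have "kbd DY F aY \<in> chains (ZC.cells m)"
        by (subst eq) (rule chains_diff[OF chains_minus[THEN iffD2, OF kZ] kbd_Y[OF aYc]])
      moreover have "kbd DY F aY \<in> chains (YC.cells (m - 1))" by (rule YC.kbd_cells[OF aYc])
      ultimately show ?thesis
        by (rule chains_inter_empty) (auto simp: YC.cells_def ZC_cells)
    qed
    obtain s b where s: "s \<in> chains (scubes q Y)" "sbd q s - cellc DY chiY aY \<in> chains (relc (q - 1) Y {})"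
      and b: "b \<in> chains (scubes (Suc (Suc q)) X)" "c - prismc q e s - sbd (Suc (Suc q)) b \<in> chains (relc (Suc q) X Z)"
    proof (cases q)
      case 0
      then have "aY = 0" by (rule aY0)
      then have "sbd (Suc q) c \<in> chains (relc q X Z)" using bdZ by simp
      from AC.attach_surj[OF c' this] show thesis using that \<open>aY = 0\<close> by auto
    next
      case (Suc m)
      have aYc: "aY \<in> chains (YC.cells m)" using aY unfolding YC_cells Suc .
      let ?A = "cellc DY chiY aY"
      have A: "?A \<in> chains (scubes m Y)" by (rule YC.cellc_scubes[OF aYc])
      have dA: "sbd m ?A = 0" unfolding YC.sbd_cellc[OF aYc] kbdY by simp
      have c2: "c \<in> chains (scubes (Suc (Suc m)) X)" using c' Suc by simp
      have bA: "sbd (Suc (Suc m)) c - prismc m e ?A \<in> chains (relc (Suc m) X Z)"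
        using bdZ unfolding Suc prismc_cellc[OF aYc] .
      with AC.attach_inj[OF c2 A] dA obtain s0 where s0: "s0 \<in> chains (scubes (Suc m) Y)"
        "sbd (Suc m) s0 - ?A \<in> chains (relc m Y {})" by auto
      \<comment> \<open>Injectivity makes \<open>aY\<close> bound some \<open>s0\<close>; subtracting \<open>s0 \<times> [0,1]\<close> from \<open>c\<close> leaves a relative
        cycle, to which surjectivity applies.\<close>
      let ?c = "c - prismc (Suc m) e s0"
      have cc: "?c \<in> chains (scubes (Suc (Suc m)) X)"
        by (intro chains_diff c2 prismc_scubes[OF s0(1) AC.e_cont])
      have ends: "pushc (Suc m) (\<lambda>y. e y u) s0 \<in> chains (relc (Suc m) X Z)" if u: "u = 0 \<or> u = 1" for u
      proof (rule pushc_relc)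
        show "s0 \<in> chains (relc (Suc m) Y (topspace Y))"
          using s0(1) by (rule chains_mono) (use singular_cube_in_topspace in \<open>fastforce simp: relc_def scubes_def\<close>)
        have "continuous_map Y (prod_topology Y (top_of_set {0..1::real})) (\<lambda>y. (y, u))"
          using u unfolding continuous_map_paired by (auto simp del: topspace_subtopology)
        from continuous_map_compose[OF this AC.e_cont] show "continuous_map Y X (\<lambda>y. e y u)"
          by (simp add: o_def)
      qed (use AC.e_ends u in blast)
      have eqc: "sbd (Suc (Suc m)) ?c = (sbd (Suc (Suc m)) c - prismc m e ?A) - prismc m e (sbd (Suc m) s0 - ?A)
         - frag_cmul ((-1) ^ Suc (Suc m)) (pushc (Suc m) (\<lambda>y. e y 0) s0 - pushc (Suc m) (\<lambda>y. e y 1) s0)"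
        unfolding sbd_diff sbd_prismc prismc_diff diff_Suc_1 by simp
      have mP: "prismc m e (sbd (Suc m) s0 - ?A) \<in> chains (relc (Suc m) X Z)"
        by (rule prismc_relc[OF s0(2) AC.e_cont]) simp
      have "sbd (Suc (Suc m)) ?c \<in> chains (relc (Suc m) X Z)"
        unfolding eqc
        by (rule chains_diff[OF chains_diff[OF bA mP]
              chains_cmul[OF chains_diff[OF ends[OF disjI1[OF refl]] ends[OF disjI2[OF refl]]]]])
      from AC.attach_surj[OF cc this] obtain s1 b where s1: "s1 \<in> chains (scubes (Suc m) Y)" "sbd (Suc m) s1 \<in> chains (relc m Y {})"
        "b \<in> chains (scubes (Suc (Suc (Suc m))) X)" "?c - prismc (Suc m) e s1 - sbd (Suc (Suc (Suc m))) b \<in> chains (relc (Suc (Suc m)) X Z)"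
        by auto
      have eq1: "sbd (Suc m) (s0 + s1) - ?A = (sbd (Suc m) s0 - ?A) + sbd (Suc m) s1" by (simp add: sbd_add)
      have 1: "sbd q (s0 + s1) - ?A \<in> chains (relc (q - 1) Y {})"
        unfolding Suc diff_Suc_1 eq1 by (rule chains_add[OF s0(2) s1(2)])
      have eq2: "c - prismc (Suc m) e (s0 + s1) - sbd (Suc (Suc (Suc m))) b = ?c - prismc (Suc m) e s1 - sbd (Suc (Suc (Suc m))) b"
        by (simp add: prismc_add)
      have 2: "c - prismc q e (s0 + s1) - sbd (Suc (Suc q)) b \<in> chains (relc (Suc q) X Z)"
        unfolding Suc eq2 by (rule s1(4))
      show thesis
        by (rule that[OF chains_add[OF s0(1) s1(1), folded Suc] 1 s1(3)[folded Suc] 2])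
    qed
    have aY': "aY \<in> chains {x \<in> {x \<in> Q. k \<in> D x}. Suc (card (D x - {k})) = q}"
      using aY by (rule chains_mono) (use cardY in auto)
    obtain aY2 bY where Y2: "aY2 \<in> chains {x \<in> {x \<in> Q. k \<in> D x}. card (D x - {k}) = q}" "bY \<in> chains (scubes (Suc q) Y)"
      "kbd DY F aY2 = aY" "s - cellc DY chiY aY2 - sbd (Suc q) bY \<in> chains (relc q Y {})"
      by (rule cell_exactD[OF exY s(1) aY' kbdY s(2)])
    have aY2: "aY2 \<in> chains (YC.cells q)" using Y2(1) unfolding YC.cells_def .
    have ends: "pushc (Suc q) (\<lambda>y. e y u) bY \<in> chains (relc (Suc q) X Z)" if u: "u = 0 \<or> u = 1" for u
    proof (rule pushc_relc)
      show "bY \<in> chains (relc (Suc q) Y (topspace Y))"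
        using Y2(2) by (rule chains_mono) (use singular_cube_in_topspace in \<open>fastforce simp: relc_def scubes_def\<close>)
      have "continuous_map Y (prod_topology Y (top_of_set {0..1::real})) (\<lambda>y. (y, u))"
        using u unfolding continuous_map_paired by (auto simp del: topspace_subtopology)
      from continuous_map_compose[OF this AC.e_cont] show "continuous_map Y X (\<lambda>y. e y u)"
        by (simp add: o_def)
    qed (use AC.e_ends u in blast)
    have P: "prismc q e (s - cellc DY chiY aY2 - sbd (Suc q) bY) \<in> chains (relc (Suc q) X Z)"
      by (rule prismc_relc[OF Y2(4) AC.e_cont]) simp
    show ?thesis
    proof (rule finish[of aY2 "b + prismc (Suc q) e bY"])
      show "aY2 \<in> chains {x \<in> Q. k \<in> D x \<and> card (D x) = r}" using aY2 unfolding YC_cells Suc .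
      show "b + prismc (Suc q) e bY \<in> chains (scubes (Suc r) X)"
        using b(1) prismc_scubes[OF Y2(2) AC.e_cont] Suc by (simp add: chains_add)
      have eqa: "a - kbd D F aY2 = aZ - (kbd D F aY2 - kbd DY F aY2)"
        by (simp add: a_split Y2(3))
      have "a - kbd D F aY2 \<in> chains (ZC.cells q)"
        unfolding eqa by (rule chains_diff[OF aZ kbd_Y[OF aY2]])
      then show "a - kbd D F aY2 \<in> chains {x \<in> Q. k \<notin> D x \<and> Suc (card (D x)) = r}"
        unfolding ZC_cells by (rule chains_mono) (auto simp: Suc)
      have "c - cellc D ch aY2 - sbd (Suc (Suc q)) (b + prismc (Suc q) e bY)
        = (c - prismc q e s - sbd (Suc (Suc q)) b) + prismc q e (s - cellc DY chiY aY2 - sbd (Suc q) bY)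
          - frag_cmul ((-1) ^ Suc (Suc q)) (pushc (Suc q) (\<lambda>y. e y 0) bY - pushc (Suc q) (\<lambda>y. e y 1) bY)"
        unfolding sbd_add sbd_prismc prismc_diff diff_Suc_1 prismc_cellc[OF aY2] by simp
      also have "\<dots> \<in> chains (relc (Suc q) X Z)"
        by (rule chains_diff[OF chains_add[OF b(2) P]
              chains_cmul[OF chains_diff[OF ends[OF disjI1[OF refl]] ends[OF disjI2[OF refl]]]]])
      finally show "c - cellc D ch aY2 - sbd (Suc r) (b + prismc (Suc q) e bY) \<in> chains (relc r X Z)"
        by (simp only: Suc)
    qed
  qed
qed

end

theorem cubical_complex_exact: "cubical_complex k X Q D F ch \<Longrightarrow> cell_exact X Q D F ch"
proof (induction k arbitrary: X Q D ch)
  case 0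
  then show ?case by (rule cell_exact_0)
next
  case (Suc k)
  then interpret cubical_complex_Suc k X Q D F ch by (simp add: cubical_complex_Suc_def)
  show ?case
    by (rule cell_exact_Suc) (rule Suc.IH[OF Y_complex], rule Suc.IH[OF Z_complex])
qed

section \<open>The realisation of a k-graph as a cubical complex\<close>

context k_graph
begin

text \<open>Two applications of unique factorisation show that a factorisation into three parts with given
  degrees is unique.\<close>

lemma seg_eqI:
  assumes "a \<in> Mor \<Lambda>" "b \<in> Mor \<Lambda>" "c \<in> Mor \<Lambda>" "src \<Lambda> a = rng \<Lambda> b" "src \<Lambda> b = rng \<Lambda> c"
    and x: "x = cmp \<Lambda> a (cmp \<Lambda> b c)" and m: "m = deg \<Lambda> a" and n: "n = (\<lambda>i. deg \<Lambda> a i + deg \<Lambda> b i)"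
  shows "seg \<Lambda> x m n = b"
proof -
  have bc: "cmp \<Lambda> b c \<in> Mor \<Lambda>" "src \<Lambda> a = rng \<Lambda> (cmp \<Lambda> b c)" using assms cmp_closed rng_cmp by auto
  have xM: "x \<in> Mor \<Lambda>" using assms(1) bc x cmp_closed by simp
  have dbc: "deg \<Lambda> (cmp \<Lambda> b c) = (\<lambda>i. deg \<Lambda> b i + deg \<Lambda> c i)" using assms deg_cmp by simp
  have dx: "deg \<Lambda> x = (\<lambda>i. deg \<Lambda> a i + deg \<Lambda> (cmp \<Lambda> b c) i)"
    unfolding x by (rule deg_cmp[OF assms(1) bc])
  show ?thesis
    unfolding seg_def
  proof (rule the_equality)
    have dc: "deg \<Lambda> c = (\<lambda>i. deg \<Lambda> x i - n i)" unfolding dx dbc n by (simp add: fun_eq_iff)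
    show "b \<in> Mor \<Lambda> \<and> deg \<Lambda> b = (\<lambda>i. n i - m i) \<and>
     (\<exists>a \<in> Mor \<Lambda>. \<exists>c \<in> Mor \<Lambda>. deg \<Lambda> a = m \<and> deg \<Lambda> c = (\<lambda>i. deg \<Lambda> x i - n i) \<and>
        src \<Lambda> a = rng \<Lambda> b \<and> src \<Lambda> b = rng \<Lambda> c \<and> x = cmp \<Lambda> a (cmp \<Lambda> b c))"
      by (rule conjI[OF assms(2)], rule conjI, simp add: m n, rule bexI[OF bexI[OF _ assms(3)] assms(1)])
        (intro conjI m[symmetric] dc assms(4,5) x)
    fix b' assume "b' \<in> Mor \<Lambda> \<and> deg \<Lambda> b' = (\<lambda>i. n i - m i) \<and>
     (\<exists>a \<in> Mor \<Lambda>. \<exists>c \<in> Mor \<Lambda>. deg \<Lambda> a = m \<and> deg \<Lambda> c = (\<lambda>i. deg \<Lambda> x i - n i) \<and>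
        src \<Lambda> a = rng \<Lambda> b' \<and> src \<Lambda> b' = rng \<Lambda> c \<and> x = cmp \<Lambda> a (cmp \<Lambda> b' c))"
    then obtain a' c' where b': "b' \<in> Mor \<Lambda>" "deg \<Lambda> b' = (\<lambda>i. n i - m i)" "a' \<in> Mor \<Lambda>" "c' \<in> Mor \<Lambda>" "deg \<Lambda> a' = m"
      "deg \<Lambda> c' = (\<lambda>i. deg \<Lambda> x i - n i)" "src \<Lambda> a' = rng \<Lambda> b'" "src \<Lambda> b' = rng \<Lambda> c'" "x = cmp \<Lambda> a' (cmp \<Lambda> b' c')" by (elim conjE bexE)
    have bc': "cmp \<Lambda> b' c' \<in> Mor \<Lambda>" "src \<Lambda> a' = rng \<Lambda> (cmp \<Lambda> b' c')" using b' cmp_closed rng_cmp by auto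
    have dbc': "deg \<Lambda> (cmp \<Lambda> b' c') = deg \<Lambda> (cmp \<Lambda> b c)"
      using b' deg_cmp[of b' c'] unfolding dbc dx by (simp add: fun_eq_iff m n)
    have u1: "\<exists>!p. fst p \<in> Mor \<Lambda> \<and> snd p \<in> Mor \<Lambda> \<and> src \<Lambda> (fst p) = rng \<Lambda> (snd p)
                \<and> deg \<Lambda> (fst p) = deg \<Lambda> a \<and> deg \<Lambda> (snd p) = deg \<Lambda> (cmp \<Lambda> b c) \<and> x = cmp \<Lambda> (fst p) (snd p)"
      by (rule factorisation[OF xM dx])
    have e1: "(a, cmp \<Lambda> b c) = (a', cmp \<Lambda> b' c')"
      by (rule ex1E[OF u1]) (metis (no_types, lifting) assms(1) bc b'(3,5,9) bc' dbc' m x fst_conv snd_conv)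
    have u2: "\<exists>!p. fst p \<in> Mor \<Lambda> \<and> snd p \<in> Mor \<Lambda> \<and> src \<Lambda> (fst p) = rng \<Lambda> (snd p)
                \<and> deg \<Lambda> (fst p) = deg \<Lambda> b \<and> deg \<Lambda> (snd p) = deg \<Lambda> c \<and> cmp \<Lambda> b c = cmp \<Lambda> (fst p) (snd p)"
      by (rule factorisation[OF bc(1) dbc])
    have db': "deg \<Lambda> b' = deg \<Lambda> b" using b'(2) by (simp add: m n)
    have dc': "deg \<Lambda> c' = deg \<Lambda> c" using b'(6) unfolding dx dbc n by simp
    have e2: "(b, c) = (b', c')"
      by (rule ex1E[OF u2]) (metis (no_types, lifting) assms(2,3,5) b'(1,4,8) db' dc' e1 prod.inject fst_conv snd_conv)
    then show "b' = b" by simp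
  qed
qed

lemma seg_decomp:
  assumes x: "x \<in> Mor \<Lambda>" and le: "\<And>i. m i \<le> n i" "\<And>i. n i \<le> deg \<Lambda> x i"
  obtains a b c where "a \<in> Mor \<Lambda>" "b \<in> Mor \<Lambda>" "c \<in> Mor \<Lambda>" "src \<Lambda> a = rng \<Lambda> b" "src \<Lambda> b = rng \<Lambda> c"
    "x = cmp \<Lambda> a (cmp \<Lambda> b c)" "deg \<Lambda> a = m" "deg \<Lambda> b = (\<lambda>i. n i - m i)" "deg \<Lambda> c = (\<lambda>i. deg \<Lambda> x i - n i)" "seg \<Lambda> x m n = b"
proof -
  have "deg \<Lambda> x = (\<lambda>i. m i + (deg \<Lambda> x i - m i))"
    using order_trans[OF le] by (simp add: fun_eq_iff)
  from ex1_implies_ex[OF factorisation[OF x this]] obtain p where p: "fst p \<in> Mor \<Lambda>" "snd p \<in> Mor \<Lambda>" "src \<Lambda> (fst p) = rng \<Lambda> (snd p)"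
    "deg \<Lambda> (fst p) = m" "deg \<Lambda> (snd p) = (\<lambda>i. deg \<Lambda> x i - m i)" "x = cmp \<Lambda> (fst p) (snd p)" by (elim exE conjE)
  have "deg \<Lambda> (snd p) = (\<lambda>i. (n i - m i) + (deg \<Lambda> x i - n i))"
    unfolding p(5) using le by (simp add: fun_eq_iff)
  from ex1_implies_ex[OF factorisation[OF p(2) this]] obtain q where q: "fst q \<in> Mor \<Lambda>" "snd q \<in> Mor \<Lambda>" "src \<Lambda> (fst q) = rng \<Lambda> (snd q)"
    "deg \<Lambda> (fst q) = (\<lambda>i. n i - m i)" "deg \<Lambda> (snd q) = (\<lambda>i. deg \<Lambda> x i - n i)" "snd p = cmp \<Lambda> (fst q) (snd q)" by (elim exE conjE)
  have sr: "src \<Lambda> (fst p) = rng \<Lambda> (fst q)" using p(3) rng_cmp[OF q(1,2,3)] unfolding q(6) by simp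
  have xq: "x = cmp \<Lambda> (fst p) (cmp \<Lambda> (fst q) (snd q))" using p(6) unfolding q(6)[symmetric] .
  have "seg \<Lambda> x m n = fst q"
    by (rule seg_eqI[OF p(1) q(1,2) sr q(3) xq]) (use p(4) q(4) le in \<open>simp_all add: fun_eq_iff\<close>)
  from that[OF p(1) q(1,2) sr q(3) xq p(4) q(4,5) this] show thesis .
qed

lemma seg_Mor:
  assumes "x \<in> Mor \<Lambda>" "\<And>i. m i \<le> n i" "\<And>i. n i \<le> deg \<Lambda> x i"
  shows "seg \<Lambda> x m n \<in> Mor \<Lambda>" "deg \<Lambda> (seg \<Lambda> x m n) = (\<lambda>i. n i - m i)"
  by (rule seg_decomp[OF assms], simp)+

lemma seg_full: "x \<in> Mor \<Lambda> \<Longrightarrow> seg \<Lambda> x (\<lambda>i. 0) (deg \<Lambda> x) = x"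
  by (rule seg_eqI[of "rng \<Lambda> x" x "src \<Lambda> x"])
    (simp_all add: rng_closed src_closed src_rng rng_src cmp_rng_left cmp_src_right deg_rng)

lemma seg_seg:
  assumes x: "x \<in> Mor \<Lambda>" and le: "\<And>i. m i \<le> n i" "\<And>i. n i \<le> deg \<Lambda> x i"
    and pq: "\<And>i. p i \<le> q i" "\<And>i. q i \<le> n i - m i"
  shows "seg \<Lambda> (seg \<Lambda> x m n) p q = seg \<Lambda> x (\<lambda>i. m i + p i) (\<lambda>i. m i + q i)"
proof -
  obtain a b c where abc: "a \<in> Mor \<Lambda>" "b \<in> Mor \<Lambda>" "c \<in> Mor \<Lambda>" "src \<Lambda> a = rng \<Lambda> b" "src \<Lambda> b = rng \<Lambda> c"
    "x = cmp \<Lambda> a (cmp \<Lambda> b c)" "deg \<Lambda> a = m" "deg \<Lambda> b = (\<lambda>i. n i - m i)" "seg \<Lambda> x m n = b"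
    by (rule seg_decomp[OF x le])
  have "q i \<le> deg \<Lambda> b i" for i using pq(2)[of i] abc(8) by simp
  then obtain a' b' c' where b: "a' \<in> Mor \<Lambda>" "b' \<in> Mor \<Lambda>" "c' \<in> Mor \<Lambda>" "src \<Lambda> a' = rng \<Lambda> b'" "src \<Lambda> b' = rng \<Lambda> c'"
    "b = cmp \<Lambda> a' (cmp \<Lambda> b' c')" "deg \<Lambda> a' = p" "deg \<Lambda> b' = (\<lambda>i. q i - p i)" "seg \<Lambda> b p q = b'"
    by (rule seg_decomp[OF abc(2) pq(1)])
  have bc': "cmp \<Lambda> b' c' \<in> Mor \<Lambda>" "src \<Lambda> a' = rng \<Lambda> (cmp \<Lambda> b' c')" "src \<Lambda> (cmp \<Lambda> b' c') = src \<Lambda> c'"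
    using b cmp_closed rng_cmp src_cmp by simp_all
  have sb: "src \<Lambda> b = src \<Lambda> c'" "rng \<Lambda> b = rng \<Lambda> a'"
    unfolding b(6) using src_cmp[OF b(1) bc'(1,2)] rng_cmp[OF b(1) bc'(1,2)] bc'(3) by simp_all
  have c'c: "src \<Lambda> c' = rng \<Lambda> c" using abc(5) sb by simp
  have aa': "src \<Lambda> a = rng \<Lambda> a'" using abc(4) sb by simp
  have C: "cmp \<Lambda> c' c \<in> Mor \<Lambda>" "rng \<Lambda> (cmp \<Lambda> c' c) = rng \<Lambda> c'" using cmp_closed[OF b(3) abc(3) c'c] rng_cmp[OF b(3) abc(3) c'c] by simp_all
  have A: "cmp \<Lambda> a a' \<in> Mor \<Lambda>" "src \<Lambda> (cmp \<Lambda> a a') = src \<Lambda> a'" using cmp_closed[OF abc(1) b(1) aa'] src_cmp[OF abc(1) b(1) aa'] by simp_all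
  have bC: "cmp \<Lambda> b' (cmp \<Lambda> c' c) \<in> Mor \<Lambda>" "rng \<Lambda> (cmp \<Lambda> b' (cmp \<Lambda> c' c)) = rng \<Lambda> b'"
    using cmp_closed[OF b(2) C(1)] rng_cmp[OF b(2) C(1)] C(2) b(5) by simp_all
  have "cmp \<Lambda> b c = cmp \<Lambda> a' (cmp \<Lambda> (cmp \<Lambda> b' c') c)"
    unfolding b(6) by (rule cmp_assoc[OF b(1) bc'(1) abc(3) bc'(2)]) (simp add: bc'(3) c'c)
  also have "cmp \<Lambda> (cmp \<Lambda> b' c') c = cmp \<Lambda> b' (cmp \<Lambda> c' c)"
    by (rule cmp_assoc[OF b(2,3) abc(3) b(5) c'c])
  finally have "x = cmp \<Lambda> a (cmp \<Lambda> a' (cmp \<Lambda> b' (cmp \<Lambda> c' c)))" using abc(6) by simp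
  also have "\<dots> = cmp \<Lambda> (cmp \<Lambda> a a') (cmp \<Lambda> b' (cmp \<Lambda> c' c))"
    by (rule cmp_assoc[OF abc(1) b(1) bC(1) aa', symmetric]) (simp add: bC(2) b(4))
  finally have xx: "x = cmp \<Lambda> (cmp \<Lambda> a a') (cmp \<Lambda> b' (cmp \<Lambda> c' c))" .
  have dA: "deg \<Lambda> (cmp \<Lambda> a a') = (\<lambda>i. m i + p i)"
    using deg_cmp[OF abc(1) b(1) aa'] abc(7) b(7) by simp
  have "seg \<Lambda> x (\<lambda>i. m i + p i) (\<lambda>i. m i + q i) = b'"
    by (rule seg_eqI[OF A(1) b(2) C(1) _ _ xx])
      (use dA b(4,5,8) A(2) C(2) pq(1) in \<open>simp_all add: fun_eq_iff\<close>)
  then show ?thesis using abc(9) b(9) by simp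
qed

abbreviation "RX \<equiv> realisation k \<Lambda>"
abbreviation "cls \<equiv> realisation_class k \<Lambda>"
abbreviation "pre \<equiv> realisation_pre k \<Lambda>"

text \<open>Two points of the disjoint union are identified iff their normal forms agree; \<open>cls_eq_iff\<close> thus
  replaces equality of classes by equality of pairs.\<close>

definition normal_form :: "'a \<Rightarrow> (nat \<Rightarrow> real) \<Rightarrow> 'a \<times> (nat \<Rightarrow> real)" where
  "normal_form x t = (seg \<Lambda> x (\<lambda>i. nat \<lfloor>t i\<rfloor>) (\<lambda>i. nat \<lceil>t i\<rceil>), \<lambda>i. t i - \<lfloor>t i\<rfloor>)"

lemma deg_box_topology:
  assumes "x \<in> Mor \<Lambda>"
  shows "subtopology (Euclidean_space k) (deg_box (deg \<Lambda> x)) = top_of_set (deg_box (deg \<Lambda> x))"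
proof -
  have "t i = 0" if "t \<in> deg_box (deg \<Lambda> x)" "k \<le> i" for t i
  proof -
    have "0 \<le> t i \<and> t i \<le> real (deg \<Lambda> x i)" using that(1) by (simp add: deg_box_def)
    then show ?thesis using deg_beyond[OF assms that(2)] by simp
  qed
  then have "{t. \<forall>i\<ge>k. t i = 0} \<inter> deg_box (deg \<Lambda> x) = deg_box (deg \<Lambda> x)" by blast
  then show ?thesis
    by (simp add: Euclidean_space_def subtopology_subtopology euclidean_product_topology)
qed

lemma pre_top: "(x, t) \<in> topspace pre \<longleftrightarrow> x \<in> Mor \<Lambda> \<and> t \<in> deg_box (deg \<Lambda> x)"
  unfolding realisation_pre_def using deg_box_topology
  by (auto simp: topspace_Euclidean_space deg_box_def intro: deg_beyond) (metis deg_beyond le_zero_eq of_nat_0 order_antisym_conv)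

lemma pre_open:
  "openin pre U \<longleftrightarrow> U \<subseteq> topspace pre \<and> (\<forall>x\<in>Mor \<Lambda>. openin (top_of_set (deg_box (deg \<Lambda> x))) {t. (x, t) \<in> U})"
  unfolding realisation_pre_def openin_sum_topology by (auto simp: deg_box_topology)

lemma rel_iff: "((x, s), (y, t)) \<in> realisation_rel k \<Lambda> \<longleftrightarrow>
    (x, s) \<in> topspace pre \<and> (y, t) \<in> topspace pre \<and> normal_form x s = normal_form y t"
  by (auto simp: realisation_rel_def normal_form_def fun_eq_iff)

lemma cls_eq_iff:
  assumes "(x, s) \<in> topspace pre" "(y, t) \<in> topspace pre"
  shows "cls x s = cls y t \<longleftrightarrow> normal_form x s = normal_form y t"
proof
  assume "cls x s = cls y t"
  moreover have "(y, t) \<in> cls y t" using assms(2) by (simp add: realisation_class_def rel_iff)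
  ultimately have "(y, t) \<in> cls x s" by simp
  then show "normal_form x s = normal_form y t" by (simp add: realisation_class_def rel_iff)
next
  assume "normal_form x s = normal_form y t"
  then show "cls x s = cls y t"
    using assms by (auto simp: realisation_class_def rel_iff)
qed

lemma RX_top: "topspace RX = topspace pre // realisation_rel k \<Lambda>"
proof -
  have "openin RX (topspace pre // realisation_rel k \<Lambda>)"
  proof -
    have "{x \<in> topspace pre. realisation_rel k \<Lambda> `` {x} \<in> topspace pre // realisation_rel k \<Lambda>} = topspace pre"
      by (auto intro: quotientI)
    then show ?thesis unfolding realisation_def openin_quotient_topology by simp
  qed
  moreover have "topspace RX \<subseteq> topspace pre // realisation_rel k \<Lambda>"
    using openin_topspace[of RX] unfolding realisation_def openin_quotient_topology by simp
  ultimately show ?thesis using openin_subset by blast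
qed

lemma cls_top: "\<lbrakk>x \<in> Mor \<Lambda>; t \<in> deg_box (deg \<Lambda> x)\<rbrakk> \<Longrightarrow> cls x t \<in> topspace RX"
  unfolding RX_top realisation_class_def by (rule quotientI) (simp add: pre_top)

lemma RX_cases:
  assumes "p \<in> topspace RX" obtains x t where "x \<in> Mor \<Lambda>" "t \<in> deg_box (deg \<Lambda> x)" "p = cls x t"
proof -
  from assms obtain q where q: "q \<in> topspace pre" "p = realisation_rel k \<Lambda> `` {q}"
    unfolding RX_top by (rule quotientE)
  obtain x t where "q = (x, t)" by (cases q)
  then show thesis using that[of x t] q by (simp add: pre_top realisation_class_def)
qed

lemma RX_open:
  "openin RX U \<longleftrightarrow> U \<subseteq> topspace RX \<and> (\<forall>x\<in>Mor \<Lambda>. openin (top_of_set (deg_box (deg \<Lambda> x))) {t \<in> deg_box (deg \<Lambda> x). cls x t \<in> U})"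
proof -
  have "{t. (x, t) \<in> {q \<in> topspace pre. realisation_rel k \<Lambda> `` {q} \<in> U}} = {t \<in> deg_box (deg \<Lambda> x). cls x t \<in> U}" if "x \<in> Mor \<Lambda>" for x
    using that by (auto simp: pre_top realisation_class_def)
  then show ?thesis
    unfolding RX_top unfolding realisation_def openin_quotient_topology pre_open by auto
qed

lemma cls_cont: "x \<in> Mor \<Lambda> \<Longrightarrow> continuous_map (top_of_set (deg_box (deg \<Lambda> x))) RX (cls x)"
  unfolding continuous_map_def using cls_top RX_open by auto

text \<open>The normal form of a point is computed within any segment that contains it.\<close>

lemma cls_seg:
  assumes x: "x \<in> Mor \<Lambda>" and le: "\<And>i. m i \<le> n i" "\<And>i. n i \<le> deg \<Lambda> x i"
    and t: "\<And>i. real (m i) \<le> t i" "\<And>i. t i \<le> real (n i)"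
  shows "cls x t = cls (seg \<Lambda> x m n) (\<lambda>i. t i - real (m i))"
proof -
  have s: "seg \<Lambda> x m n \<in> Mor \<Lambda>" "deg \<Lambda> (seg \<Lambda> x m n) = (\<lambda>i. n i - m i)" by (rule seg_Mor[OF x le])+
  have fl: "\<lfloor>t i - real (m i)\<rfloor> = \<lfloor>t i\<rfloor> - int (m i)" "\<lceil>t i - real (m i)\<rceil> = \<lceil>t i\<rceil> - int (m i)" for i
    using floor_diff_of_int[of "t i" "int (m i)"] ceiling_diff_of_int[of "t i" "int (m i)"] by simp_all
  have fb: "int (m i) \<le> \<lfloor>t i\<rfloor>" "\<lceil>t i\<rceil> \<le> int (n i)" "\<lfloor>t i\<rfloor> \<le> \<lceil>t i\<rceil>" for i
    using t[of i] by (simp_all add: le_floor_iff ceiling_le_iff)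
  have "seg \<Lambda> (seg \<Lambda> x m n) (\<lambda>i. nat \<lfloor>t i - real (m i)\<rfloor>) (\<lambda>i. nat \<lceil>t i - real (m i)\<rceil>)
    = seg \<Lambda> x (\<lambda>i. m i + nat \<lfloor>t i - real (m i)\<rfloor>) (\<lambda>i. m i + nat \<lceil>t i - real (m i)\<rceil>)"
  proof (rule seg_seg[OF x le])
    fix i
    show "nat \<lfloor>t i - real (m i)\<rfloor> \<le> nat \<lceil>t i - real (m i)\<rceil>"
      unfolding fl by (rule nat_mono) (use fb[of i] in linarith)
    show "nat \<lceil>t i - real (m i)\<rceil> \<le> n i - m i"
      unfolding fl nat_le_iff of_nat_diff[OF le(1)] using fb[of i] by linarith
  qed
  moreover have "(\<lambda>i. m i + nat \<lfloor>t i - real (m i)\<rfloor>) = (\<lambda>i. nat \<lfloor>t i\<rfloor>)"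
  proof (rule ext)
    fix i show "m i + nat \<lfloor>t i - real (m i)\<rfloor> = nat \<lfloor>t i\<rfloor>" unfolding fl using fb[of i] by linarith
  qed
  moreover have "(\<lambda>i. m i + nat \<lceil>t i - real (m i)\<rceil>) = (\<lambda>i. nat \<lceil>t i\<rceil>)"
  proof (rule ext)
    fix i show "m i + nat \<lceil>t i - real (m i)\<rceil> = nat \<lceil>t i\<rceil>" unfolding fl using fb[of i] by linarith
  qed
  ultimately have "normal_form x t = normal_form (seg \<Lambda> x m n) (\<lambda>i. t i - real (m i))"
    unfolding normal_form_def by (simp add: fl(1))
  moreover have "(x, t) \<in> topspace pre"
  proof -
    have "0 \<le> t i \<and> t i \<le> real (deg \<Lambda> x i)" for i
      using t(1)[of i] t(2)[of i] le(2)[of i] by linarith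
    then show ?thesis unfolding pre_top deg_box_def using x by simp
  qed
  moreover have "(seg \<Lambda> x m n, \<lambda>i. t i - real (m i)) \<in> topspace pre"
    unfolding pre_top deg_box_def s(2) using s(1) t le by (simp add: of_nat_diff)
  ultimately show ?thesis using cls_eq_iff by blast
qed

definition cubes :: "'a set" where
  "cubes = {x \<in> Mor \<Lambda>. \<forall>i<k. deg \<Lambda> x i \<le> 1}"

definition dirs :: "'a \<Rightarrow> nat set" where
  "dirs x = {i. deg \<Lambda> x i \<noteq> 0}"

definition face :: "nat \<Rightarrow> nat \<Rightarrow> 'a \<Rightarrow> 'a" where
  "face l i x = (if l = 0 then seg \<Lambda> x (\<lambda>i. 0) (\<lambda>j. deg \<Lambda> x j - unit_vec i j) else seg \<Lambda> x (unit_vec i) (deg \<Lambda> x))"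

lemma cubes_deg: "x \<in> cubes \<Longrightarrow> deg \<Lambda> x i = (if i \<in> dirs x then 1 else 0)"
  using deg_beyond[of x i] by (cases "i < k") (auto simp: cubes_def dirs_def le_Suc_eq)

lemma cubes_Mor: "x \<in> cubes \<Longrightarrow> x \<in> Mor \<Lambda>"
  by (simp add: cubes_def)

lemma cubes_box: "x \<in> cubes \<Longrightarrow> coord_box (dirs x) = deg_box (deg \<Lambda> x)"
  unfolding coord_box_def deg_box_def using cubes_deg[of x] by (auto split: if_splits) (metis less_eq_real_def order_antisym_conv)+

lemma cubesI: "\<lbrakk>x \<in> Mor \<Lambda>; \<And>i. deg \<Lambda> x i \<le> 1\<rbrakk> \<Longrightarrow> x \<in> cubes"
  by (simp add: cubes_def)

lemma face_bounds:
  assumes "x \<in> cubes" "i \<in> dirs x"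
  shows "unit_vec i j \<le> deg \<Lambda> x j" "deg \<Lambda> x j - unit_vec i j \<le> deg \<Lambda> x j"
  using cubes_deg[OF assms(1), of j] assms(2) by (auto simp: unit_vec_def)

lemma face_Mor:
  assumes "x \<in> cubes" "i \<in> dirs x"
  shows "face l i x \<in> Mor \<Lambda>" "deg \<Lambda> (face l i x) = (\<lambda>j. deg \<Lambda> x j - unit_vec i j)"
proof -
  have 0: "seg \<Lambda> x (\<lambda>i. 0) (\<lambda>j. deg \<Lambda> x j - unit_vec i j) \<in> Mor \<Lambda>"
    "deg \<Lambda> (seg \<Lambda> x (\<lambda>i. 0) (\<lambda>j. deg \<Lambda> x j - unit_vec i j)) = (\<lambda>j. deg \<Lambda> x j - unit_vec i j)"
    using seg_Mor[OF cubes_Mor[OF assms(1)], of "\<lambda>i. 0" "\<lambda>j. deg \<Lambda> x j - unit_vec i j"] face_bounds[OF assms] by simp_all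
  have 1: "seg \<Lambda> x (unit_vec i) (deg \<Lambda> x) \<in> Mor \<Lambda>" "deg \<Lambda> (seg \<Lambda> x (unit_vec i) (deg \<Lambda> x)) = (\<lambda>j. deg \<Lambda> x j - unit_vec i j)"
    using seg_Mor[OF cubes_Mor[OF assms(1)], of "unit_vec i" "deg \<Lambda> x"] face_bounds[OF assms] by simp_all
  show "face l i x \<in> Mor \<Lambda>" "deg \<Lambda> (face l i x) = (\<lambda>j. deg \<Lambda> x j - unit_vec i j)"
    using 0 1 by (simp_all add: face_def)
qed

lemma cls_face:
  assumes x: "x \<in> cubes" "i \<in> dirs x" and l: "l \<in> {0, 1}" and t: "t \<in> coord_box (dirs x)" "t i = real l"
  shows "cls x t = cls (face l i x) (t(i := 0))"
proof -
  have tb: "0 \<le> t j" "t j \<le> real (deg \<Lambda> x j)" for j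
    using t(1) unfolding cubes_box[OF x(1)] deg_box_def by auto
  show ?thesis
  proof (cases "l = 0")
    case True
    have "cls x t = cls (seg \<Lambda> x (\<lambda>i. 0) (\<lambda>j. deg \<Lambda> x j - unit_vec i j)) (\<lambda>j. t j - real 0)"
    proof (rule cls_seg[OF cubes_Mor[OF x(1)]])
      fix j show "t j \<le> real (deg \<Lambda> x j - unit_vec i j)"
        using tb[of j] t(2) True by (cases "j = i") (auto simp: unit_vec_def)
    qed (use tb face_bounds[OF x] in simp_all)
    also have "(\<lambda>j. t j - real 0) = t(i := 0)" using t(2) True by (auto simp: fun_eq_iff)
    finally show ?thesis unfolding face_def if_P[OF True] .
  next
    case False
    then have l1: "l = 1" using l by simp
    have "cls x t = cls (seg \<Lambda> x (unit_vec i) (deg \<Lambda> x)) (\<lambda>j. t j - real (unit_vec i j))"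
    proof (rule cls_seg[OF cubes_Mor[OF x(1)]])
      fix j show "real (unit_vec i j) \<le> t j"
        using tb[of j] t(2) l1 by (cases "j = i") (auto simp: unit_vec_def)
    qed (use tb face_bounds[OF x] in simp_all)
    also have "(\<lambda>j. t j - real (unit_vec i j)) = t(i := 0)" using t(2) l1 by (auto simp: fun_eq_iff unit_vec_def)
    finally show ?thesis unfolding face_def if_not_P[OF False] .
  qed
qed

lemma normal_form_open:
  assumes "x \<in> cubes" "t \<in> open_coord_box (dirs x)" shows "normal_form x t = (x, t)"
proof -
  have "\<lfloor>t i\<rfloor> = 0" "nat \<lceil>t i\<rceil> = deg \<Lambda> x i" for i
  proof -
    have "i \<in> dirs x \<Longrightarrow> 0 < t i \<and> t i < 1" "i \<notin> dirs x \<Longrightarrow> t i = 0"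
      using assms(2) by (auto simp: open_coord_box_def)
    moreover have "\<lceil>t i\<rceil> = 1" if "0 < t i \<and> t i < 1" using that by (simp add: ceiling_unique)
    moreover have "\<lfloor>t i\<rfloor> = 0" if "0 < t i \<and> t i < 1" using that by (simp add: floor_unique)
    ultimately show "\<lfloor>t i\<rfloor> = 0" "nat \<lceil>t i\<rceil> = deg \<Lambda> x i"
      using cubes_deg[OF assms(1), of i] by (cases "i \<in> dirs x"; simp)+
  qed
  then show ?thesis
    unfolding normal_form_def using seg_full[OF cubes_Mor[OF assms(1)]] by simp
qed

lemma open_pre_top: "\<lbrakk>x \<in> cubes; t \<in> open_coord_box (dirs x)\<rbrakk> \<Longrightarrow> (x, t) \<in> topspace pre"
  using open_box_sub[of t "dirs x"] cubes_box[of x] cubes_Mor[of x] by (simp add: pre_top)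

text \<open>Every point lies in the segment \<open>x(\<lfloor>t\<rfloor>, \<lceil>t\<rceil>)\<close>, which is a cube. After subtraction of the integer
  parts its coordinates in the directions of this cube are strictly between 0 and 1; such a pair is its own normal form, whence uniqueness. For the topology it matters
  that the box of any morphism \<open>x\<close> is a finite union of translated unit boxes, so that closedness can be
  tested on unit boxes.\<close>

theorem realisation_complex: "cubical_complex k RX cubes dirs face cls"
proof
  show "dirs x \<subseteq> {..<k}" if "x \<in> cubes" for x
  proof
    fix i assume "i \<in> dirs x"
    then show "i \<in> {..<k}" using deg_beyond[OF cubes_Mor[OF that], of i] by (cases "i < k") (simp_all add: dirs_def)
  qed
  show "face l i x \<in> cubes" if "x \<in> cubes" "i \<in> dirs x" "l \<in> {0, 1}" for x i l
  proof (rule cubesI[OF face_Mor(1)[OF that(1,2)]])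
    fix j show "deg \<Lambda> (face l i x) j \<le> 1"
      unfolding face_Mor(2)[OF that(1,2)] cubes_deg[OF that(1), of j] by simp
  qed
  show "dirs (face l i x) = dirs x - {i}" if "x \<in> cubes" "i \<in> dirs x" "l \<in> {0, 1}" for x i l
  proof -
    have "deg \<Lambda> (face l i x) j \<noteq> 0 \<longleftrightarrow> j \<in> dirs x - {i}" for j
      unfolding face_Mor(2)[OF that(1,2)] cubes_deg[OF that(1), of j] by (simp add: unit_vec_def)
    then show ?thesis unfolding dirs_def[of "face l i x"] by blast
  qed
  show "continuous_map (top_of_set (coord_box (dirs x))) RX (cls x)" if "x \<in> cubes" for x
    unfolding cubes_box[OF that] by (rule cls_cont[OF cubes_Mor[OF that]])
  show "cls x t = cls (face l i x) (t(i := 0))"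
    if "x \<in> cubes" "i \<in> dirs x" "l \<in> {0, 1}" "t \<in> coord_box (dirs x)" "t i = real l" for x i l t
    by (rule cls_face[OF that])
  show "\<exists>x\<in>cubes. \<exists>t\<in>open_coord_box (dirs x). p = cls x t" if p: "p \<in> topspace RX" for p
  proof -
    obtain x t where xt: "x \<in> Mor \<Lambda>" "t \<in> deg_box (deg \<Lambda> x)" "p = cls x t" by (rule RX_cases[OF p])
    define m n where "m = (\<lambda>i. nat \<lfloor>t i\<rfloor>)" and "n = (\<lambda>i. nat \<lceil>t i\<rceil>)"
    have tb: "0 \<le> t i" "t i \<le> real (deg \<Lambda> x i)" for i using xt(2) by (auto simp: deg_box_def)
    have mt: "real (m i) \<le> t i" "t i < real (m i) + 1" "t i \<le> real (n i)" for i
      using tb[of i] by (auto simp: m_def n_def intro: real_nat_ceiling_ge)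
    have mn: "m i \<le> n i" for i using order_trans[OF mt(1)[of i] mt(3)[of i]] by simp
    have nd: "n i \<le> deg \<Lambda> x i" for i using tb[of i] by (simp add: n_def nat_le_iff ceiling_le_iff)
    have n1: "n i \<le> m i + 1" "n i = m i \<longleftrightarrow> t i = real (m i)" for i
    proof -
      have "n i \<le> Suc (m i)"
        unfolding n_def by (rule nat_le_iff[THEN iffD2], rule ceiling_le) (use mt(2)[of i] in simp)
      then show "n i \<le> m i + 1" by simp
      show "n i = m i \<longleftrightarrow> t i = real (m i)"
      proof
        assume "n i = m i" then show "t i = real (m i)" using mt[of i] by simp
      next
        assume "t i = real (m i)" then show "n i = m i" by (simp add: n_def)
      qed
    qed
    let ?y = "seg \<Lambda> x m n" and ?u = "\<lambda>i. t i - real (m i)"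
    have y: "?y \<in> Mor \<Lambda>" "deg \<Lambda> ?y = (\<lambda>i. n i - m i)" by (rule seg_Mor[OF xt(1) mn nd])+
    have "?y \<in> cubes" by (rule cubesI[OF y(1)]) (use n1(1) in \<open>simp add: y(2) le_diff_conv\<close>)
    moreover have "?u \<in> open_coord_box (dirs ?y)"
      unfolding open_coord_box_def mem_Collect_eq
    proof (intro conjI ballI allI impI)
      fix i assume "i \<in> dirs ?y"
      then have "n i \<noteq> m i" by (simp add: dirs_def y(2))
      then show "0 < ?u i" "?u i < 1" using n1(2)[of i] mt[of i] by auto
    next
      fix i assume "i \<notin> dirs ?y"
      then have "n i = m i" using mn[of i] by (simp add: dirs_def y(2))
      then show "?u i = 0" using n1(2)[of i] by simp
    qed
    moreover have "p = cls ?y ?u" unfolding xt(3) by (rule cls_seg[OF xt(1) mn nd mt(1,3)])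
    ultimately show ?thesis by blast
  qed
  show "x = y \<and> s = t" if "x \<in> cubes" "y \<in> cubes" "s \<in> open_coord_box (dirs x)" "t \<in> open_coord_box (dirs y)" "cls x s = cls y t" for x y s t
    using that(5) cls_eq_iff[OF open_pre_top[OF that(1,3)] open_pre_top[OF that(2,4)]]
      normal_form_open[OF that(1,3)] normal_form_open[OF that(2,4)] by simp
  show "closedin RX C"
    if C: "C \<subseteq> topspace RX" and cl: "\<And>x. x \<in> cubes \<Longrightarrow> closed {t \<in> coord_box (dirs x). cls x t \<in> C}" for C
  proof -
    have "closed {t \<in> deg_box (deg \<Lambda> x). cls x t \<in> C}" if x: "x \<in> Mor \<Lambda>" for x
    proof -
      define N where "N = {n. \<forall>i. n i \<le> deg \<Lambda> x i}"
      define top where "top n = (\<lambda>i. min (n i + 1) (deg \<Lambda> x i))" for n :: "nat \<Rightarrow> nat"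
      define B where "B n = {u \<in> coord_box (dirs (seg \<Lambda> x n (top n))). cls (seg \<Lambda> x n (top n)) u \<in> C}" for n
      have le: "n i \<le> top n i" "top n i \<le> deg \<Lambda> x i" if "n \<in> N" for n i using that by (auto simp: N_def top_def)
      have s: "seg \<Lambda> x n (top n) \<in> Mor \<Lambda>" "deg \<Lambda> (seg \<Lambda> x n (top n)) = (\<lambda>i. top n i - n i)" if "n \<in> N" for n
        using seg_Mor[OF x le(1)[OF that] le(2)[OF that]] by simp_all
      have sc: "seg \<Lambda> x n (top n) \<in> cubes" if "n \<in> N" for n
        by (rule cubesI[OF s(1)[OF that]]) (simp only: s(2)[OF that], simp add: top_def)
      have "finite N"
      proof -
        define M where "M = Max (insert 0 (deg \<Lambda> x ` {..<k}))"
        have M: "deg \<Lambda> x i \<le> M" if "i < k" for i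
          unfolding M_def by (rule Max_ge) (use that in auto)
        have "N \<subseteq> {n. \<forall>i. (i \<in> {..<k} \<longrightarrow> n i \<in> {..M}) \<and> (i \<notin> {..<k} \<longrightarrow> n i = 0)}"
        proof
          fix n assume "n \<in> N"
          then have n: "n i \<le> deg \<Lambda> x i" for i by (simp add: N_def)
          have "n i \<le> M" if "i < k" for i using n[of i] M[OF that] by simp
          moreover have "n i = 0" if "\<not> i < k" for i using n[of i] deg_beyond[OF x, of i] that by simp
          ultimately show "n \<in> {n. \<forall>i. (i \<in> {..<k} \<longrightarrow> n i \<in> {..M}) \<and> (i \<notin> {..<k} \<longrightarrow> n i = 0)}" by simp
        qed
        then show ?thesis
          by (rule finite_subset) (rule finite_set_of_finite_funs; simp)
      qed
      moreover have "closed ((\<lambda>t i. t i - real (n i)) -` B n)" if "n \<in> N" for n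
      proof (rule closed_vimage)
        show "closed (B n)" unfolding B_def by (rule cl[OF sc[OF that]])
        show "continuous_on UNIV (\<lambda>t i. t i - real (n i))"
          by (rule continuous_on_coordinatewise_then_product) (intro continuous_on_diff continuous_on_coord continuous_on_const)
      qed
      moreover have "{t \<in> deg_box (deg \<Lambda> x). cls x t \<in> C} = (\<Union>n\<in>N. (\<lambda>t i. t i - real (n i)) -` B n)"
      proof (rule subset_antisym; rule subsetI)
        fix t assume t: "t \<in> {t \<in> deg_box (deg \<Lambda> x). cls x t \<in> C}"
        define n where "n = (\<lambda>i. nat \<lfloor>t i\<rfloor>)"
        have tb: "0 \<le> t i" "t i \<le> real (deg \<Lambda> x i)" for i using t by (auto simp: deg_box_def)
        have nt: "real (n i) \<le> t i" "t i < real (n i) + 1" for i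
          using tb(1)[of i] by (auto simp: n_def)
        have "n i \<le> deg \<Lambda> x i" for i using nt(1)[of i] tb(2)[of i] by linarith
        then have nN: "n \<in> N" by (simp add: N_def)
        have tt: "t i \<le> real (top n i)" for i using nt(2)[of i] tb(2)[of i] by (simp add: top_def min_def)
        have "(\<lambda>i. t i - real (n i)) \<in> coord_box (dirs (seg \<Lambda> x n (top n)))"
          unfolding cubes_box[OF sc[OF nN]] deg_box_def s(2)[OF nN] using nt(1) tt le(1)[OF nN] by (simp add: of_nat_diff)
        moreover have "cls x t = cls (seg \<Lambda> x n (top n)) (\<lambda>i. t i - real (n i))"
          by (rule cls_seg[OF x le(1)[OF nN] le(2)[OF nN] nt(1) tt])
        ultimately have "(\<lambda>i. t i - real (n i)) \<in> B n" using t by (simp add: B_def)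
        then show "t \<in> (\<Union>n\<in>N. (\<lambda>t i. t i - real (n i)) -` B n)" using nN by blast
      next
        fix t assume "t \<in> (\<Union>n\<in>N. (\<lambda>t i. t i - real (n i)) -` B n)"
        then obtain n where nN: "n \<in> N" and tB: "(\<lambda>i. t i - real (n i)) \<in> B n" by blast
        have "(\<lambda>i. t i - real (n i)) \<in> deg_box (\<lambda>i. top n i - n i)"
          using tB unfolding B_def cubes_box[OF sc[OF nN]] s(2)[OF nN] by simp
        then have "0 \<le> t i - real (n i) \<and> t i - real (n i) \<le> real (top n i - n i)" for i
          unfolding deg_box_def mem_Collect_eq by (rule spec)
        then have tb: "real (n i) \<le> t i" "t i \<le> real (top n i)" for i
          unfolding of_nat_diff[OF le(1)[OF nN]] by simp_all
        have "cls x t = cls (seg \<Lambda> x n (top n)) (\<lambda>i. t i - real (n i))"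
          by (rule cls_seg[OF x le(1)[OF nN] le(2)[OF nN] tb])
        then have "cls x t \<in> C" using tB by (simp add: B_def)
        moreover have "0 \<le> t i \<and> t i \<le> real (deg \<Lambda> x i)" for i
          using tb[of i] le(2)[OF nN, of i] of_nat_0_le_iff[of "n i", where 'a = real] by linarith
        ultimately show "t \<in> {t \<in> deg_box (deg \<Lambda> x). cls x t \<in> C}" by (simp add: deg_box_def)
      qed
      ultimately show ?thesis by (simp add: closed_UN)
    qed
    note cl' = this
    have "openin RX (topspace RX - C)"
      unfolding RX_open
    proof (intro conjI ballI)
      fix x assume x: "x \<in> Mor \<Lambda>"
      have eq: "{t \<in> deg_box (deg \<Lambda> x). cls x t \<in> topspace RX - C} = deg_box (deg \<Lambda> x) \<inter> - {t \<in> deg_box (deg \<Lambda> x). cls x t \<in> C}"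
        using cls_top[OF x] by auto
      show "openin (top_of_set (deg_box (deg \<Lambda> x))) {t \<in> deg_box (deg \<Lambda> x). cls x t \<in> topspace RX - C}"
        unfolding eq using cl'[OF x] by (intro openin_open_Int) (simp add: closed_def)
    qed blast
    then show ?thesis using C by (simp add: closedin_def)
  qed
qed

end

section \<open>Chain complexes of abelian groups\<close>

text \<open>The images of the elements of a coset all lie in one coset, so that \<open>the_elem\<close> picks this one.\<close>

lemma quotient_map_coset:
  assumes A: "comm_group A" and B: "comm_group B" and N: "subgroup N A" and M: "subgroup M B"
    and f: "f \<in> hom A B" and fN: "f ` N \<subseteq> M" and a: "a \<in> carrier A"
  shows "quotient_map_on_cosets B M f (N #>\<^bsub>A\<^esub> a) = M #>\<^bsub>B\<^esub> f a"
proof -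
  interpret A: comm_group A by (rule A)
  interpret B: comm_group B by (rule B)
  have "M #>\<^bsub>B\<^esub> f z = M #>\<^bsub>B\<^esub> f a" if "z \<in> N #>\<^bsub>A\<^esub> a" for z
  proof -
    from that obtain n where n: "n \<in> N" "z = n \<otimes>\<^bsub>A\<^esub> a" by (auto simp: r_coset_def)
    have "f z = f n \<otimes>\<^bsub>B\<^esub> f a"
      unfolding n(2) by (rule hom_mult[OF f subgroup.mem_carrier[OF N n(1)] a])
    then have "f z \<in> M #>\<^bsub>B\<^esub> f a" unfolding r_coset_def using fN n(1) by blast
    then show ?thesis by (rule B.repr_independence[OF _ hom_in_carrier[OF f a] M, symmetric])
  qed
  moreover have "a \<in> N #>\<^bsub>A\<^esub> a" by (rule A.rcos_self[OF a N])
  ultimately have "(\<lambda>z. M #>\<^bsub>B\<^esub> f z) ` (N #>\<^bsub>A\<^esub> a) = {M #>\<^bsub>B\<^esub> f a}" by blast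
  then show ?thesis unfolding quotient_map_on_cosets_def by simp
qed

lemma quotient_map_hom:
  assumes A: "comm_group A" and B: "comm_group B" and N: "subgroup N A" and M: "subgroup M B"
    and f: "f \<in> hom A B" and fN: "f ` N \<subseteq> M"
  shows "quotient_map_on_cosets B M f \<in> hom (A Mod N) (B Mod M)"
proof -
  interpret A: comm_group A by (rule A)
  interpret B: comm_group B by (rule B)
  interpret N: normal N A by (rule A.subgroup_imp_normal[OF N])
  interpret M: normal M B by (rule B.subgroup_imp_normal[OF M])
  note q = quotient_map_coset[OF A B N M f fN]
  show ?thesis
  proof (rule homI)
    fix x assume "x \<in> carrier (A Mod N)"
    then obtain a where a: "a \<in> carrier A" "x = N #>\<^bsub>A\<^esub> a" unfolding carrier_FactGroup by blast
    show "quotient_map_on_cosets B M f x \<in> carrier (B Mod M)"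
      unfolding a(2) q[OF a(1)] carrier_FactGroup using hom_in_carrier[OF f a(1)] by blast
    fix y assume "y \<in> carrier (A Mod N)"
    then obtain b where b: "b \<in> carrier A" "y = N #>\<^bsub>A\<^esub> b" unfolding carrier_FactGroup by blast
    show "quotient_map_on_cosets B M f (x \<otimes>\<^bsub>A Mod N\<^esub> y)
      = quotient_map_on_cosets B M f x \<otimes>\<^bsub>B Mod M\<^esub> quotient_map_on_cosets B M f y"
      unfolding a(2) b(2) mult_FactGroup N.rcos_sum[OF a(1) b(1)] q[OF a(1)] q[OF b(1)]
        q[OF A.m_closed[OF a(1) b(1)]] hom_mult[OF f a(1) b(1)]
        M.rcos_sum[OF hom_in_carrier[OF f a(1)] hom_in_carrier[OF f b(1)]] ..
  qed
qed

locale chain_complex =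
  fixes C :: "nat \<Rightarrow> ('a, 'm) monoid_scheme" and D :: "nat \<Rightarrow> 'a \<Rightarrow> 'a"
  assumes comm: "comm_group (C n)" and D_hom: "D n \<in> hom (C n) (C (n - 1))"
    and D_D: "x \<in> carrier (C (Suc n)) \<Longrightarrow> D n (D (Suc n) x) = \<one>\<^bsub>C (n - 1)\<^esub>"
begin

definition cycles :: "nat \<Rightarrow> 'a set" where
  "cycles r = kernel (C r) (C (r - 1)) (D r)"

lemma cycles_iff: "z \<in> cycles r \<longleftrightarrow> z \<in> carrier (C r) \<and> D r z = \<one>\<^bsub>C (r - 1)\<^esub>"
  by (simp add: cycles_def kernel_def)

lemma D_group_hom: "group_hom (C n) (C (n - 1)) (D n)"
  using comm_group.axioms(2)[OF comm] D_hom by (simp add: group_hom_def group_hom_axioms_def)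

lemma cycles_subgroup: "subgroup (cycles r) (C r)"
  unfolding cycles_def by (rule group_hom.subgroup_kernel[OF D_group_hom])

lemma boundary_cycles: "boundary_set C D r \<subseteq> cycles r"
proof
  fix z assume "z \<in> boundary_set C D r"
  then obtain x where x: "x \<in> carrier (C (Suc r))" "z = D (Suc r) x" unfolding boundary_set_def by blast
  have "z \<in> carrier (C r)" unfolding x(2) using hom_in_carrier[OF D_hom x(1)] by simp
  then show "z \<in> cycles r" unfolding cycles_iff using D_D[OF x(1)] x(2) by simp
qed

lemma cycle_group_comm: "comm_group (C r\<lparr>carrier := cycles r\<rparr>)"
proof (rule group.group_comm_groupI)
  show "group (C r\<lparr>carrier := cycles r\<rparr>)"
    by (rule group.subgroup_imp_group[OF comm_group.axioms(2)[OF comm] cycles_subgroup])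
  fix x y assume "x \<in> carrier (C r\<lparr>carrier := cycles r\<rparr>)" "y \<in> carrier (C r\<lparr>carrier := cycles r\<rparr>)"
  then show "x \<otimes>\<^bsub>C r\<lparr>carrier := cycles r\<rparr>\<^esub> y = y \<otimes>\<^bsub>C r\<lparr>carrier := cycles r\<rparr>\<^esub> x"
    using comm_monoid.m_comm[OF comm_group.axioms(1)[OF comm]] by (simp add: cycles_iff)
qed

lemma boundary_subgroup: "subgroup (boundary_set C D r) (C r\<lparr>carrier := cycles r\<rparr>)"
proof (rule group.subgroup_incl[OF comm_group.axioms(2)[OF comm] _ cycles_subgroup boundary_cycles])
  show "subgroup (boundary_set C D r) (C r)"
    using group_hom.img_is_subgroup[OF D_group_hom[of "Suc r"]] by (simp add: boundary_set_def)
qed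

lemma homology_eq: "chain_homology C D r = (C r\<lparr>carrier := cycles r\<rparr>) Mod boundary_set C D r"
  by (simp add: chain_homology_def cycles_def)

lemma homology_comm: "comm_group (chain_homology C D r)"
  unfolding homology_eq by (rule comm_group.abelian_FactGroup[OF cycle_group_comm boundary_subgroup])

lemma homology_carrier:
  "carrier (chain_homology C D r) = (\<lambda>z. boundary_set C D r #>\<^bsub>C r\<^esub> z) ` cycles r"
  unfolding homology_eq carrier_FactGroup by (simp add: r_coset_def)

end

locale chain_complex_map = S: chain_complex C D + T: chain_complex C' D'
  for C :: "nat \<Rightarrow> ('a, 'm) monoid_scheme" and D :: "nat \<Rightarrow> 'a \<Rightarrow> 'a"
    and C' :: "nat \<Rightarrow> ('b, 'n) monoid_scheme" and D' :: "nat \<Rightarrow> 'b \<Rightarrow> 'b" +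
  fixes f :: "nat \<Rightarrow> 'a \<Rightarrow> 'b"
  assumes f_hom: "f n \<in> hom (C n) (C' n)"
    and f_D: "x \<in> carrier (C n) \<Longrightarrow> f (n - 1) (D n x) = D' n (f n x)"
begin

lemma f_cycles: "z \<in> S.cycles r \<Longrightarrow> f r z \<in> T.cycles r"
  using hom_in_carrier[OF f_hom] f_D[of z r]
    hom_one[OF f_hom comm_group.axioms(2)[OF S.comm] comm_group.axioms(2)[OF T.comm], of "r - 1"]
  by (simp add: S.cycles_iff T.cycles_iff)

lemma f_cycle_hom: "f r \<in> hom (C r\<lparr>carrier := S.cycles r\<rparr>) (C' r\<lparr>carrier := T.cycles r\<rparr>)"
  by (rule homI) (use f_cycles hom_mult[OF f_hom] in \<open>simp_all add: S.cycles_iff\<close>)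

lemma f_boundary: "f r ` boundary_set C D r \<subseteq> boundary_set C' D' r"
proof
  fix y assume "y \<in> f r ` boundary_set C D r"
  then obtain x where x: "x \<in> carrier (C (Suc r))" "y = f r (D (Suc r) x)" unfolding boundary_set_def by blast
  then have "y = D' (Suc r) (f (Suc r) x)" using f_D[OF x(1)] by simp
  then show "y \<in> boundary_set C' D' r"
    unfolding boundary_set_def using hom_in_carrier[OF f_hom x(1)] by blast
qed

lemma homology_map_eq:
  "chain_homology_map C' D' f r
   = quotient_map_on_cosets (C' r\<lparr>carrier := T.cycles r\<rparr>) (boundary_set C' D' r) (f r)"
  by (simp add: chain_homology_map_def quotient_map_on_cosets_def r_coset_def)

lemma homology_map_class:
  assumes "z \<in> S.cycles r"
  shows "chain_homology_map C' D' f r (boundary_set C D r #>\<^bsub>C r\<^esub> z) = boundary_set C' D' r #>\<^bsub>C' r\<^esub> f r z"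
  unfolding homology_map_eq
  using quotient_map_coset[OF S.cycle_group_comm T.cycle_group_comm S.boundary_subgroup T.boundary_subgroup
      f_cycle_hom f_boundary, of z] assms by (simp add: r_coset_def)

text \<open>The kernel of the induced map is trivial by \<open>inj\<close>, and by \<open>surj\<close> every cycle is homologous to an image.\<close>

theorem homology_map_iso:
  assumes surj: "\<And>z. z \<in> T.cycles r \<Longrightarrow> \<exists>a\<in>S.cycles r. z \<in> boundary_set C' D' r #>\<^bsub>C' r\<^esub> f r a"
    and inj: "\<And>a. \<lbrakk>a \<in> S.cycles r; f r a \<in> boundary_set C' D' r\<rbrakk> \<Longrightarrow> a \<in> boundary_set C D r"
  shows "chain_homology_map C' D' f r \<in> iso (chain_homology C D r) (chain_homology C' D' r)"
proof -
  let ?h = "chain_homology_map C' D' f r" and ?G = "chain_homology C D r" and ?H = "chain_homology C' D' r"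
  let ?B = "boundary_set C D r" and ?B' = "boundary_set C' D' r"
  have G: "group ?G" "group ?H" using S.homology_comm T.homology_comm by (simp_all add: comm_group_def)
  have hom: "?h \<in> hom ?G ?H"
    unfolding S.homology_eq T.homology_eq homology_map_eq
    by (rule quotient_map_hom[OF S.cycle_group_comm T.cycle_group_comm S.boundary_subgroup
          T.boundary_subgroup f_cycle_hom f_boundary])
  have one: "\<one>\<^bsub>?G\<^esub> = ?B" "\<one>\<^bsub>?H\<^esub> = ?B'" unfolding S.homology_eq T.homology_eq by simp_all
  have "x = \<one>\<^bsub>?G\<^esub>" if x: "x \<in> carrier ?G" "?h x = \<one>\<^bsub>?H\<^esub>" for x
  proof -
    obtain z where z: "z \<in> S.cycles r" "x = ?B #>\<^bsub>C r\<^esub> z" using x(1) unfolding S.homology_carrier by blast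
    have "?B' #>\<^bsub>C' r\<lparr>carrier := T.cycles r\<rparr>\<^esub> f r z = ?B'"
      using x(2) unfolding z(2) homology_map_class[OF z(1)] one(2) by (simp add: r_coset_def)
    then have "f r z \<in> ?B'"
      by (rule group.coset_join1[OF comm_group.axioms(2)[OF T.cycle_group_comm] _ _ T.boundary_subgroup])
        (simp add: f_cycles[OF z(1)])
    then have "z \<in> ?B" by (rule inj[OF z(1)])
    then have "?B #>\<^bsub>C r\<lparr>carrier := S.cycles r\<rparr>\<^esub> z = ?B"
      by (rule group.coset_join2[OF comm_group.axioms(2)[OF S.cycle_group_comm] _ S.boundary_subgroup, rotated])
        (simp add: z(1))
    then show ?thesis unfolding z(2) one(1) by (simp add: r_coset_def)
  qed
  then have ker: "kernel ?G ?H ?h = {\<one>\<^bsub>?G\<^esub>}"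
    using hom_one[OF hom G] group.is_monoid[OF G(1), THEN monoid.one_closed] unfolding kernel_def by blast
  have "y \<in> ?h ` carrier ?G" if y: "y \<in> carrier ?H" for y
  proof -
    obtain z where z: "z \<in> T.cycles r" "y = ?B' #>\<^bsub>C' r\<^esub> z" using y unfolding T.homology_carrier by blast
    obtain a where a: "a \<in> S.cycles r" "z \<in> ?B' #>\<^bsub>C' r\<^esub> f r a" using surj[OF z(1)] by blast
    have "?B' #>\<^bsub>C' r\<lparr>carrier := T.cycles r\<rparr>\<^esub> f r a = ?B' #>\<^bsub>C' r\<lparr>carrier := T.cycles r\<rparr>\<^esub> z"
      by (rule group.repr_independence[OF comm_group.axioms(2)[OF T.cycle_group_comm] _ _ T.boundary_subgroup])
        (use a f_cycles in \<open>simp_all add: r_coset_def\<close>)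
    then have "y = ?h (?B #>\<^bsub>C r\<^esub> a)" unfolding z(2) homology_map_class[OF a(1)] by (simp add: r_coset_def)
    then show ?thesis unfolding S.homology_carrier using a(1) by blast
  qed
  then have "?h ` carrier ?G = carrier ?H" using hom_in_carrier[OF hom] by blast
  then show ?thesis using iso_kernel_image[OF G] hom ker by blast
qed

end

section \<open>Singular chains modulo degenerate chains\<close>

abbreviation cubcl :: "'x topology \<Rightarrow> nat \<Rightarrow> 'x cube_chain \<Rightarrow> 'x cube_chain set" where
  "cubcl X r c \<equiv> degenerate_chains X r #>\<^bsub>all_cubes_group X r\<^esub> c"

lemma carrier_cubes: "carrier (all_cubes_group X r) = chains (scubes r X)"
  by (auto simp: all_cubes_group_def chains_def scubes_def)

lemma degenerate_chains_eq: "degenerate_chains X r = chains (relc r X {})"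
  by (auto simp: degenerate_chains_def chains_def relc_empty)

lemma comm_cubes: "comm_group (all_cubes_group X r)"
  unfolding all_cubes_group_def by (rule abelian_free_Abelian_group)

lemma mult_cubes: "x \<otimes>\<^bsub>all_cubes_group X r\<^esub> y = x + y"
  by (simp add: all_cubes_group_def)

lemma degenerate_subgroup: "subgroup (degenerate_chains X r) (all_cubes_group X r)"
proof
  show sub: "degenerate_chains X r \<subseteq> carrier (all_cubes_group X r)"
    unfolding carrier_cubes degenerate_chains_eq using chains_mono relc_subset by blast
  show "inv\<^bsub>all_cubes_group X r\<^esub> x \<in> degenerate_chains X r" if "x \<in> degenerate_chains X r" for x
  proof -
    have "Poly_Mapping.keys x \<subseteq> {T. singular_cube r X T}"
      using subsetD[OF sub that] unfolding all_cubes_group_def carrier_free_Abelian_group_iff .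
    then have "inv\<^bsub>all_cubes_group X r\<^esub> x = - x"
      unfolding all_cubes_group_def by (rule inv_free_Abelian_group)
    then show ?thesis using that by (simp add: degenerate_chains_eq)
  qed
qed (auto simp: mult_cubes degenerate_chains_eq chains_add all_cubes_group_def)

lemma cubcl_eq: "cubcl X r c = cubcl X r d \<longleftrightarrow> c - d \<in> degenerate_chains X r"
proof
  assume eq: "cubcl X r c = cubcl X r d"
  have "c \<in> cubcl X r c" by (force simp: r_coset_def mult_cubes degenerate_chains_eq)
  then obtain n where "n \<in> degenerate_chains X r" "c = n + d"
    unfolding eq by (auto simp: r_coset_def mult_cubes)
  then show "c - d \<in> degenerate_chains X r" by simp
next
  have sub: "cubcl X r c \<subseteq> cubcl X r d" if cd: "c - d \<in> degenerate_chains X r" for c d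
  proof
    fix x assume "x \<in> cubcl X r c"
    then obtain n where n: "n \<in> degenerate_chains X r" "x = n + c" by (auto simp: r_coset_def mult_cubes)
    have "n + (c - d) \<in> degenerate_chains X r"
      using n(1) cd unfolding degenerate_chains_eq by (rule chains_add)
    moreover have "x = (n + (c - d)) + d" unfolding n(2) by simp
    ultimately show "x \<in> cubcl X r d" unfolding r_coset_def mult_cubes by blast
  qed
  assume cd: "c - d \<in> degenerate_chains X r"
  then have "- (c - d) \<in> degenerate_chains X r" by (simp only: degenerate_chains_eq chains_minus)
  then have "d - c \<in> degenerate_chains X r" by simp
  then show "cubcl X r c = cubcl X r d" using sub cd by blast
qed

lemma cubcl_0: "cubcl X r 0 = degenerate_chains X r"
  by (auto simp: r_coset_def mult_cubes)

lemma cubcl_degenerate: "cubcl X r c = degenerate_chains X r \<longleftrightarrow> c \<in> degenerate_chains X r"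
  using cubcl_eq[of X r c 0] by (simp add: cubcl_0)

lemma carrier_cubical: "carrier (cubical_chain_group X r) = cubcl X r ` chains (scubes r X)"
  unfolding cubical_chain_group_def carrier_FactGroup carrier_cubes ..

lemma one_cubical: "\<one>\<^bsub>cubical_chain_group X r\<^esub> = degenerate_chains X r"
  by (simp add: cubical_chain_group_def)

lemma comm_cubical: "comm_group (cubical_chain_group X r)"
  unfolding cubical_chain_group_def by (rule comm_group.abelian_FactGroup[OF comm_cubes degenerate_subgroup])

lemma cubcl_hom: "cubcl X r \<in> hom (all_cubes_group X r) (cubical_chain_group X r)"
  unfolding cubical_chain_group_def
  by (rule normal.r_coset_hom_Mod[OF comm_group.subgroup_imp_normal[OF comm_cubes degenerate_subgroup]])

lemma sbd_hom: "sbd r \<in> hom (all_cubes_group X r) (all_cubes_group X (r - 1))"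
  by (rule homI) (simp_all only: carrier_cubes mult_cubes sbd_add sbd_scubes)

lemma sbd_degenerate_chains: "sbd r ` degenerate_chains X r \<subseteq> degenerate_chains X (r - 1)"
  unfolding degenerate_chains_eq using sbd_relc by blast

lemma cubical_boundary_eq:
  "cubical_boundary X r = quotient_map_on_cosets (all_cubes_group X (r - 1)) (degenerate_chains X (r - 1)) (sbd r)"
  by (simp add: cubical_boundary_def sbd_def)

lemma cubical_boundary_cubcl:
  "c \<in> chains (scubes r X) \<Longrightarrow> cubical_boundary X r (cubcl X r c) = cubcl X (r - 1) (sbd r c)"
  unfolding cubical_boundary_eq
  by (rule quotient_map_coset[OF comm_cubes comm_cubes degenerate_subgroup degenerate_subgroup sbd_hom
        sbd_degenerate_chains]) (simp only: carrier_cubes)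

lemma cubical_chain_complex: "chain_complex (cubical_chain_group X) (cubical_boundary X)"
proof (rule chain_complex.intro)
  show "comm_group (cubical_chain_group X n)" for n by (rule comm_cubical)
  show "cubical_boundary X n \<in> hom (cubical_chain_group X n) (cubical_chain_group X (n - 1))" for n
    unfolding cubical_boundary_eq cubical_chain_group_def
    by (rule quotient_map_hom[OF comm_cubes comm_cubes degenerate_subgroup degenerate_subgroup sbd_hom
        sbd_degenerate_chains])
  show "cubical_boundary X n (cubical_boundary X (Suc n) x) = \<one>\<^bsub>cubical_chain_group X (n - 1)\<^esub>"
    if x: "x \<in> carrier (cubical_chain_group X (Suc n))" for n x
  proof -
    obtain c where c: "c \<in> chains (scubes (Suc n) X)" "x = cubcl X (Suc n) c"
      using x unfolding carrier_cubical by blast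
    have "sbd (Suc n) c \<in> chains (scubes n X)" using sbd_scubes[OF c(1)] by simp
    then show ?thesis
      unfolding c(2) cubical_boundary_cubcl[OF c(1)] diff_Suc_1 one_cubical
      by (simp only: cubical_boundary_cubcl sbd_sbd cubcl_0)
  qed
qed

lemma cubical_chain_map_cubcl:
  assumes "continuous_map X Y f" "c \<in> chains (scubes r X)"
  shows "cubical_chain_map Y f r (cubcl X r c) = cubcl Y r (pushc r f c)"
    and cubical_chain_map_hom: "cubical_chain_map Y f r \<in> hom (cubical_chain_group X r) (cubical_chain_group Y r)"
proof -
  have eq: "cubical_chain_map Y f r = quotient_map_on_cosets (all_cubes_group Y r) (degenerate_chains Y r) (pushc r f)"
    by (simp add: cubical_chain_map_def pushc_def push_def)
  have hom: "pushc r f \<in> hom (all_cubes_group X r) (all_cubes_group Y r)"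
    by (rule homI) (simp_all only: carrier_cubes mult_cubes pushc_add pushc_scubes[OF _ assms(1)])
  have deg: "pushc r f ` degenerate_chains X r \<subseteq> degenerate_chains Y r"
    unfolding degenerate_chains_eq using pushc_relc[OF _ assms(1), of _ r "{}" "{}"] by blast
  show "cubical_chain_map Y f r (cubcl X r c) = cubcl Y r (pushc r f c)"
    unfolding eq
    by (rule quotient_map_coset[OF comm_cubes comm_cubes degenerate_subgroup degenerate_subgroup hom deg])
      (simp only: carrier_cubes assms(2))
  show "cubical_chain_map Y f r \<in> hom (cubical_chain_group X r) (cubical_chain_group Y r)"
    unfolding eq cubical_chain_group_def
    by (rule quotient_map_hom[OF comm_cubes comm_cubes degenerate_subgroup degenerate_subgroup hom deg])
qed

lemma cubical_chain_map:
  assumes "continuous_map X Y f"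
  shows "chain_complex_map (cubical_chain_group X) (cubical_boundary X) (cubical_chain_group Y)
    (cubical_boundary Y) (cubical_chain_map Y f)"
proof (rule chain_complex_map.intro[OF cubical_chain_complex cubical_chain_complex], rule chain_complex_map_axioms.intro)
  show "cubical_chain_map Y f n \<in> hom (cubical_chain_group X n) (cubical_chain_group Y n)" for n
    by (rule cubical_chain_map_hom[OF assms chains_zero])
  show "cubical_chain_map Y f (n - 1) (cubical_boundary X n x) = cubical_boundary Y n (cubical_chain_map Y f n x)"
    if x: "x \<in> carrier (cubical_chain_group X n)" for n x
  proof -
    obtain c where c: "c \<in> chains (scubes n X)" "x = cubcl X n c" using x unfolding carrier_cubical by blast
    show ?thesis
      unfolding c(2) cubical_boundary_cubcl[OF c(1)] cubical_chain_map_cubcl[OF assms c(1)]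
        cubical_chain_map_cubcl[OF assms sbd_scubes[OF c(1)]]
        cubical_boundary_cubcl[OF pushc_scubes[OF c(1) assms]] sbd_pushc ..
  qed
qed

section \<open>The comparison map\<close>

text \<open>Positions in the sorted list of directions are ranks, which translates between the numbering of
  directions by position and the cells' directions themselves.\<close>

lemma nth_sorted:
  assumes "finite E" "m < card E"
  shows "sorted_list_of_set E ! m \<in> E" and "rank E (sorted_list_of_set E ! m) = m"
proof -
  let ?l = "sorted_list_of_set E"
  have len: "length ?l = card E" and set: "set ?l = E" using assms(1) by simp_all
  show "?l ! m \<in> E" using nth_mem[of m ?l] assms(2) len set by simp
  have mono: "?l ! p < ?l ! q" if "p < q" "q < card E" for p q
    using sorted_wrt_nth_less[OF strict_sorted_list_of_set that(1)] that(2) len by simp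
  have "{j \<in> E. j < ?l ! m} = (!) ?l ` {..<m}"
  proof (rule subset_antisym; rule subsetI)
    fix j assume j: "j \<in> {j \<in> E. j < ?l ! m}"
    then have "j \<in> set ?l" using set by simp
    then obtain p where p: "p < card E" "j = ?l ! p" unfolding in_set_conv_nth len by blast
    have "p < m"
    proof (rule ccontr)
      assume "\<not> p < m"
      then have "p = m \<or> m < p" by auto
      then have "?l ! m \<le> j" unfolding p(2) using mono[OF _ p(1), of m] by auto
      then show False using j by simp
    qed
    then show "j \<in> (!) ?l ` {..<m}" using p(2) by blast
  next
    fix j assume "j \<in> (!) ?l ` {..<m}"
    then obtain p where p: "p < m" "j = ?l ! p" by blast
    then show "j \<in> {j \<in> E. j < ?l ! m}"
      using mono[OF p(1) assms(2)] nth_mem[of p ?l] assms(2) len set by simp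
  qed
  moreover have "inj_on ((!) ?l) {..<m}"
    by (rule inj_onI) (use assms(2) len nth_eq_iff_index_eq[OF distinct_sorted_list_of_set, of _ E] in simp)
  ultimately show "rank E (?l ! m) = m" unfolding rank_def by (simp add: card_image)
qed

context k_graph
begin

interpretation cc: cubical_complex k RX cubes dirs face cls
  by (rule realisation_complex)

lemma kcubes_eq: "kcubes k \<Lambda> r = cc.cells r"
proof -
  have "(\<Sum>i<k. deg \<Lambda> x i) = card (dirs x)" if x: "x \<in> cubes" for x
  proof -
    have "(\<Sum>i<k. deg \<Lambda> x i) = (\<Sum>i<k. if i \<in> dirs x then 1 else 0)"
      by (rule sum.cong[OF refl]) (rule cubes_deg[OF x])
    also have "\<dots> = card ({..<k} \<inter> dirs x)" by (simp add: sum.If_cases)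
    also have "{..<k} \<inter> dirs x = dirs x" using cc.D_sub[OF x] by blast
    finally show ?thesis .
  qed
  then show ?thesis unfolding kcubes_def cc.cells_def by (auto simp: cubes_def)
qed

lemma kcubesD: "x \<in> kcubes k \<Lambda> r \<Longrightarrow> x \<in> cubes \<and> finite (dirs x) \<and> card (dirs x) = r"
  using cc.D_finite unfolding kcubes_eq cc.cells_def by blast

lemma dir_eq: "dir \<Lambda> x j = sorted_list_of_set (dirs x) ! j"
  by (simp add: dir_def dirs_def)

lemma dir_in:
  assumes "x \<in> kcubes k \<Lambda> r" "j < r" shows "dir \<Lambda> x j \<in> dirs x" and "rank (dirs x) (dir \<Lambda> x j) = j"
  using nth_sorted[of "dirs x" j] kcubesD[OF assms(1)] assms(2) unfolding dir_eq by simp_all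

lemma dir_point:
  assumes x: "x \<in> kcubes k \<Lambda> r"
  shows "(\<lambda>i. \<Sum>m<r. t m * real (unit_vec (dir \<Lambda> x m) i)) = emb (dirs x) t"
proof (rule ext)
  fix i
  have E: "finite (dirs x)" "card (dirs x) = r" using kcubesD[OF x] by simp_all
  show "(\<Sum>m<r. t m * real (unit_vec (dir \<Lambda> x m) i)) = emb (dirs x) t i"
  proof (cases "i \<in> dirs x")
    case True
    have iff: "i = dir \<Lambda> x m \<longleftrightarrow> m = rank (dirs x) i" if "m < r" for m
      using dir_in[OF x that] rank_inj[OF E(1)] True unfolding inj_on_def by metis
    have "(\<Sum>m<r. t m * real (unit_vec (dir \<Lambda> x m) i)) = (\<Sum>m<r. if m = rank (dirs x) i then t m else 0)"
      by (rule sum.cong[OF refl]) (use iff in \<open>simp add: unit_vec_def\<close>)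
    also have "\<dots> = t (rank (dirs x) i)" using rank_less_card[OF E(1) True] E(2) by simp
    finally show ?thesis using True by (simp add: emb_def)
  next
    case False
    have "unit_vec (dir \<Lambda> x m) i = 0" if "m < r" for m
      using dir_in(1)[OF x that] False by (auto simp: unit_vec_def)
    then show ?thesis using False by (simp add: emb_def)
  qed
qed

lemma iota_eq: "x \<in> kcubes k \<Lambda> r \<Longrightarrow> iota k \<Lambda> r x = cell_cube dirs cls x"
  using kcubesD[of x r] unfolding iota_def cell_cube_def by (simp add: dir_point)

text \<open>The sum over positions is reindexed by directions; the sign for \<open>l = 1\<close> turns into a difference.\<close>

lemma kboundary_eq:
  assumes "a \<in> chains (kcubes k \<Lambda> r)" shows "kboundary \<Lambda> r a = kbd dirs face a"
  unfolding kboundary_def kbd_def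
proof (rule frag_extend_eq_on[OF assms])
  fix x assume x: "x \<in> kcubes k \<Lambda> r"
  let ?g = "\<lambda>i. frag_cmul ((-1) ^ Suc (rank (dirs x) i)) (frag_of (face 0 i x) - frag_of (face 1 i x))"
  have E: "finite (dirs x)" "card (dirs x) = r" using kcubesD[OF x] by simp_all
  have face: "kface \<Lambda> l j x = face l (dir \<Lambda> x j) x" for l j by (simp add: kface_def face_def)
  have "(\<Sum>l\<in>{0,1}. \<Sum>j<r. frag_cmul ((-1) ^ (Suc j + l)) (frag_of (kface \<Lambda> l j x)))
    = (\<Sum>j<r. frag_cmul ((-1) ^ Suc j) (frag_of (kface \<Lambda> 0 j x)) + frag_cmul ((-1) ^ (Suc j + 1)) (frag_of (kface \<Lambda> 1 j x)))"
    by (simp add: sum.distrib)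
  also have "\<dots> = (\<Sum>j<r. ?g (dir \<Lambda> x j))"
    by (rule sum.cong[OF refl]) (simp add: dir_in(2)[OF x] face frag_cmul_diff)
  also have "\<dots> = (\<Sum>i\<in>dirs x. ?g i)"
    by (rule sum.reindex_bij_betw) (use bij_betw_nth[of "sorted_list_of_set (dirs x)" "{..<r}" "dirs x"] E in \<open>simp add: dir_eq\<close>)
  finally show "(\<Sum>l\<in>{0,1}. \<Sum>j<r. frag_cmul ((-1) ^ (Suc j + l)) (frag_of (kface \<Lambda> l j x))) = (\<Sum>i\<in>dirs x. ?g i)" .
qed

lemma carrier_kchain: "carrier (kchain_group k \<Lambda> r) = chains (kcubes k \<Lambda> r)"
  by (auto simp: kchain_group_def chains_def)

lemma Phi_eq: "a \<in> chains (kcubes k \<Lambda> r) \<Longrightarrow> Phi k \<Lambda> r a = cubcl RX r (cellc dirs cls a)"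
  unfolding Phi_def cellc_def by (subst frag_extend_eq_on) (auto simp: iota_eq)

lemma cellc_RX: "a \<in> chains (kcubes k \<Lambda> r) \<Longrightarrow> cellc dirs cls a \<in> chains (scubes r RX)"
  unfolding kcubes_eq by (rule cc.cellc_scubes)

lemma kboundary_chains: "a \<in> chains (kcubes k \<Lambda> r) \<Longrightarrow> kboundary \<Lambda> r a \<in> chains (kcubes k \<Lambda> (r - 1))"
  using kboundary_eq cc.kbd_cells unfolding kcubes_eq by simp

lemma kgraph_chain_complex: "chain_complex (kchain_group k \<Lambda>) (kboundary \<Lambda>)"
proof (rule chain_complex.intro)
  show "comm_group (kchain_group k \<Lambda> n)" for n
    unfolding kchain_group_def by (rule abelian_free_Abelian_group)
  show "kboundary \<Lambda> n \<in> hom (kchain_group k \<Lambda> n) (kchain_group k \<Lambda> (n - 1))" for n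
  proof (rule homI)
    show "kboundary \<Lambda> n (x \<otimes>\<^bsub>kchain_group k \<Lambda> n\<^esub> y) = kboundary \<Lambda> n x \<otimes>\<^bsub>kchain_group k \<Lambda> (n - 1)\<^esub> kboundary \<Lambda> n y" for x y
      by (simp add: kchain_group_def kboundary_def frag_extend_add)
  qed (simp only: carrier_kchain kboundary_chains)
  show "kboundary \<Lambda> n (kboundary \<Lambda> (Suc n) x) = \<one>\<^bsub>kchain_group k \<Lambda> (n - 1)\<^esub>"
    if x: "x \<in> carrier (kchain_group k \<Lambda> (Suc n))" for n x
  proof -
    have x': "x \<in> chains (kcubes k \<Lambda> (Suc n))" using x by (simp only: carrier_kchain)
    have "kboundary \<Lambda> n (kboundary \<Lambda> (Suc n) x) = kbd dirs face (kbd dirs face x)"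
      using kboundary_eq[OF kboundary_chains[OF x']] kboundary_eq[OF x'] by simp
    also have "\<dots> = 0" by (rule cc.kbd_kbd[OF x'[unfolded kcubes_eq]])
    finally show ?thesis by (simp add: kchain_group_def)
  qed
qed

lemma Phi_chain_map:
  "chain_complex_map (kchain_group k \<Lambda>) (kboundary \<Lambda>) (cubical_chain_group RX) (cubical_boundary RX) (Phi k \<Lambda>)"
proof (rule chain_complex_map.intro[OF kgraph_chain_complex cubical_chain_complex], rule chain_complex_map_axioms.intro)
  show "Phi k \<Lambda> n \<in> hom (kchain_group k \<Lambda> n) (cubical_chain_group RX n)" for n
  proof (rule homI)
    fix x assume x: "x \<in> carrier (kchain_group k \<Lambda> n)"
    then have x': "x \<in> chains (kcubes k \<Lambda> n)" by (simp only: carrier_kchain)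
    have sx: "cellc dirs cls x \<in> chains (scubes n RX)" by (rule cellc_RX[OF x'])
    then show "Phi k \<Lambda> n x \<in> carrier (cubical_chain_group RX n)"
      unfolding Phi_eq[OF x'] carrier_cubical by (rule imageI)
    fix y assume "y \<in> carrier (kchain_group k \<Lambda> n)"
    then have y': "y \<in> chains (kcubes k \<Lambda> n)" by (simp only: carrier_kchain)
    have sy: "cellc dirs cls y \<in> chains (scubes n RX)" by (rule cellc_RX[OF y'])
    have xy: "x \<otimes>\<^bsub>kchain_group k \<Lambda> n\<^esub> y = x + y" by (simp add: kchain_group_def)
    show "Phi k \<Lambda> n (x \<otimes>\<^bsub>kchain_group k \<Lambda> n\<^esub> y) = Phi k \<Lambda> n x \<otimes>\<^bsub>cubical_chain_group RX n\<^esub> Phi k \<Lambda> n y"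
      unfolding xy Phi_eq[OF x'] Phi_eq[OF y'] Phi_eq[OF chains_add[OF x' y']] cellc_add
      using hom_mult[OF cubcl_hom[of RX n], of "cellc dirs cls x" "cellc dirs cls y"] sx sy
      unfolding carrier_cubes mult_cubes by simp
  qed
  show "Phi k \<Lambda> (n - 1) (kboundary \<Lambda> n x) = cubical_boundary RX n (Phi k \<Lambda> n x)"
    if x: "x \<in> carrier (kchain_group k \<Lambda> n)" for n x
  proof -
    have x': "x \<in> chains (kcubes k \<Lambda> n)" using x by (simp only: carrier_kchain)
    have "cubical_boundary RX n (Phi k \<Lambda> n x) = cubcl RX (n - 1) (sbd n (cellc dirs cls x))"
      unfolding Phi_eq[OF x'] by (rule cubical_boundary_cubcl[OF cellc_RX[OF x']])
    also have "\<dots> = Phi k \<Lambda> (n - 1) (kboundary \<Lambda> n x)"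
      unfolding Phi_eq[OF kboundary_chains[OF x']]
      by (simp only: cc.sbd_cellc[OF x'[unfolded kcubes_eq]] kboundary_eq[OF x'])
    finally show ?thesis by (rule sym)
  qed
qed

text \<open>Surjectivity is exactness for a singular cycle and \<open>a = 0\<close>. For injectivity, exactness one degree
  higher is applied to a chain whose boundary is the image of \<open>a\<close>, and produces a cellular chain with
  boundary \<open>a\<close>.\<close>

theorem Phi_star_iso: "Phi_star k \<Lambda> r \<in> iso (kgraph_homology k \<Lambda> r) (cubical_homology RX r)"
proof -
  interpret P: chain_complex_map "kchain_group k \<Lambda>" "kboundary \<Lambda>" "cubical_chain_group RX" "cubical_boundary RX" "Phi k \<Lambda>"
    by (rule Phi_chain_map)
  have exact: "cell_exact RX cubes dirs face cls"
    by (rule cubical_complex_exact[OF realisation_complex])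
  have cells: "{x \<in> cubes. card (dirs x) = n} = kcubes k \<Lambda> n" for n
    unfolding kcubes_eq cc.cells_def ..
  have cycle: "a \<in> P.S.cycles r \<longleftrightarrow> a \<in> chains (kcubes k \<Lambda> r) \<and> kbd dirs face a = 0" for a
    unfolding P.S.cycles_iff carrier_kchain using kboundary_eq[of a r] by (auto simp: kchain_group_def)
  show ?thesis
    unfolding Phi_star_def kgraph_homology_def cubical_homology_def
  proof (rule P.homology_map_iso)
    fix z assume "z \<in> P.T.cycles r"
    then have z: "z \<in> carrier (cubical_chain_group RX r)" "cubical_boundary RX r z = degenerate_chains RX (r - 1)"
      unfolding P.T.cycles_iff one_cubical by simp_all
    from z(1) obtain c where c: "c \<in> chains (scubes r RX)" "z = cubcl RX r c" unfolding carrier_cubical by blast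
    have "sbd r c \<in> degenerate_chains RX (r - 1)"
      using z(2) unfolding c(2) cubical_boundary_cubcl[OF c(1)] cubcl_degenerate .
    then have "sbd r c - cellc dirs cls 0 \<in> chains (relc (r - 1) RX {})" by (simp add: degenerate_chains_eq)
    from cell_exactD[OF exact c(1) chains_zero kbd_0 this] obtain a b where
      ab: "a \<in> chains (kcubes k \<Lambda> r)" "b \<in> chains (scubes (Suc r) RX)" "kbd dirs face a = 0"
        "c - cellc dirs cls a - sbd (Suc r) b \<in> degenerate_chains RX r"
      unfolding cells degenerate_chains_eq by metis
    have sa: "cellc dirs cls a \<in> chains (scubes r RX)" by (rule cellc_RX[OF ab(1)])
    have sb: "sbd (Suc r) b \<in> chains (scubes r RX)" using sbd_scubes[OF ab(2)] by simp
    have "c - (sbd (Suc r) b + cellc dirs cls a) \<in> degenerate_chains RX r"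
      using ab(4) by (simp add: algebra_simps)
    then have "z = cubcl RX r (sbd (Suc r) b + cellc dirs cls a)" unfolding c(2) cubcl_eq .
    also have "\<dots> = cubcl RX r (sbd (Suc r) b) \<otimes>\<^bsub>cubical_chain_group RX r\<^esub> Phi k \<Lambda> r a"
      unfolding Phi_eq[OF ab(1)]
      using hom_mult[OF cubcl_hom[of RX r], of "sbd (Suc r) b" "cellc dirs cls a"] sa sb
      unfolding carrier_cubes mult_cubes by simp
    finally have zeq: "z = cubcl RX r (sbd (Suc r) b) \<otimes>\<^bsub>cubical_chain_group RX r\<^esub> Phi k \<Lambda> r a" .
    have "cubcl RX r (sbd (Suc r) b) = cubical_boundary RX (Suc r) (cubcl RX (Suc r) b)"
      using cubical_boundary_cubcl[OF ab(2)] by simp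
    then have "cubcl RX r (sbd (Suc r) b) \<in> boundary_set (cubical_chain_group RX) (cubical_boundary RX) r"
      unfolding boundary_set_def carrier_cubical using ab(2) by blast
    then have "z \<in> boundary_set (cubical_chain_group RX) (cubical_boundary RX) r #>\<^bsub>cubical_chain_group RX r\<^esub> Phi k \<Lambda> r a"
      unfolding r_coset_def zeq by blast
    moreover have "a \<in> P.S.cycles r" unfolding cycle using ab by simp
    ultimately show "\<exists>a\<in>P.S.cycles r. z \<in> boundary_set (cubical_chain_group RX) (cubical_boundary RX) r #>\<^bsub>cubical_chain_group RX r\<^esub> Phi k \<Lambda> r a"
      by blast
  next
    fix a assume a: "a \<in> P.S.cycles r" "Phi k \<Lambda> r a \<in> boundary_set (cubical_chain_group RX) (cubical_boundary RX) r"
    have a': "a \<in> chains (kcubes k \<Lambda> r)" "kbd dirs face a = 0" using a(1) unfolding cycle by simp_all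
    from a(2) obtain b where b: "b \<in> chains (scubes (Suc r) RX)"
      "Phi k \<Lambda> r a = cubical_boundary RX (Suc r) (cubcl RX (Suc r) b)"
      unfolding boundary_set_def carrier_cubical by blast
    have "cubcl RX r (sbd (Suc r) b) = cubcl RX r (cellc dirs cls a)"
      using b(2) unfolding Phi_eq[OF a'(1)] cubical_boundary_cubcl[OF b(1)] by simp
    then have *: "sbd (Suc r) b - cellc dirs cls a \<in> chains (relc (Suc r - 1) RX {})"
      unfolding cubcl_eq unfolding degenerate_chains_eq diff_Suc_1 .
    have a'': "a \<in> chains {x \<in> cubes. Suc (card (dirs x)) = Suc r}" using a'(1) unfolding cells[symmetric] by simp
    from cell_exactD[OF exact b(1) a'' a'(2) *] obtain e where
      e: "e \<in> chains (kcubes k \<Lambda> (Suc r))" "kbd dirs face e = a"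
      unfolding cells by metis
    then have "a = kboundary \<Lambda> (Suc r) e" using kboundary_eq[OF e(1)] by simp
    then show "a \<in> boundary_set (kchain_group k \<Lambda>) (kboundary \<Lambda>) r"
      unfolding boundary_set_def carrier_kchain using e(1) by blast
  qed
qed

end

section \<open>Naturality\<close>

locale kgraph_hom = S: k_graph k \<Lambda> + T: k_graph k \<Gamma>
  for k :: nat and \<Lambda> :: "'a kgraph" and \<Gamma> :: "'b kgraph" +
  fixes \<theta> :: "'a \<Rightarrow> 'b"
  assumes morphism: "kgraph_morphism \<Lambda> \<Gamma> \<theta>"
begin

lemma theta:
  assumes "x \<in> Mor \<Lambda>"
  shows theta_Mor: "\<theta> x \<in> Mor \<Gamma>" and theta_src: "\<theta> (src \<Lambda> x) = src \<Gamma> (\<theta> x)"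
    and theta_rng: "\<theta> (rng \<Lambda> x) = rng \<Gamma> (\<theta> x)" and theta_deg: "deg \<Gamma> (\<theta> x) = deg \<Lambda> x"
  using morphism assms unfolding kgraph_morphism_def by blast+

lemma theta_cmp:
  "\<lbrakk>x \<in> Mor \<Lambda>; y \<in> Mor \<Lambda>; src \<Lambda> x = rng \<Lambda> y\<rbrakk> \<Longrightarrow> \<theta> (cmp \<Lambda> x y) = cmp \<Gamma> (\<theta> x) (\<theta> y)"
  using morphism unfolding kgraph_morphism_def by blast

lemma theta_seg:
  assumes x: "x \<in> Mor \<Lambda>" and le: "\<And>i. m i \<le> n i" "\<And>i. n i \<le> deg \<Lambda> x i"
  shows "\<theta> (seg \<Lambda> x m n) = seg \<Gamma> (\<theta> x) m n"
proof -
  obtain a b c where abc: "a \<in> Mor \<Lambda>" "b \<in> Mor \<Lambda>" "c \<in> Mor \<Lambda>" "src \<Lambda> a = rng \<Lambda> b" "src \<Lambda> b = rng \<Lambda> c"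
    "x = cmp \<Lambda> a (cmp \<Lambda> b c)" "deg \<Lambda> a = m" "deg \<Lambda> b = (\<lambda>i. n i - m i)" "seg \<Lambda> x m n = b"
    by (rule S.seg_decomp[OF x le])
  have bc: "cmp \<Lambda> b c \<in> Mor \<Lambda>" "src \<Lambda> a = rng \<Lambda> (cmp \<Lambda> b c)"
    using S.cmp_closed[OF abc(2,3,5)] S.rng_cmp[OF abc(2,3,5)] abc(4) by simp_all
  have "\<theta> x = cmp \<Gamma> (\<theta> a) (cmp \<Gamma> (\<theta> b) (\<theta> c))"
    unfolding abc(6) theta_cmp[OF abc(1) bc] theta_cmp[OF abc(2,3,5)] ..
  then have "seg \<Gamma> (\<theta> x) m n = \<theta> b"
  proof (rule T.seg_eqI[OF theta_Mor[OF abc(1)] theta_Mor[OF abc(2)] theta_Mor[OF abc(3)], rotated 2])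
    show "src \<Gamma> (\<theta> a) = rng \<Gamma> (\<theta> b)" "src \<Gamma> (\<theta> b) = rng \<Gamma> (\<theta> c)"
      using theta_src[OF abc(1)] theta_rng[OF abc(2)] theta_src[OF abc(2)] theta_rng[OF abc(3)] abc(4,5) by simp_all
    show "m = deg \<Gamma> (\<theta> a)" using theta_deg[OF abc(1)] abc(7) by simp
    show "n = (\<lambda>i. deg \<Gamma> (\<theta> a) i + deg \<Gamma> (\<theta> b) i)"
      using theta_deg[OF abc(1)] theta_deg[OF abc(2)] abc(7,8) le(1) by (simp add: fun_eq_iff)
  qed
  then show ?thesis using abc(9) by simp
qed

lemma theta_kcubes: "x \<in> kcubes k \<Lambda> r \<Longrightarrow> \<theta> x \<in> kcubes k \<Gamma> r"
  by (simp add: kcubes_def theta_Mor theta_deg)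

lemma theta_dir: "x \<in> Mor \<Lambda> \<Longrightarrow> dir \<Gamma> (\<theta> x) j = dir \<Lambda> x j"
  by (simp add: dir_def theta_deg)

lemma theta_kface:
  assumes "x \<in> kcubes k \<Lambda> r" "j < r" shows "\<theta> (kface \<Lambda> l j x) = kface \<Gamma> l j (\<theta> x)"
proof -
  have x: "x \<in> S.cubes" "x \<in> Mor \<Lambda>" using S.kcubesD[OF assms(1)] S.cubes_Mor by blast+
  note b = S.face_bounds[OF x(1) S.dir_in(1)[OF assms]]
  show ?thesis
    unfolding kface_def theta_dir[OF x(2)] theta_deg[OF x(2)]
    using theta_seg[OF x(2), of "\<lambda>i. 0" "\<lambda>i. deg \<Lambda> x i - unit_vec (dir \<Lambda> x j) i"]
      theta_seg[OF x(2), of "unit_vec (dir \<Lambda> x j)" "deg \<Lambda> x"] b by simp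
qed

abbreviation pushk :: "('a \<Rightarrow>\<^sub>0 int) \<Rightarrow> ('b \<Rightarrow>\<^sub>0 int)" where
  "pushk \<equiv> frag_extend (frag_of \<circ> \<theta>)"

lemma pushk_chains: "a \<in> chains (kcubes k \<Lambda> r) \<Longrightarrow> pushk a \<in> chains (kcubes k \<Gamma> r)"
  by (erule chains_extend) (simp add: theta_kcubes)

lemma pushk_kboundary:
  assumes "a \<in> chains (kcubes k \<Lambda> r)" shows "pushk (kboundary \<Lambda> r a) = kboundary \<Gamma> r (pushk a)"
  unfolding kboundary_def frag_extend_extend
proof (rule frag_extend_eq_on[OF assms])
  fix x assume x: "x \<in> kcubes k \<Lambda> r"
  show "pushk (\<Sum>l\<in>{0, 1}. \<Sum>j<r. frag_cmul ((- 1) ^ (Suc j + l)) (frag_of (kface \<Lambda> l j x)))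
    = frag_extend (\<lambda>y. \<Sum>l\<in>{0, 1}. \<Sum>j<r. frag_cmul ((- 1) ^ (Suc j + l)) (frag_of (kface \<Gamma> l j y))) ((frag_of \<circ> \<theta>) x)"
    unfolding frag_extend_sum' frag_extend_cmul o_def frag_extend_of
    by (intro sum.cong refl) (simp add: theta_kface[OF x])
qed

lemma pushk_chain_map:
  "chain_complex_map (kchain_group k \<Lambda>) (kboundary \<Lambda>) (kchain_group k \<Gamma>) (kboundary \<Gamma>) (\<lambda>r. pushk)"
proof (rule chain_complex_map.intro[OF S.kgraph_chain_complex T.kgraph_chain_complex], rule chain_complex_map_axioms.intro)
  show "pushk \<in> hom (kchain_group k \<Lambda> n) (kchain_group k \<Gamma> n)" for n
  proof (rule homI)
    show "pushk x \<in> carrier (kchain_group k \<Gamma> n)" if "x \<in> carrier (kchain_group k \<Lambda> n)" for x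
      using that unfolding S.carrier_kchain T.carrier_kchain by (rule pushk_chains)
  qed (simp add: kchain_group_def frag_extend_add)
qed (simp only: S.carrier_kchain pushk_kboundary)

text \<open>Morphisms preserve degrees and segments, hence normal forms; therefore the map of realisations is
  well defined on classes.\<close>

lemma theta_normal_form:
  assumes "x \<in> Mor \<Lambda>" "t \<in> deg_box (deg \<Lambda> x)"
  shows "T.normal_form (\<theta> x) t = map_prod \<theta> id (S.normal_form x t)"
proof -
  have "t i \<le> real (deg \<Lambda> x i)" for i using assms(2) by (simp add: deg_box_def)
  then have "nat \<lceil>t i\<rceil> \<le> deg \<Lambda> x i" for i by (simp add: nat_le_iff ceiling_le_iff)
  moreover have "nat \<lfloor>t i\<rfloor> \<le> nat \<lceil>t i\<rceil>" for i by (rule nat_mono) (rule floor_le_ceiling)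
  ultimately show ?thesis
    unfolding S.normal_form_def T.normal_form_def
    using theta_seg[OF assms(1), of "\<lambda>i. nat \<lfloor>t i\<rfloor>" "\<lambda>i. nat \<lceil>t i\<rceil>"] by simp
qed

abbreviation "F \<equiv> realisation_map k \<Gamma> \<theta>"

lemma theta_pre_top: "(x, t) \<in> topspace S.pre \<Longrightarrow> (\<theta> x, t) \<in> topspace T.pre"
  unfolding S.pre_top T.pre_top using theta_Mor theta_deg by auto

lemma realisation_map_cls:
  assumes x: "x \<in> Mor \<Lambda>" "t \<in> deg_box (deg \<Lambda> x)" shows "F (S.cls x t) = T.cls (\<theta> x) t"
proof -
  have xt: "(x, t) \<in> topspace S.pre" using x by (simp add: S.pre_top)
  have "T.cls (\<theta> y) s = T.cls (\<theta> x) t" if ys: "(y, s) \<in> S.cls x t" for y s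
  proof -
    have ys': "(y, s) \<in> topspace S.pre" "S.normal_form x t = S.normal_form y s"
      using ys unfolding realisation_class_def Image_singleton_iff S.rel_iff by simp_all
    then have "T.normal_form (\<theta> y) s = T.normal_form (\<theta> x) t"
      using theta_normal_form[OF x] theta_normal_form[of y s] unfolding S.pre_top by simp
    then show ?thesis using T.cls_eq_iff[OF theta_pre_top[OF ys'(1)] theta_pre_top[OF xt]] by simp
  qed
  then have const: "(\<lambda>(y, s). T.cls (\<theta> y) s) q = T.cls (\<theta> x) t" if "q \<in> S.cls x t" for q
    using that by (cases q) simp
  have "(x, t) \<in> S.cls x t"
    unfolding realisation_class_def Image_singleton_iff S.rel_iff using xt by simp
  then have "(\<lambda>(y, s). T.cls (\<theta> y) s) ` S.cls x t = {T.cls (\<theta> x) t}"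
    using image_constant[of "(x, t)" "S.cls x t" "T.cls (\<theta> x) t"] by (simp only: image_cong[OF refl const])
  then show ?thesis unfolding realisation_map_def by simp
qed

lemma realisation_map_cont: "continuous_map S.RX T.RX F"
proof -
  have img: "F p \<in> topspace T.RX" if p: "p \<in> topspace S.RX" for p
  proof -
    obtain x t where xt: "x \<in> Mor \<Lambda>" "t \<in> deg_box (deg \<Lambda> x)" "p = S.cls x t" by (rule S.RX_cases[OF p])
    show ?thesis
      unfolding xt(3) realisation_map_cls[OF xt(1,2)]
      by (rule T.cls_top[OF theta_Mor[OF xt(1)]]) (simp add: theta_deg[OF xt(1)] xt(2))
  qed
  have "openin S.RX {p \<in> topspace S.RX. F p \<in> U}" if U: "openin T.RX U" for U
    unfolding S.RX_open
  proof (intro conjI ballI)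
    fix x assume x: "x \<in> Mor \<Lambda>"
    have eq: "{t \<in> deg_box (deg \<Lambda> x). S.cls x t \<in> {p \<in> topspace S.RX. F p \<in> U}}
      = {t \<in> deg_box (deg \<Gamma> (\<theta> x)). T.cls (\<theta> x) t \<in> U}"
      using realisation_map_cls[OF x] S.cls_top[OF x] theta_deg[OF x] by auto
    have "openin (top_of_set (deg_box (deg \<Gamma> (\<theta> x)))) {t \<in> deg_box (deg \<Gamma> (\<theta> x)). T.cls (\<theta> x) t \<in> U}"
      using U[unfolded T.RX_open] theta_Mor[OF x] by (elim conjE) (rule bspec)
    then show "openin (top_of_set (deg_box (deg \<Lambda> x))) {t \<in> deg_box (deg \<Lambda> x). S.cls x t \<in> {p \<in> topspace S.RX. F p \<in> U}}"
      unfolding eq unfolding theta_deg[OF x] .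
  qed blast
  then show ?thesis unfolding continuous_map_def using img by blast
qed

lemma push_iota:
  assumes x: "x \<in> kcubes k \<Lambda> r" shows "push r F (iota k \<Lambda> r x) = iota k \<Gamma> r (\<theta> x)"
proof (rule ext)
  fix t
  have x': "x \<in> S.cubes" "x \<in> Mor \<Lambda>" "finite (S.dirs x)" "card (S.dirs x) = r"
    using S.kcubesD[OF x] S.cubes_Mor by blast+
  show "push r F (iota k \<Lambda> r x) t = iota k \<Gamma> r (\<theta> x) t"
  proof (cases "t \<in> unit_cube r")
    case True
    have "emb (S.dirs x) t \<in> deg_box (deg \<Lambda> x)"
      using emb_box[OF x'(3)] True x'(4) S.cubes_box[OF x'(1)] by simp
    from realisation_map_cls[OF x'(2) this]
    show ?thesis
      using True by (simp add: push_def iota_def theta_dir[OF x'(2)] S.dir_point[OF x])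
  qed (simp add: push_def iota_def)
qed

lemma Phi_natural:
  assumes a: "a \<in> chains (kcubes k \<Lambda> r)"
  shows "Phi k \<Gamma> r (pushk a) = cubical_chain_map T.RX F r (Phi k \<Lambda> r a)"
proof -
  have "cubical_chain_map T.RX F r (Phi k \<Lambda> r a) = cubcl T.RX r (pushc r F (cellc S.dirs S.cls a))"
    unfolding S.Phi_eq[OF a] by (rule cubical_chain_map_cubcl[OF realisation_map_cont S.cellc_RX[OF a]])
  also have "pushc r F (cellc S.dirs S.cls a) = cellc T.dirs T.cls (pushk a)"
    unfolding pushc_def cellc_def frag_extend_extend
  proof (rule frag_extend_eq_on[OF a])
    fix x assume x: "x \<in> kcubes k \<Lambda> r"
    show "frag_extend (\<lambda>T. frag_of (push r F T)) (frag_of (cell_cube S.dirs S.cls x))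
      = frag_extend (\<lambda>x. frag_of (cell_cube T.dirs T.cls x)) ((frag_of \<circ> \<theta>) x)"
      using push_iota[OF x] S.iota_eq[OF x] T.iota_eq[OF theta_kcubes[OF x]] by simp
  qed
  also have "cubcl T.RX r (cellc T.dirs T.cls (pushk a)) = Phi k \<Gamma> r (pushk a)"
    by (rule T.Phi_eq[OF pushk_chains[OF a], symmetric])
  finally show ?thesis by (rule sym)
qed

text \<open>Both sides are evaluated on a representing cycle, where they agree by \<open>Phi_natural\<close>.\<close>

theorem Phi_star_natural:
  assumes c: "c \<in> carrier (kgraph_homology k \<Lambda> r)"
  shows "Phi_star k \<Gamma> r (kgraph_homology_map k \<Gamma> \<theta> r c) = cubical_homology_map T.RX F r (Phi_star k \<Lambda> r c)"
proof -
  interpret PS: chain_complex_map "kchain_group k \<Lambda>" "kboundary \<Lambda>" "cubical_chain_group S.RX" "cubical_boundary S.RX" "Phi k \<Lambda>"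
    by (rule S.Phi_chain_map)
  interpret PT: chain_complex_map "kchain_group k \<Gamma>" "kboundary \<Gamma>" "cubical_chain_group T.RX" "cubical_boundary T.RX" "Phi k \<Gamma>"
    by (rule T.Phi_chain_map)
  interpret K: chain_complex_map "kchain_group k \<Lambda>" "kboundary \<Lambda>" "kchain_group k \<Gamma>" "kboundary \<Gamma>" "\<lambda>r. pushk"
    by (rule pushk_chain_map)
  interpret C: chain_complex_map "cubical_chain_group S.RX" "cubical_boundary S.RX" "cubical_chain_group T.RX" "cubical_boundary T.RX" "cubical_chain_map T.RX F"
    by (rule cubical_chain_map[OF realisation_map_cont])
  obtain z where z: "z \<in> PS.S.cycles r" "c = boundary_set (kchain_group k \<Lambda>) (kboundary \<Lambda>) r #>\<^bsub>kchain_group k \<Lambda> r\<^esub> z"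
    using c unfolding kgraph_homology_def PS.S.homology_carrier by blast
  have "z \<in> chains (kcubes k \<Lambda> r)" using z(1) unfolding PS.S.cycles_iff S.carrier_kchain by simp
  note nat = Phi_natural[OF this]
  show ?thesis
    unfolding Phi_star_def kgraph_homology_map_def cubical_homology_map_def z(2)
      K.homology_map_class[OF z(1)] PS.homology_map_class[OF z(1)]
      PT.homology_map_class[OF K.f_cycles[OF z(1)]] C.homology_map_class[OF PS.f_cycles[OF z(1)]] nat ..
qed

end

theorem theorem6p3:
  fixes k r :: nat and \<Lambda> :: "'a kgraph"
  assumes "k_graph k \<Lambda>"
  shows "Phi_star k \<Lambda> r \<in> iso (kgraph_homology k \<Lambda> r) (cubical_homology (realisation k \<Lambda>) r) \<and>
    (\<forall>(\<Gamma> :: 'b kgraph) \<theta>. k_graph k \<Gamma> \<and> kgraph_morphism \<Lambda> \<Gamma> \<theta> \<longrightarrow>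
       (\<forall>c \<in> carrier (kgraph_homology k \<Lambda> r).
          Phi_star k \<Gamma> r (kgraph_homology_map k \<Gamma> \<theta> r c) =
          cubical_homology_map (realisation k \<Gamma>) (realisation_map k \<Gamma> \<theta>) r (Phi_star k \<Lambda> r c)))"
proof (intro conjI allI impI ballI)
  show "Phi_star k \<Lambda> r \<in> iso (kgraph_homology k \<Lambda> r) (cubical_homology (realisation k \<Lambda>) r)"
    by (rule k_graph.Phi_star_iso[OF assms])
  fix \<Gamma> :: "'b kgraph" and \<theta> c
  assume G: "k_graph k \<Gamma> \<and> kgraph_morphism \<Lambda> \<Gamma> \<theta>" and c: "c \<in> carrier (kgraph_homology k \<Lambda> r)"
  interpret kgraph_hom k \<Lambda> \<Gamma> \<theta>
    using assms G by (simp add: kgraph_hom_def kgraph_hom_axioms_def)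
  show "Phi_star k \<Gamma> r (kgraph_homology_map k \<Gamma> \<theta> r c) =
    cubical_homology_map (realisation k \<Gamma>) (realisation_map k \<Gamma> \<theta>) r (Phi_star k \<Lambda> r c)"
    by (rule Phi_star_natural[OF c])
qed

end
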